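(* Let $T$ be a tree. The face ring $k[\Delta_\Gamma(T)]$ of the Gallai simplicial complex $\Delta_\Gamma(T)$ associated to $T$ is Cohen-Macaulay.
   Context: Let $G$ be a finite simple graph with vertex set $V(G)=[n]=\{1,\dots,n\}$ and edge set $E(G)$; write $e_{i,j}=\{i,j\}$ for an edge. A tree is a connected finite simple graph without cycles. The Gallai graph $\Gamma(G)$ is the graph whose vertex set is $E(G)$; two distinct edges of $G$ are adjacent in $\Gamma(G)$ if they are incident in $G$ (share a vertex) but do not span a triangle in $G$. The set of Gallai-indices $\Omega(G)$ is the collection of the following subsets of $V(G)$: $F_{i,j,k}=\{i,j,k\}$ whenever $e_{i,j}$ and $e_{j,k}$ are adjacent in $\Gamma(G)$, and $F_{i,j}=\{i,j\}$ whenever $e_{i,j}$ is an isolated vertex of $\Gamma(G)$. The Gallai simplicial complex of $G$ is the simplicial complex $\Delta_\Gamma(G)=\langle F\mid F\in\Omega(G)\rangle$ over $V(G)$, i.e. the complex consisting of all subsets of members of $\Omega(G)$. Face ring: for a simplicial complex $\Delta$ over $[n]$ and $S=k[x_1,\dots,x_n]$ over an infinite field $k$, $k[\Delta]=S/I_{\mathcal{N}}(\Delta)$, where $I_{\mathcal{N}}(\Delta)$ is generated by the square-free monomials $x_{j_1}\cdots x_{j_s}$ with $\{j_1,\dots,j_s\}\subset[n]$ not a face of $\Delta$. *)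

theory Defs
  imports "HOL-Algebra.QuotRing" "HOL-Algebra.Ring_Divisibility"
    "HOL-Library.Poly_Mapping" "HOL-Library.Extended_Nat"
begin

section \<open>Graphs and trees\<close>

type_synonym 'a ugraph = "'a set \<times> 'a set set"

definition verts :: "'a ugraph \<Rightarrow> 'a set" where
  "verts G = fst G"

definition edges :: "'a ugraph \<Rightarrow> 'a set set" where
  "edges G = snd G"

definition simple_graph :: "'a ugraph \<Rightarrow> bool" where
  "simple_graph G \<longleftrightarrow> finite (verts G) \<and> (\<forall>e\<in>edges G. e \<subseteq> verts G \<and> card e = 2)"

definition walk :: "'a ugraph \<Rightarrow> 'a list \<Rightarrow> bool" where
  "walk G xs \<longleftrightarrow> xs \<noteq> [] \<and> set xs \<subseteq> verts G \<and> successively (\<lambda>u v. {u, v} \<in> edges G) xs"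

definition graph_connected :: "'a ugraph \<Rightarrow> bool" where
  "graph_connected G \<longleftrightarrow> verts G \<noteq> {} \<and>
     (\<forall>u\<in>verts G. \<forall>v\<in>verts G. \<exists>xs. walk G xs \<and> hd xs = u \<and> last xs = v)"

definition graph_cycle :: "'a ugraph \<Rightarrow> 'a list \<Rightarrow> bool" where
  "graph_cycle G xs \<longleftrightarrow> walk G xs \<and> distinct xs \<and> 3 \<le> length xs \<and> {last xs, hd xs} \<in> edges G"

definition tree :: "'a ugraph \<Rightarrow> bool" where
  "tree G \<longleftrightarrow> simple_graph G \<and> graph_connected G \<and> (\<nexists>xs. graph_cycle G xs)"

definition isolated_vertex :: "'a ugraph \<Rightarrow> 'a \<Rightarrow> bool" where
  "isolated_vertex G v \<longleftrightarrow> v \<in> verts G \<and> (\<forall>e\<in>edges G. v \<notin> e)"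


section \<open>The Gallai graph and the Gallai simplicial complex\<close>

text \<open>Two distinct incident edges have exactly three vertices between them; they span a triangle
  if these are pairwise adjacent.\<close>

definition span_triangle :: "'a ugraph \<Rightarrow> 'a set \<Rightarrow> 'a set \<Rightarrow> bool" where
  "span_triangle G e f \<longleftrightarrow> (\<forall>i\<in>e \<union> f. \<forall>j\<in>e \<union> f. i \<noteq> j \<longrightarrow> {i, j} \<in> edges G)"

definition gallai_graph :: "'a ugraph \<Rightarrow> 'a set ugraph" where
  "gallai_graph G =
     (edges G, {{e, f} | e f. e \<in> edges G \<and> f \<in> edges G \<and> e \<noteq> f \<and> e \<inter> f \<noteq> {} \<and>
        \<not> span_triangle G e f})"

definition gallai_indices :: "'a ugraph \<Rightarrow> 'a set set" where
  "gallai_indices G =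
     {{i, j, k} | i j k. {{i, j}, {j, k}} \<in> edges (gallai_graph G)} \<union>
     {{i, j} | i j. isolated_vertex (gallai_graph G) {i, j}}"

definition gallai_complex :: "'a ugraph \<Rightarrow> 'a set set" where
  "gallai_complex G = {A. \<exists>F\<in>gallai_indices G. A \<subseteq> F}"


section \<open>Face rings\<close>

text \<open>A polynomial maps monomials, given by their exponent vectors, to coefficients;
  \<open>mpoly_ring V\<close> is the ring of polynomials in the variables \<open>x\<^sub>v\<close> with \<open>v \<in> V\<close>.\<close>

definition mpoly_ring :: "'v set \<Rightarrow> (('v \<Rightarrow>\<^sub>0 nat) \<Rightarrow>\<^sub>0 'k::comm_ring_1) ring" where
  "mpoly_ring V =
     \<lparr>carrier = {p. \<forall>m\<in>Poly_Mapping.keys p. Poly_Mapping.keys m \<subseteq> V},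
      mult = (*), one = 1, zero = 0, add = (+)\<rparr>"

definition mvar :: "'v \<Rightarrow> ('v \<Rightarrow>\<^sub>0 nat) \<Rightarrow>\<^sub>0 'k::comm_ring_1" where
  "mvar v = Poly_Mapping.single (Poly_Mapping.single v 1) 1"

text \<open>The empty set is a non-face of the void complex \<open>{}\<close> only; in that case the ideal below
  contains the empty product \<open>1\<close> and the face ring is the zero ring.\<close>

definition nonface_ideal :: "'v set \<Rightarrow> 'v set set \<Rightarrow> (('v \<Rightarrow>\<^sub>0 nat) \<Rightarrow>\<^sub>0 'k::comm_ring_1) set" where
  "nonface_ideal V \<Delta> = genideal (mpoly_ring V) {\<Prod>v\<in>W. mvar v | W. W \<subseteq> V \<and> W \<notin> \<Delta>}"

definition face_ring :: "'v set \<Rightarrow> 'v set set \<Rightarrow> (('v \<Rightarrow>\<^sub>0 nat) \<Rightarrow>\<^sub>0 'k::comm_ring_1) set ring" where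
  "face_ring V \<Delta> = mpoly_ring V Quot nonface_ideal V \<Delta>"


section \<open>Cohen-Macaulay rings\<close>

text \<open>We follow D. Eisenbud, Commutative Algebra with a View Toward Algebraic Geometry:
  codimension (Chapter 9), regular sequences and depth (Chapter 17), and Cohen-Macaulay rings
  (Chapter 18: \<open>depth(P, R) = codim P\<close> for every maximal ideal \<open>P\<close> of a Noetherian ring \<open>R\<close>).\<close>

text \<open>The second conjunct says that \<open>xs ! i\<close> is a nonzerodivisor on
  \<open>R / (xs ! 0, \<dots>, xs ! (i - 1))\<close>.\<close>

definition regular_sequence :: "('a, 'm) ring_scheme \<Rightarrow> 'a list \<Rightarrow> bool" where
  "regular_sequence R xs \<longleftrightarrow>
     set xs \<subseteq> carrier R \<and>
     (\<forall>i<length xs. \<forall>y\<in>carrier R.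
        xs ! i \<otimes>\<^bsub>R\<^esub> y \<in> genideal R (set (take i xs)) \<longrightarrow> y \<in> genideal R (set (take i xs))) \<and>
     genideal R (set xs) \<noteq> carrier R"

text \<open>Over a Noetherian ring all maximal regular sequences in a proper ideal have the same
  length, which is the supremum below.\<close>

definition ideal_depth :: "('a, 'm) ring_scheme \<Rightarrow> 'a set \<Rightarrow> enat" where
  "ideal_depth R I = Sup {enat (length xs) | xs. regular_sequence R xs \<and> set xs \<subseteq> I}"

text \<open>The codimension, or height, of a prime \<open>P\<close>, i.e. the Krull dimension of the localization
  at \<open>P\<close>: chains of primes \<open>Q 0 \<subset> \<dots> \<subset> Q l = P\<close>.\<close>

definition codimension :: "('a, 'm) ring_scheme \<Rightarrow> 'a set \<Rightarrow> enat" where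
  "codimension R P =
     Sup {enat l | l. \<exists>Q. (\<forall>i\<le>l. primeideal (Q i) R) \<and> (\<forall>i<l. Q i \<subset> Q (Suc i)) \<and> Q l = P}"

definition cohen_macaulay :: "('a, 'm) ring_scheme \<Rightarrow> bool" where
  "cohen_macaulay R \<longleftrightarrow>
     cring R \<and> noetherian_ring R \<and>
     (\<forall>P. maximalideal P R \<longrightarrow> ideal_depth R P = codimension R P)"

end

theory Submission
  imports Defs "HOL-Computational_Algebra.Polynomial"
begin

text \<open>Growing a tree \<open>T\<close> by one vertex \<open>l\<close> attached to \<open>v\<close> adds to the Gallai complex the facets
  \<open>{l, v, k}\<close> with \<open>k\<close> a neighbour of \<open>v\<close>, and adding these one by one is a shelling; for a single
  edge the complex is a simplex. So it suffices that the face ring \<open>R\<close> of a shellable complex with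
  facets of size \<open>d\<close> over an infinite field is Cohen-Macaulay, at all maximal ideals \<open>P\<close>.

  Depth at least \<open>d\<close>: by Zariski's lemma \<open>P\<close> contains \<open>g\<^sub>v = x\<^sub>v f\<^sub>v(x\<^sub>v)\<close> with \<open>f\<^sub>v \<noteq> 0\<close> for every
  vertex \<open>v\<close>. Choose distinct scalars \<open>a\<^sub>v\<close>. The \<open>d\<close> sums of the \<open>a\<^sub>v ^ j g\<^sub>v\<close>, \<open>j < d\<close>, form a
  regular sequence modulo the ideal of each facet, because a Vandermonde elimination makes them
  triangular with monic entries, and then on \<open>R\<close>, along the filtration given by the shelling.
  Codimension at most \<open>d\<close>: elements \<open>y\<^sub>i \<in> Q\<^sub>i\<^sub>+\<^sub>1 - Q\<^sub>i\<close> for a chain of primes are algebraically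
  independent, whereas the monomials supported on faces grow like a polynomial of degree \<open>d\<close>.
  Finally depth is at most codimension, since a nonzerodivisor lets one descend to a smaller prime.\<close>

subsection \<open>Weakly regular sequences\<close>

text \<open>The equality of depth and codimension is demanded at every maximal ideal, so homogeneous
  parameters, which need not lie in \<open>P\<close>, do not suffice: the sequence has to be found
  inside the given \<open>P\<close>. The field is merely infinite, hence \<open>P\<close> need not
  be the ideal of a point, and the role of \<open>x_v - c\<close> is taken by an arbitrary nonzero
  \<open>f_v(x_v)\<close> in \<open>P\<close>. The factor \<open>x_v\<close> in \<open>g_v\<close>
  reconciles this with the shelling. Modulo the ideal of a facet every \<open>g_v\<close> with
  \<open>v\<close> outside the facet vanishes, so one sequence of sums over all vertices turns into
  a sequence of sums over the facet, of length equal to the number of its vertices. The same factor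
  gives each \<open>g_v\<close> positive degree, so that in the elimination the other summands
  cannot disturb its leading coefficient. Quotient rings are avoided until the end: an ideal is an
  \<open>rmod.subspace\<close> of a fixed ring type, the ideal generated by a set is its
  \<open>rmod.span\<close>, and all notions are relative to such an ideal \<open>Q\<close>.\<close>

interpretation rmod: Modules.module "(*) :: 'a::comm_ring_1 \<Rightarrow> 'a \<Rightarrow> 'a"
  by unfold_locales (auto simp: algebra_simps)

declare rmod.scale_scale [simp del] \<comment> \<open>it would loop with \<open>mult.assoc\<close>\<close>

lemma subspace_add_right_iff: "rmod.subspace Q \<Longrightarrow> y \<in> Q \<Longrightarrow> x + y \<in> Q \<longleftrightarrow> x \<in> Q"
  using rmod.subspace_add[of Q x y] rmod.subspace_diff[of Q "x + y" y] by (auto simp del: rmod.span_eq_iff)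

text \<open>For an ideal \<open>Q\<close> this is the ideal \<open>Q + (x)\<close>; the explicit
  multiplier \<open>t\<close> makes the element chases below direct.\<close>

definition adjoin :: "'a::comm_ring_1 set \<Rightarrow> 'a \<Rightarrow> 'a set" where
  "adjoin Q x = {z. \<exists>t. z - x * t \<in> Q}"

lemma adjoinI: "z - x * t \<in> Q \<Longrightarrow> z \<in> adjoin Q x"
  unfolding adjoin_def by blast

lemma adjoinE:
  assumes "z \<in> adjoin Q x"
  obtains t where "z - x * t \<in> Q"
  using assms unfolding adjoin_def by blast

lemma adjoin_eq_span: "rmod.subspace Q \<Longrightarrow> adjoin Q x = rmod.span (insert x Q)"
  using rmod.span_eq_iff[of Q] by (simp add: adjoin_def rmod.span_breakdown_eq set_eq_iff mult.commute)

lemma subspace_adjoin: "rmod.subspace Q \<Longrightarrow> rmod.subspace (adjoin Q x)"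
  by (simp add: adjoin_eq_span)

lemma adjoin_commute: "adjoin (adjoin Q x) y = adjoin (adjoin Q y) x"
proof -
  have "adjoin (adjoin Q x) y \<subseteq> adjoin (adjoin Q y) x" for x y
  proof
    fix z assume "z \<in> adjoin (adjoin Q x) y"
    then obtain t u where "z - y * t - x * u \<in> Q" by (auto elim!: adjoinE)
    then have "z - x * u - y * t \<in> Q" by (simp add: algebra_simps)
    then show "z \<in> adjoin (adjoin Q y) x" by (intro adjoinI)
  qed
  then show ?thesis by blast
qed

lemma subset_adjoin: "Q \<subseteq> adjoin Q x"
  unfolding adjoin_def by (auto intro!: exI[of _ 0])

lemma adjoin_cong:
  assumes "rmod.subspace Q" "x - y \<in> Q"
  shows "adjoin Q x = adjoin Q y"
proof -
  have "z - x * t \<in> Q \<longleftrightarrow> z - y * t \<in> Q" for z t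
  proof -
    have "t * (x - y) \<in> Q" by (rule rmod.subspace_scale[OF assms])
    then have "z - x * t \<in> Q \<longleftrightarrow> (z - x * t) + t * (x - y) \<in> Q"
      by (rule subspace_add_right_iff[OF assms(1), symmetric])
    also have "(z - x * t) + t * (x - y) = z - y * t" by (simp add: algebra_simps)
    finally show ?thesis .
  qed
  then show ?thesis unfolding adjoin_def by auto
qed

definition nonzerodivisor_mod :: "'a::comm_ring_1 set \<Rightarrow> 'a \<Rightarrow> bool" where
  "nonzerodivisor_mod Q x \<longleftrightarrow> (\<forall>y. x * y \<in> Q \<longrightarrow> y \<in> Q)"

text \<open>Properness of the resulting ideal is left out: the void complex has the unit ideal, and
  for a sequence inside a prime containing \<open>Q\<close> properness is automatic.\<close>

primrec weakly_regular :: "'a::comm_ring_1 set \<Rightarrow> 'a list \<Rightarrow> bool" where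
  "weakly_regular Q [] = True"
| "weakly_regular Q (x # xs) \<longleftrightarrow> nonzerodivisor_mod Q x \<and> weakly_regular (adjoin Q x) xs"

section \<open>Invariance and reordering of weakly regular sequences\<close>

lemma nonzerodivisor_mod_cong:
  assumes "rmod.subspace Q" "x - y \<in> Q"
  shows "nonzerodivisor_mod Q x \<longleftrightarrow> nonzerodivisor_mod Q y"
proof -
  have "x * t \<in> Q \<longleftrightarrow> y * t \<in> Q" for t
  proof -
    have "t * (x - y) \<in> Q" by (rule rmod.subspace_scale[OF assms])
    then have "x * t - y * t \<in> Q" by (simp add: algebra_simps)
    then show ?thesis
      using rmod.subspace_add[OF assms(1), of "x * t - y * t" "y * t"]
        rmod.subspace_diff[OF assms(1), of "x * t" "x * t - y * t"] by auto
  qed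
  then show ?thesis unfolding nonzerodivisor_mod_def by auto
qed

lemma weakly_regular_cong:
  assumes "rmod.subspace Q" "list_all2 (\<lambda>x y. x - y \<in> Q) xs ys"
  shows "weakly_regular Q xs \<longleftrightarrow> weakly_regular Q ys"
  using assms
proof (induction xs arbitrary: ys Q)
  case (Cons x xs)
  then obtain y ys' where ys: "ys = y # ys'" "x - y \<in> Q" "list_all2 (\<lambda>x y. x - y \<in> Q) xs ys'"
    by (auto simp: list_all2_Cons1)
  have "list_all2 (\<lambda>u v. u - v \<in> adjoin Q y) xs ys'"
    by (rule list_all2_mono[OF ys(3)]) (use subset_adjoin in blast)
  then have "weakly_regular (adjoin Q y) xs \<longleftrightarrow> weakly_regular (adjoin Q y) ys'"
    by (rule Cons.IH[OF subspace_adjoin[OF Cons.prems(1)]])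
  then show ?case
    using nonzerodivisor_mod_cong[OF Cons.prems(1) ys(2)] adjoin_cong[OF Cons.prems(1) ys(2)] ys(1)
    by simp
qed simp

text \<open>The elimination step of a Vandermonde matrix: each entry loses \<open>c\<close> times
  its original predecessor, where \<open>p\<close> precedes the first entry.\<close>

primrec shift_list :: "'a::comm_ring_1 \<Rightarrow> 'a \<Rightarrow> 'a list \<Rightarrow> 'a list" where
  "shift_list c p [] = []"
| "shift_list c p (x # xs) = (x - c * p) # shift_list c x xs"

text \<open>Each correction is a multiple of an entry that has already been adjoined, or of
  \<open>p\<close>, which lies in \<open>Q\<close>; so neither the successive ideals nor the
  conditions modulo them change.\<close>

lemma weakly_regular_shift_list:
  assumes "rmod.subspace Q" "p \<in> Q"
  shows "weakly_regular Q (shift_list c p xs) \<longleftrightarrow> weakly_regular Q xs"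
  using assms
proof (induction xs arbitrary: p Q)
  case (Cons x xs)
  have "(x - c * p) - x \<in> Q"
    using rmod.subspace_neg[OF Cons.prems(1) rmod.subspace_scale[OF Cons.prems, of c]] by simp
  moreover have "x \<in> adjoin Q x"
    using rmod.subspace_0[OF Cons.prems(1)] by (intro adjoinI[of _ _ 1]) simp
  ultimately show ?case
    using Cons.IH[of "adjoin Q x" x] subspace_adjoin[OF Cons.prems(1)]
      nonzerodivisor_mod_cong[OF Cons.prems(1), of "x - c * p" x]
      adjoin_cong[OF Cons.prems(1), of "x - c * p" x]
    by simp
qed simp

text \<open>One half of exchanging a regular pair \<open>x, h\<close>. The other half, that
  \<open>h\<close> is a nonzerodivisor modulo \<open>Q\<close> itself, can fail in general and has
  to be supplied separately.\<close>

lemma nonzerodivisor_mod_adjoin_swap: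
  assumes Q: "rmod.subspace Q" and "nonzerodivisor_mod Q x" "nonzerodivisor_mod (adjoin Q x) h"
  shows "nonzerodivisor_mod (adjoin Q h) x"
  unfolding nonzerodivisor_mod_def
proof (intro allI impI)
  fix y assume "x * y \<in> adjoin Q h"
  then obtain s where s: "x * y - h * s \<in> Q" by (rule adjoinE)
  have "h * s - x * y \<in> Q" using rmod.subspace_neg[OF Q s] by simp
  then have "h * s \<in> adjoin Q x" by (rule adjoinI)
  then have "s \<in> adjoin Q x" using assms(3) by (simp add: nonzerodivisor_mod_def)
  then obtain u where u: "s - x * u \<in> Q" by (rule adjoinE)
  have "(x * y - h * s) + h * (s - x * u) \<in> Q"
    by (rule rmod.subspace_add[OF Q s rmod.subspace_scale[OF Q u]])
  then have "x * (y - h * u) \<in> Q" by (simp add: algebra_simps)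
  then have "y - h * u \<in> Q" using assms(2) by (simp add: nonzerodivisor_mod_def)
  then show "y \<in> adjoin Q h" by (rule adjoinI)
qed

text \<open>\<open>h\<close> travels to the front by successive exchanges with its left neighbour.
  Each exchange requires \<open>h\<close> to be a nonzerodivisor at that place, which is why the
  hypothesis covers all prefixes.\<close>

lemma weakly_regular_Cons_front:
  assumes "rmod.subspace Q" "weakly_regular Q xs"
    and "\<And>i. i \<le> length xs \<Longrightarrow> nonzerodivisor_mod (foldl adjoin Q (take i xs)) h"
  shows "weakly_regular Q (h # xs)"
  using assms
proof (induction xs arbitrary: Q)
  case Nil
  then show ?case by simp
next
  case (Cons x xs)
  have "weakly_regular (adjoin Q x) (h # xs)"
    using Cons.prems(2) Cons.prems(3)[of "Suc _"] subspace_adjoin[OF Cons.prems(1)]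
    by (intro Cons.IH) auto
  moreover have "nonzerodivisor_mod Q h" using Cons.prems(3)[of 0] by simp
  ultimately show ?case
    using nonzerodivisor_mod_adjoin_swap[of Q x h] Cons.prems(1,2) adjoin_commute[of Q x h] by simp
qed

text \<open>Multiplication by \<open>m\<close> identifies \<open>A / K\<close> with \<open>J / I\<close>, the kernel of \<open>A / I \<rightarrow> A / J\<close>.\<close>

lemma weakly_regular_filtration:
  fixes I J K :: "'a::comm_ring_1 set"
  assumes "rmod.subspace I" "rmod.subspace K"
    and J: "J = adjoin I m"
    and colon: "\<And>s. m * s \<in> I \<longleftrightarrow> s \<in> K"
    and "weakly_regular J xs" "weakly_regular K xs"
  shows "weakly_regular I xs"
  using assms
proof (induction xs arbitrary: I J K)
  case (Cons x xs)
  note I = Cons.prems(1) and K = Cons.prems(2) and colon = Cons.prems(4)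
  have regJ: "\<And>y. x * y \<in> J \<Longrightarrow> y \<in> J" and regK: "\<And>y. x * y \<in> K \<Longrightarrow> y \<in> K"
    using Cons.prems(5,6) by (auto simp: nonzerodivisor_mod_def)
  have decomp: "\<exists>s. y - m * s \<in> I" if "y \<in> J" for y
    using that Cons.prems(3) by (simp add: adjoin_def)
  have compose: "y \<in> J" if "y - m * s \<in> I" for y s
    using that unfolding Cons.prems(3) by (rule adjoinI)
  have "nonzerodivisor_mod I x"
    unfolding nonzerodivisor_mod_def
  proof (intro allI impI)
    fix y assume xy: "x * y \<in> I"
    then have "y \<in> J" using regJ compose[of "x * y" 0] by simp
    then obtain s where s: "y - m * s \<in> I" using decomp by blast
    have "x * y - x * (y - m * s) \<in> I"
      by (rule rmod.subspace_diff[OF I xy rmod.subspace_scale[OF I s]])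
    then have "m * (x * s) \<in> I" by (simp add: algebra_simps)
    then have "m * s \<in> I" using colon regK by blast
    then show "y \<in> I" using rmod.subspace_add[OF I s, of "m * s"] by simp
  qed
  moreover have "weakly_regular (adjoin I x) xs"
  proof (rule Cons.IH[of _ "adjoin K x" "adjoin J x"])
    show "adjoin J x = adjoin (adjoin I x) m" using adjoin_commute Cons.prems(3) by blast
    fix s
    \<comment> \<open>The identification survives adjoining \<open>x\<close> because
      \<open>x\<close> is a nonzerodivisor modulo \<open>J\<close>: in \<open>m * s = x * t\<close>
      modulo \<open>I\<close>, the factor \<open>t\<close> must itself be a multiple of
      \<open>m\<close> modulo \<open>I\<close>.\<close>
    show "m * s \<in> adjoin I x \<longleftrightarrow> s \<in> adjoin K x"
    proof
      assume "m * s \<in> adjoin I x"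
      then obtain t where t: "m * s - x * t \<in> I" by (rule adjoinE)
      have "- (m * s - x * t) \<in> I" using t by (rule rmod.subspace_neg[OF I])
      then have "x * t - m * s \<in> I" by simp
      then have "t \<in> J" using compose regJ by blast
      then obtain s' where s': "t - m * s' \<in> I" using decomp by blast
      have "(m * s - x * t) + x * (t - m * s') \<in> I"
        by (rule rmod.subspace_add[OF I t rmod.subspace_scale[OF I s']])
      then have "m * (s - x * s') \<in> I" by (simp add: algebra_simps)
      then show "s \<in> adjoin K x" unfolding colon by (rule adjoinI)
    next
      assume "s \<in> adjoin K x"
      then obtain t where "s - x * t \<in> K" by (rule adjoinE)
      then have "m * (s - x * t) \<in> I" using colon by blast
      then have "m * s - x * (m * t) \<in> I" by (simp add: algebra_simps)
      then show "m * s \<in> adjoin I x" by (rule adjoinI)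
    qed
  qed (use Cons.prems subspace_adjoin in auto)
  ultimately show ?case by simp
qed simp

section \<open>Comparison with generated ideals\<close>

lemma foldl_adjoin_eq_span:
  "rmod.subspace Q \<Longrightarrow> foldl adjoin Q xs = rmod.span (Q \<union> set xs)"
proof (induction xs arbitrary: Q)
  case (Cons x xs)
  have "rmod.span (rmod.span (insert x Q) \<union> set xs) = rmod.span (Q \<union> set (x # xs))"
  proof (rule rmod.span_subspace)
    have "rmod.span (insert x Q) \<subseteq> rmod.span (Q \<union> set (x # xs))" by (rule rmod.span_mono) auto
    then show "rmod.span (insert x Q) \<union> set xs \<subseteq> rmod.span (Q \<union> set (x # xs))"
      using rmod.span_superset[of "Q \<union> set (x # xs)"] by auto
    have "insert x Q \<subseteq> rmod.span (insert x Q)" by (rule rmod.span_superset)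
    then show "rmod.span (Q \<union> set (x # xs)) \<subseteq> rmod.span (rmod.span (insert x Q) \<union> set xs)"
      by (intro rmod.span_mono) auto
  qed auto
  then show ?case using Cons.IH[OF subspace_adjoin[OF Cons.prems]] adjoin_eq_span[OF Cons.prems] by simp
next
  case Nil
  then show ?case using rmod.span_eq_iff[of Q] by (simp add: eq_commute)
qed

lemma weakly_regular_iff_nth:
  "weakly_regular Q xs \<longleftrightarrow>
     (\<forall>i<length xs. nonzerodivisor_mod (foldl adjoin Q (take i xs)) (xs ! i))"
proof (induction xs arbitrary: Q)
  case (Cons x xs)
  show ?case by (simp add: Cons.IH All_less_Suc2)
qed simp

lemma subspace_foldl_adjoin: "rmod.subspace Q \<Longrightarrow> rmod.subspace (foldl adjoin Q xs)"
  by (simp add: foldl_adjoin_eq_span)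

lemma weakly_regular_UNIV: "weakly_regular UNIV xs"
proof (induction xs)
  case (Cons x xs)
  have "adjoin UNIV x = UNIV" by (simp add: adjoin_def)
  then show ?case using Cons by (simp add: nonzerodivisor_mod_def)
qed simp

subsection \<open>Prime ideals\<close>

definition prime_set :: "'a::comm_ring_1 set \<Rightarrow> bool" where
  "prime_set P \<longleftrightarrow> rmod.subspace P \<and> 1 \<notin> P \<and> (\<forall>x y. x * y \<in> P \<longrightarrow> x \<in> P \<or> y \<in> P)"

lemma prime_setD:
  assumes "prime_set P"
  shows "rmod.subspace P" "1 \<notin> P" "x * y \<in> P \<Longrightarrow> x \<in> P \<or> y \<in> P"
  using assms unfolding prime_set_def by blast+

text \<open>An ideal \<open>P\<close> that is maximal among those containing \<open>I\<close> and
  avoiding \<open>S\<close> is prime: if neither \<open>x\<close> nor \<open>y\<close> lies in it,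
  then \<open>P + (x)\<close> and \<open>P + (y)\<close> both meet \<open>S\<close>, and the product
  of the two elements of \<open>S\<close> would fall into \<open>P\<close> as soon as
  \<open>x * y\<close> does.\<close>

lemma prime_set_disjoint:
  fixes I S :: "'a::comm_ring_1 set"
  assumes "rmod.subspace I" "1 \<in> S" "\<And>x y. x \<in> S \<Longrightarrow> y \<in> S \<Longrightarrow> x * y \<in> S" "I \<inter> S = {}"
  obtains P where "prime_set P" "I \<subseteq> P" "P \<inter> S = {}"
proof -
  define \<A> where "\<A> = {Q. rmod.subspace Q \<and> I \<subseteq> Q \<and> Q \<inter> S = {}}"
  have "\<exists>M\<in>\<A>. \<forall>X\<in>\<A>. M \<subseteq> X \<longrightarrow> X = M"
  proof (rule subset_Zorn_nonempty)
    show "\<A> \<noteq> {}" using assms(1,4) by (auto simp: \<A>_def)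
    fix C assume C: "C \<noteq> {}" "subset.chain \<A> C"
    have CA: "C \<subseteq> \<A>" and lin: "\<And>X Y. X \<in> C \<Longrightarrow> Y \<in> C \<Longrightarrow> X \<subseteq> Y \<or> Y \<subseteq> X"
      using C(2) unfolding subset_chain_def by blast+
    have subC: "rmod.subspace X" if "X \<in> C" for X using that CA by (auto simp: \<A>_def)
    have "rmod.subspace (\<Union>C)"
    proof (rule rmod.subspaceI)
      obtain X where "X \<in> C" using C(1) by blast
      then show "0 \<in> \<Union>C" using rmod.subspace_0[OF subC] by (intro UnionI)
      show "x + y \<in> \<Union>C" if xy: "x \<in> \<Union>C" "y \<in> \<Union>C" for x y
      proof -
        obtain X Y where "X \<in> C" "x \<in> X" "Y \<in> C" "y \<in> Y" using xy by blast
        then obtain Z where "Z \<in> C" "x \<in> Z" "y \<in> Z" using lin[of X Y] by blast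
        then show ?thesis using rmod.subspace_add[OF subC, of Z x y] by blast
      qed
      show "c * x \<in> \<Union>C" if "x \<in> \<Union>C" for c x
        using that rmod.subspace_scale[OF subC, of _ x c] by blast
    qed
    then show "\<Union>C \<in> \<A>" using C(1) CA by (auto simp: \<A>_def)
  qed
  then obtain P where P: "P \<in> \<A>" and max: "\<forall>X\<in>\<A>. P \<subseteq> X \<longrightarrow> X = P" ..
  have subP: "rmod.subspace P" and "I \<subseteq> P" and disj: "P \<inter> S = {}" using P by (auto simp: \<A>_def)
  have meet: "\<exists>s\<in>S. \<exists>t. s - x * t \<in> P" if "x \<notin> P" for x
  proof -
    have "x \<in> adjoin P x" using rmod.subspace_0[OF subP] by (intro adjoinI[of _ _ 1]) simp
    then have "adjoin P x \<noteq> P" using that by blast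
    then have "adjoin P x \<notin> \<A>" using max subset_adjoin[of P x] by blast
    then have "adjoin P x \<inter> S \<noteq> {}"
      using subspace_adjoin[OF subP, of x] \<open>I \<subseteq> P\<close> subset_adjoin[of P x] unfolding \<A>_def by blast
    then show ?thesis by (auto simp: adjoin_def)
  qed
  have "x \<in> P \<or> y \<in> P" if xy: "x * y \<in> P" for x y
  proof (rule ccontr)
    assume "\<not> (x \<in> P \<or> y \<in> P)"
    then obtain s t s' t' where s: "s \<in> S" "s - x * t \<in> P" "s' \<in> S" "s' - y * t' \<in> P"
      using meet[of x] meet[of y] by blast
    have "s' * (s - x * t) + (x * t) * (s' - y * t') + (t * t') * (x * y) \<in> P"
      using rmod.subspace_scale[OF subP s(2), of s'] rmod.subspace_scale[OF subP s(4), of "x * t"]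
        rmod.subspace_scale[OF subP xy, of "t * t'"] rmod.subspace_add[OF subP] by presburger
    then have "s * s' \<in> P" by (simp add: algebra_simps)
    then show False using assms(3)[OF s(1,3)] disj by blast
  qed
  then have "prime_set P" using subP disj assms(2) unfolding prime_set_def by blast
  then show ?thesis using \<open>I \<subseteq> P\<close> disj by (rule that)
qed

lemma prime_set_power: "prime_set P \<Longrightarrow> x ^ n \<in> P \<Longrightarrow> x \<in> P"
  by (induction n) (auto simp: prime_set_def)

text \<open>The prime is found disjoint from the multiplicative set of all \<open>s * x ^ n\<close> with \<open>s \<notin> P\<close>.\<close>

lemma prime_set_below_nonzerodivisor:
  assumes "rmod.subspace I" "prime_set P" "I \<subseteq> P" "nonzerodivisor_mod I x"
  obtains Q where "prime_set Q" "I \<subseteq> Q" "Q \<subseteq> P" "x \<notin> Q"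
proof -
  define S where "S = {x ^ n * s | n s. s \<notin> P}"
  have "1 \<notin> P" using assms(2) by (simp add: prime_set_def)
  then have memS: "s \<in> S" if "s \<notin> P" for s
    using that by (auto simp: S_def intro!: exI[of _ "0::nat"])
  have "x \<in> S" using \<open>1 \<notin> P\<close> by (auto simp: S_def intro!: exI[of _ 1])
  have pow: "y \<in> I" if "x ^ n * y \<in> I" for n y
    using that assms(4) by (induction n) (simp_all add: nonzerodivisor_mod_def mult.assoc)
  have disj: "I \<inter> S = {}" using pow assms(3) by (auto simp: S_def)
  have mult: "u * v \<in> S" if uv: "u \<in> S" "v \<in> S" for u v
  proof -
    obtain n s m t where "u = x ^ n * s" "v = x ^ m * t" "s \<notin> P" "t \<notin> P"
      using uv by (auto simp: S_def)
    moreover from this have "s * t \<notin> P" using assms(2) unfolding prime_set_def by metis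
    moreover have "(x ^ n * s) * (x ^ m * t) = x ^ (n + m) * (s * t)" by (simp add: power_add mult_ac)
    ultimately show ?thesis
      unfolding S_def mem_Collect_eq by metis
  qed
  obtain Q where Q: "prime_set Q" "I \<subseteq> Q" "Q \<inter> S = {}"
    using prime_set_disjoint[OF assms(1) memS[OF \<open>1 \<notin> P\<close>] mult disj] .
  have "Q \<subseteq> P" "x \<notin> Q" using Q(3) memS \<open>x \<in> S\<close> by auto
  then show ?thesis using that[OF Q(1,2)] by simp
qed

text \<open>The chain is built downwards from \<open>P\<close>, whence the induction from the end of
  the list: the last entry is a nonzerodivisor modulo the earlier ones, so below \<open>P\<close>
  there is a prime that contains the earlier ones but misses the last.\<close>

lemma prime_chain_weakly_regular:
  assumes "rmod.subspace I" "weakly_regular I xs" "prime_set P" "I \<union> set xs \<subseteq> P"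
  shows "\<exists>Q. (\<forall>i\<le>length xs. prime_set (Q i) \<and> I \<subseteq> Q i) \<and> (\<forall>i<length xs. Q i \<subset> Q (Suc i)) \<and>
    Q (length xs) = P"
  using assms(2-4)
proof (induction xs arbitrary: P rule: rev_induct)
  case Nil
  then show ?case by (intro exI[of _ "\<lambda>_. P"]) auto
next
  case (snoc x xs)
  let ?J = "foldl adjoin I xs"
  have reg: "weakly_regular I xs" "nonzerodivisor_mod ?J x"
    using snoc.prems(1) by (auto simp: weakly_regular_iff_nth nth_append less_Suc_eq)
  have J: "?J = rmod.span (I \<union> set xs)" using foldl_adjoin_eq_span[OF assms(1)] by blast
  have "rmod.subspace P" using snoc.prems(2) unfolding prime_set_def by blast
  then have "?J \<subseteq> P" unfolding J using snoc.prems(3) by (intro rmod.span_minimal) auto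
  then obtain P' where P': "prime_set P'" "?J \<subseteq> P'" "P' \<subseteq> P" "x \<notin> P'"
    by (rule prime_set_below_nonzerodivisor[OF subspace_foldl_adjoin[OF assms(1)] snoc.prems(2) _ reg(2)])
  have "I \<union> set xs \<subseteq> P'" using P'(2) rmod.span_superset[of "I \<union> set xs"] unfolding J by blast
  from snoc.IH[OF reg(1) P'(1) this] obtain Q where Q: "\<forall>i\<le>length xs. prime_set (Q i) \<and> I \<subseteq> Q i"
      "\<forall>i<length xs. Q i \<subset> Q (Suc i)" "Q (length xs) = P'"
    by blast
  define Q' where "Q' = Q(Suc (length xs) := P)"
  have "prime_set (Q' i) \<and> I \<subseteq> Q' i" if "i \<le> Suc (length xs)" for i
    using that Q(1) snoc.prems(2,3) by (cases "i = Suc (length xs)") (simp_all add: Q'_def)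
  moreover have "Q' i \<subset> Q' (Suc i)" if "i < Suc (length xs)" for i
  proof (cases "i = length xs")
    case True
    have "x \<in> P" using snoc.prems(3) by simp
    then show ?thesis using True P'(3,4) Q(3) unfolding Q'_def by auto
  next
    case False
    then show ?thesis using that Q(2) unfolding Q'_def by simp
  qed
  moreover have "Q' (Suc (length xs)) = P" by (simp add: Q'_def)
  ultimately show ?case by (intro exI[of _ Q']) simp
qed

subsection \<open>Polynomials over a subring\<close>

definition subring_set :: "'a::comm_ring_1 set \<Rightarrow> bool" where
  "subring_set C \<longleftrightarrow> 1 \<in> C \<and> (\<forall>x\<in>C. \<forall>y\<in>C. x - y \<in> C \<and> x * y \<in> C)"

context
  fixes C :: "'a::comm_ring_1 set"
  assumes C: "subring_set C"
begin

lemma subring_set_1: "1 \<in> C"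
  and subring_set_diff: "x \<in> C \<Longrightarrow> y \<in> C \<Longrightarrow> x - y \<in> C"
  and subring_set_mult: "x \<in> C \<Longrightarrow> y \<in> C \<Longrightarrow> x * y \<in> C"
  using C by (simp_all add: subring_set_def)

lemma subring_set_0: "0 \<in> C"
  using subring_set_diff[OF subring_set_1 subring_set_1] by simp

lemma subring_set_uminus: "x \<in> C \<Longrightarrow> - x \<in> C"
  using subring_set_diff[OF subring_set_0, of x] by simp

lemma subring_set_add: "x \<in> C \<Longrightarrow> y \<in> C \<Longrightarrow> x + y \<in> C"
  using subring_set_diff[of x "- y"] subring_set_uminus by simp

lemma subring_set_power: "x \<in> C \<Longrightarrow> x ^ n \<in> C"
  by (induction n) (simp_all add: subring_set_1 subring_set_mult)

lemma subring_set_sum: "(\<And>i. i \<in> A \<Longrightarrow> f i \<in> C) \<Longrightarrow> sum f A \<in> C"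
  by (induction A rule: infinite_finite_induct) (simp_all add: subring_set_0 subring_set_add)

end

definition polys_over :: "'a::comm_ring_1 set \<Rightarrow> 'a poly set" where
  "polys_over C = {p. \<forall>i. coeff p i \<in> C}"

text \<open>The subring \<open>C[y]\<close> of the ambient ring. Since \<open>y\<close> may satisfy
  relations over \<open>C\<close>, the representing polynomial is not unique.\<close>

definition extend :: "'a::comm_ring_1 set \<Rightarrow> 'a \<Rightarrow> 'a set" where
  "extend C y = (\<lambda>p. poly p y) ` polys_over C"

context
  fixes C :: "'a::comm_ring_1 set"
  assumes C: "subring_set C"
begin

lemma subring_set_polys_over: "subring_set (polys_over C)"
  unfolding subring_set_def polys_over_def
  by (auto simp: coeff_mult coeff_pCons one_pCons subring_set_0[OF C] subring_set_1[OF C]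
      subring_set_diff[OF C] subring_set_mult[OF C] intro!: subring_set_sum[OF C] split: nat.splits)

lemma polys_over_monom: "a \<in> C \<Longrightarrow> monom a n \<in> polys_over C"
  by (simp add: polys_over_def subring_set_0[OF C])

lemma polys_over_smult: "a \<in> C \<Longrightarrow> p \<in> polys_over C \<Longrightarrow> smult a p \<in> polys_over C"
  by (simp add: polys_over_def subring_set_mult[OF C])

lemma subring_set_extend: "subring_set (extend C y)"
  unfolding subring_set_def
proof (intro conjI ballI)
  show "1 \<in> extend C y"
    unfolding extend_def using subring_set_1[OF subring_set_polys_over] by (intro image_eqI[of _ _ 1]) auto
  fix u v assume "u \<in> extend C y" "v \<in> extend C y"
  then obtain p q where pq: "p \<in> polys_over C" "u = poly p y" "q \<in> polys_over C" "v = poly q y"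
    by (auto simp: extend_def)
  show "u - v \<in> extend C y"
    unfolding extend_def using pq subring_set_diff[OF subring_set_polys_over]
    by (intro image_eqI[of _ _ "p - q"]) auto
  show "u * v \<in> extend C y"
    unfolding extend_def using pq subring_set_mult[OF subring_set_polys_over]
    by (intro image_eqI[of _ _ "p * q"]) auto
qed

lemma subset_extend: "C \<subseteq> extend C y"
proof
  fix a assume "a \<in> C"
  then show "a \<in> extend C y"
    unfolding extend_def using polys_over_monom[of a 0] by (intro image_eqI[of _ _ "monom a 0"]) (simp_all add: poly_monom)
qed

lemma mem_extend: "y \<in> extend C y"
  unfolding extend_def using polys_over_monom[OF subring_set_1[OF C], of 1]
  by (intro image_eqI[of _ _ "monom 1 1"]) (simp_all add: poly_monom)

end

text \<open>Degree less than \<open>n\<close>, in a form where \<open>n = 0\<close> singles out the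
  zero polynomial, as \<open>degree\<close> cannot; this gives inductions on \<open>n\<close> a
  clean base case.\<close>

definition coeffs_below :: "nat \<Rightarrow> 'a::zero poly \<Rightarrow> bool" where
  "coeffs_below n p \<longleftrightarrow> (\<forall>i\<ge>n. coeff p i = 0)"

lemma coeffs_belowD: "coeffs_below n p \<Longrightarrow> n \<le> i \<Longrightarrow> coeff p i = 0"
  by (simp add: coeffs_below_def)

lemma coeffs_below_mono: "coeffs_below n p \<Longrightarrow> n \<le> m \<Longrightarrow> coeffs_below m p"
  by (simp add: coeffs_below_def)

lemma coeffs_below_degree: "coeffs_below (Suc (degree p)) p"
  by (simp add: coeffs_below_def coeff_eq_0)

lemma coeff_mult_top:
  assumes "coeffs_below (Suc a) p" "coeffs_below (Suc b) q"
  shows "coeff (p * q) (a + b) = coeff p a * coeff q b"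
proof -
  have "coeff (p * q) (a + b) = (\<Sum>i\<in>{a}. coeff p i * coeff q (a + b - i))"
    unfolding coeff_mult
  proof (rule sum.mono_neutral_right)
    show "\<forall>i\<in>{..a + b} - {a}. coeff p i * coeff q (a + b - i) = 0"
    proof
      fix i assume "i \<in> {..a + b} - {a}"
      then consider "Suc a \<le> i" | "Suc b \<le> a + b - i" by fastforce
      then show "coeff p i * coeff q (a + b - i) = 0"
        using coeffs_belowD[OF assms(1), of i] coeffs_belowD[OF assms(2), of "a + b - i"] by cases simp_all
    qed
  qed auto
  then show ?thesis by simp
qed

lemma coeffs_below_mult:
  assumes "coeffs_below (Suc a) p" "coeffs_below (Suc b) q"
  shows "coeffs_below (Suc (a + b)) (p * q)"
  unfolding coeffs_below_def coeff_mult
proof (intro allI impI sum.neutral ballI)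
  fix k i assume k: "Suc (a + b) \<le> k" and "i \<in> {..k}"
  then consider "Suc a \<le> i" | "Suc b \<le> k - i" by fastforce
  then show "coeff p i * coeff q (k - i) = 0"
    using coeffs_belowD[OF assms(1), of i] coeffs_belowD[OF assms(2), of "k - i"] by cases simp_all
qed

lemma coeff_power_top:
  assumes "coeffs_below (Suc a) p"
  shows "coeff (p ^ n) (n * a) = coeff p a ^ n \<and> coeffs_below (Suc (n * a)) (p ^ n)"
proof (induction n)
  case 0
  then show ?case by (simp add: coeffs_below_def coeff_pCons one_pCons split: nat.splits)
next
  case (Suc n)
  then show ?case using coeff_mult_top[OF assms, of "n * a" "p ^ n"] coeffs_below_mult[OF assms, of "n * a" "p ^ n"]
    by simp
qed

text \<open>Multiplying by the coefficient of \<open>u\<close> at \<open>s\<close>, where ordinary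
  division would invert it, keeps quotient and remainder over \<open>C\<close>. The last clause,
  degree of \<open>q\<close> below \<open>n - s\<close>, is what later puts a cofactor below the
  minimal degree of a relation.\<close>

lemma pseudo_division:
  assumes C: "subring_set C" and u: "u \<in> polys_over C" "coeffs_below (Suc s) u"
    and p: "p \<in> polys_over C" "coeffs_below n p"
  shows "\<exists>k q r. q \<in> polys_over C \<and> r \<in> polys_over C \<and> smult (coeff u s ^ k) p = q * u + r \<and>
    coeffs_below s r \<and> (\<forall>i. n \<le> i + s \<longrightarrow> coeff q i = 0)"
  using p
proof (induction n arbitrary: p)
  case 0
  then have "p = 0" by (simp add: coeffs_below_def poly_eqI)
  then show ?case
    using 0 by (intro exI[of _ "0 :: nat"] exI[of _ "0 :: 'a poly"]) (simp add: coeffs_below_def)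
next
  case (Suc m)
  let ?l = "coeff u s" and ?a = "coeff p m"
  show ?case
  proof (cases "Suc m \<le> s")
    case True
    then have "coeffs_below s p" using Suc.prems(2) coeffs_below_mono by blast
    moreover have "0 \<in> polys_over C" using subring_set_0[OF subring_set_polys_over[OF C]] .
    ultimately show ?thesis
      using Suc.prems(1) by (intro exI[of _ "0 :: nat"] exI[of _ "0 :: 'a poly"] exI[of _ p]) simp
  next
    case False
    let ?M = "monom ?a (m - s)"
    let ?p = "smult ?l p - ?M * u"
    have aC: "?a \<in> C" and lC: "?l \<in> C" using Suc.prems(1) u(1) by (simp_all add: polys_over_def)
    have M: "?M \<in> polys_over C" using polys_over_monom[OF C aC] .
    have "?p \<in> polys_over C"
      by (intro subring_set_diff[OF subring_set_polys_over[OF C]] polys_over_smult[OF C]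
          subring_set_mult[OF subring_set_polys_over[OF C]] lC M u(1) Suc.prems(1))
    moreover have "coeffs_below m ?p"
      unfolding coeffs_below_def
    proof (intro allI impI)
      fix i assume "m \<le> i"
      show "coeff ?p i = 0"
      proof (cases "i = m")
        case True
        then show ?thesis using False by (simp add: coeff_monom_mult)
      next
        case False
        then have "Suc m \<le> i" "Suc s \<le> i - (m - s)" using \<open>m \<le> i\<close> \<open>\<not> Suc m \<le> s\<close> by auto
        then show ?thesis
          using coeffs_belowD[OF Suc.prems(2)] coeffs_belowD[OF u(2)] by (simp add: coeff_monom_mult)
      qed
    qed
    ultimately obtain k q r where IH: "q \<in> polys_over C" "r \<in> polys_over C"
        "smult (?l ^ k) ?p = q * u + r" "coeffs_below s r" "\<forall>i. m \<le> i + s \<longrightarrow> coeff q i = 0"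
      using Suc.IH by blast
    have "smult (?l ^ Suc k) p = (q + smult (?l ^ k) ?M) * u + r"
      using IH(3) by (simp add: algebra_simps smult_diff_right)
    moreover have "q + smult (?l ^ k) ?M \<in> polys_over C"
      by (intro subring_set_add[OF subring_set_polys_over[OF C]] polys_over_smult[OF C]
          subring_set_power[OF C] lC M IH(1))
    moreover have "\<forall>i. Suc m \<le> i + s \<longrightarrow> coeff (q + smult (?l ^ k) ?M) i = 0"
      using IH(5) False by auto
    ultimately show ?thesis using IH(2,4) by blast
  qed
qed

section \<open>Removing a generator modulo a prime ideal\<close>

lemma poly_mem_subspace:
  assumes "rmod.subspace P" "\<And>i. coeff p i \<in> P"
  shows "poly p y \<in> P"
  unfolding poly_altdef
  by (intro rmod.subspace_sum[OF assms(1)]) (subst mult.commute, intro rmod.subspace_scale[OF assms])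

lemma power_diff_mem_subspace:
  assumes "rmod.subspace P" "x - y \<in> P"
  shows "x ^ n - y ^ n \<in> P"
proof (induction n)
  case (Suc n)
  have "x * (x ^ n - y ^ n) + y ^ n * (x - y) \<in> P"
    by (intro rmod.subspace_add[OF assms(1)] rmod.subspace_scale[OF assms(1)] Suc assms(2))
  then show ?case by (simp add: algebra_simps)
qed (simp add: rmod.subspace_0[OF assms(1)])

lemma diff_diff_mem_subspace:
  assumes "rmod.subspace P" "x - y \<in> P" "y - z \<in> P"
  shows "x - z \<in> P"
  using rmod.subspace_add[OF assms] by simp

lemma trim_mod:
  assumes P: "rmod.subspace P" and C: "subring_set C"
    and p: "p \<in> polys_over C" "coeffs_below n p" "coeff p i \<notin> P"
  shows "\<exists>s q. s < n \<and> q \<in> polys_over C \<and> coeffs_below (Suc s) q \<and> coeff q s \<notin> P \<and>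
    poly p y - poly q y \<in> P"
  using p
proof (induction n arbitrary: p)
  case 0
  then show ?case using rmod.subspace_0[OF P] by (simp add: coeffs_below_def)
next
  case (Suc m)
  show ?case
  proof (cases "coeff p m \<in> P")
    case False
    then show ?thesis using Suc.prems rmod.subspace_0[OF P] by (intro exI[of _ m] exI[of _ p]) simp
  next
    case True
    let ?M = "monom (coeff p m) m"
    have "p - ?M \<in> polys_over C"
      using Suc.prems(1) by (intro subring_set_diff[OF subring_set_polys_over[OF C]] polys_over_monom[OF C])
        (simp_all add: polys_over_def)
    moreover have "coeffs_below m (p - ?M)"
      unfolding coeffs_below_def
    proof (intro allI impI)
      fix j assume "m \<le> j"
      then show "coeff (p - ?M) j = 0"
        using coeffs_belowD[OF Suc.prems(2), of j] by (cases "j = m") simp_all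
    qed
    moreover have "coeff (p - ?M) i \<notin> P" using Suc.prems(3) True by (auto simp: coeffs_below_def)
    ultimately obtain s q where q: "s < m" "q \<in> polys_over C" "coeffs_below (Suc s) q"
        "coeff q s \<notin> P" "poly (p - ?M) y - poly q y \<in> P"
      using Suc.IH by blast
    have "(poly (p - ?M) y - poly q y) + y ^ m * coeff p m \<in> P"
      by (intro rmod.subspace_add[OF P] rmod.subspace_scale[OF P] True q(5))
    then have "poly p y - poly q y \<in> P" by (simp add: poly_monom algebra_simps)
    then show ?thesis using q by (intro exI[of _ s] exI[of _ q]) simp
  qed
qed

text \<open>The step of Zariski's lemma that removes a generator \<open>y\<close>: if, modulo \<open>P\<close>, certain elements of
  \<open>C\<close> divide powers of a fixed \<open>d\<close> in \<open>C[y]\<close>, then they divide powers of a fixed \<open>c\<close> in \<open>C\<close>.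
  If \<open>y\<close> is transcendental over \<open>C\<close>, take for \<open>c\<close> the leading coefficient of \<open>d\<close>. Otherwise
  choose a nonzero relation \<open>F(y) = 0\<close> of minimal degree \<open>r\<close> with leading coefficient \<open>a\<close> and a
  nonzero multiple \<open>b \<in> C\<close> of \<open>d\<close>, and take \<open>c = a b\<close>: then \<open>1, y, \<dots>, y ^ (r - 1)\<close> are independent
  and one compares constant coefficients.\<close>

lemma denominator_descent:
  assumes P: "prime_set P" and C: "subring_set C" and d: "d \<in> extend C y" "d \<notin> P"
  shows "\<exists>c\<in>C. c \<notin> P \<and> (\<forall>z\<in>C. (\<exists>n. \<exists>e\<in>extend C y. d ^ n - z * e \<in> P) \<longrightarrow>
    (\<exists>n. \<exists>e\<in>C. c ^ n - z * e \<in> P))"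
proof -
  note sP = prime_setD(1)[OF P] and sPC = subring_set_polys_over[OF C]
  obtain \<delta> where \<delta>: "\<delta> \<in> polys_over C" "d = poly \<delta> y" using d(1) by (auto simp: extend_def)
  have trim: "\<exists>s q. s < n \<and> q \<in> polys_over C \<and> coeffs_below (Suc s) q \<and> coeff q s \<notin> P \<and>
      poly p y - poly q y \<in> P" if "p \<in> polys_over C" "coeffs_below n p" "coeff p i \<notin> P" for p n i
    using trim_mod[OF sP C that] .
  have big_coeff: "\<exists>i. coeff p i \<notin> P" if "poly p y \<notin> P" for p
    using poly_mem_subspace[OF sP, of p y] that by blast
  show ?thesis
  proof (cases "\<forall>p\<in>polys_over C. poly p y \<in> P \<longrightarrow> (\<forall>i. coeff p i \<in> P)")
    case True
    obtain i where "coeff \<delta> i \<notin> P" using big_coeff d(2) \<delta>(2) by blast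
    from trim[OF \<delta>(1) coeffs_below_degree this] obtain s q where q: "q \<in> polys_over C"
        "coeffs_below (Suc s) q" "coeff q s \<notin> P" "d - poly q y \<in> P"
      using \<delta>(2) by blast
    let ?c = "coeff q s"
    have "\<exists>n. \<exists>e\<in>C. ?c ^ n - z * e \<in> P" if z: "z \<in> C" and e: "e \<in> extend C y" "d ^ n - z * e \<in> P" for z n e
    proof -
      obtain \<epsilon> where \<epsilon>: "\<epsilon> \<in> polys_over C" "e = poly \<epsilon> y" using e(1) by (auto simp: extend_def)
      have "(d ^ n - z * e) - (d ^ n - poly q y ^ n) \<in> P"
        by (intro rmod.subspace_diff[OF sP] e(2) power_diff_mem_subspace[OF sP] q(4))
      then have "poly (q ^ n - smult z \<epsilon>) y \<in> P" by (simp add: \<epsilon>(2) poly_power algebra_simps)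
      moreover have "q ^ n - smult z \<epsilon> \<in> polys_over C"
        by (intro subring_set_diff[OF sPC] subring_set_power[OF sPC] polys_over_smult[OF C] q(1) z \<epsilon>(1))
      \<comment> \<open>With \<open>y\<close> transcendental modulo \<open>P\<close>, every
        coefficient of this relation lies in \<open>P\<close>; position \<open>n * s\<close> is the
        one where \<open>q ^ n\<close> contributes exactly \<open>?c ^ n\<close>.\<close>
      ultimately have "coeff (q ^ n - smult z \<epsilon>) (n * s) \<in> P" using True by blast
      then have "?c ^ n - z * coeff \<epsilon> (n * s) \<in> P" using coeff_power_top[OF q(2)] by simp
      then show ?thesis using \<epsilon>(1) unfolding polys_over_def by blast
    qed
    moreover have "?c \<in> C" using q(1) by (simp add: polys_over_def)
    ultimately show ?thesis using q(3) by blast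
  next
    case False
    define rel where "rel r F \<longleftrightarrow> F \<in> polys_over C \<and> coeffs_below (Suc r) F \<and> coeff F r \<notin> P \<and> poly F y \<in> P"
      for r F
    define r where "r = (LEAST r. \<exists>F. rel r F)"
    have shrink: "\<exists>s<n. \<exists>F. rel s F" if p: "p \<in> polys_over C" "coeffs_below n p" "coeff p i \<notin> P" "poly p y \<in> P"
      for p n i
    proof -
      obtain s q where q: "s < n" "q \<in> polys_over C" "coeffs_below (Suc s) q" "coeff q s \<notin> P"
          "poly p y - poly q y \<in> P"
        using trim[OF p(1-3)] by blast
      have "poly q y \<in> P" using rmod.subspace_diff[OF sP p(4) q(5)] by simp
      then show ?thesis using q unfolding rel_def by blast
    qed
    obtain p i where "p \<in> polys_over C" "poly p y \<in> P" "coeff p i \<notin> P" using False by blast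
    then have "\<exists>r F. rel r F" using shrink[OF _ coeffs_below_degree] by blast
    then have "\<exists>F. rel r F" unfolding r_def by (rule LeastI_ex)
    then obtain F where F: "F \<in> polys_over C" "coeffs_below (Suc r) F" "coeff F r \<notin> P" "poly F y \<in> P"
      unfolding rel_def by blast
    have least: "r \<le> s" if "rel s G" for s G unfolding r_def using that by (intro Least_le) blast
    have indep: "coeff p i \<in> P" if "p \<in> polys_over C" "coeffs_below r p" "poly p y \<in> P" for p i
      using shrink[OF that(1,2) _ that(3)] least by fastforce
    let ?a = "coeff F r"
    have aC: "?a \<in> C" using F(1) by (simp add: polys_over_def)
    have "r > 0"
    proof (rule ccontr)
      assume "\<not> r > 0"
      then have "F = [:?a:]" using coeffs_belowD[OF F(2)] by (intro poly_eqI) (auto simp: coeff_pCons split: nat.splits)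
      then have "poly F y = poly [:?a:] y" by (rule arg_cong)
      then have "poly F y = ?a" by simp
      then show False using F(3,4) by simp
    qed
    have reduce: "\<exists>N q. q \<in> polys_over C \<and> coeffs_below r q \<and> ?a ^ N * poly p y - poly q y \<in> P"
      if p: "p \<in> polys_over C" for p
    proof -
      obtain N g q where q: "q \<in> polys_over C" "smult (?a ^ N) p = g * F + q" "coeffs_below r q"
        using pseudo_division[OF C F(1,2) p coeffs_below_degree] by blast
      have "?a ^ N * poly p y = poly (g * F + q) y" unfolding q(2)[symmetric] by simp
      then have "?a ^ N * poly p y - poly q y = poly g y * poly F y" by simp
      also have "\<dots> \<in> P" using rmod.subspace_scale[OF sP F(4)] .
      finally show ?thesis using q by blast
    qed
    \<comment> \<open>The nonzero multiple of \<open>d\<close> in \<open>C\<close> is sought as a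
      polynomial \<open>u\<close> of least degree \<open>s\<close> whose value is a multiple of
      \<open>d\<close> modulo \<open>P\<close>; this least degree will turn out to be 0.\<close>
    define mult where "mult s u \<longleftrightarrow> u \<in> polys_over C \<and> coeffs_below (Suc s) u \<and> coeff u s \<notin> P \<and>
      (\<exists>e\<in>extend C y. poly u y - d * e \<in> P)" for s u
    define s where "s = (LEAST s. \<exists>u. mult s u)"
    have pow: "?a ^ N \<notin> P" for N using prime_set_power[OF P] F(3) by blast
    obtain N q where q: "q \<in> polys_over C" "coeffs_below r q" "?a ^ N * d - poly q y \<in> P"
      using reduce[OF \<delta>(1)] \<delta>(2) by blast
    have "?a ^ N * d \<notin> P" using prime_setD(3)[OF P] pow d(2) by blast
    then have "poly q y \<notin> P" using rmod.subspace_add[OF sP q(3), of "poly q y"] by auto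
    then obtain i where "coeff q i \<notin> P" using big_coeff by blast
    from trim[OF q(1,2) this] obtain s0 u0 where u0: "s0 < r" "u0 \<in> polys_over C"
        "coeffs_below (Suc s0) u0" "coeff u0 s0 \<notin> P" "poly q y - poly u0 y \<in> P"
      by blast
    have "poly u0 y - d * ?a ^ N \<in> P"
      using rmod.subspace_neg[OF sP diff_diff_mem_subspace[OF sP q(3) u0(5)]] by (simp add: mult.commute)
    moreover have "?a ^ N \<in> extend C y"
      using subset_extend[OF C] subring_set_power[OF C aC] by blast
    ultimately have "mult s0 u0" using u0 unfolding mult_def by blast
    then have "s \<le> s0" unfolding s_def by (intro Least_le) blast
    then have "s < r" using u0(1) by simp
    have "\<exists>s u. mult s u" using \<open>mult s0 u0\<close> by blast
    then have "\<exists>u. mult s u" unfolding s_def by (rule LeastI_ex)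
    then obtain u e where u: "u \<in> polys_over C" "coeffs_below (Suc s) u" "coeff u s \<notin> P"
        and e: "e \<in> extend C y" "poly u y - d * e \<in> P"
      unfolding mult_def by blast
    have "poly u y \<notin> P"
      using indep[OF u(1) coeffs_below_mono[OF u(2)], of s] u(3) \<open>s < r\<close> by auto
    have "s = 0"
    proof (rule ccontr)
      assume "s \<noteq> 0"
      \<comment> \<open>Pseudo-divide the minimal relation \<open>F\<close> by \<open>u\<close>. The
        remainder has a multiple of \<open>d\<close> as value and degree below \<open>s\<close>, so
        by minimality all its coefficients lie in \<open>P\<close>. Then \<open>g\<close> times
        \<open>u\<close> vanishes at \<open>y\<close> modulo \<open>P\<close>, hence so does
        \<open>g\<close>; its degree is below \<open>r\<close> because \<open>s > 0\<close>, so its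
        coefficients lie in \<open>P\<close> too, and the top coefficient of \<open>F\<close>
        contradicts this.\<close>
      let ?l = "coeff u s"
      obtain k g h where gh: "g \<in> polys_over C" "h \<in> polys_over C" "smult (?l ^ k) F = g * u + h"
          "coeffs_below s h" "\<forall>i. Suc r \<le> i + s \<longrightarrow> coeff g i = 0"
        using pseudo_division[OF C u(1,2) F(1,2)] by blast
      have rem: "poly h y = ?l ^ k * poly F y - poly g y * poly u y"
        using arg_cong[OF gh(3), of "\<lambda>p. poly p y"] by simp
      have hP: "coeff h i \<in> P" for i
      proof (rule ccontr)
        assume "coeff h i \<notin> P"
        from trim[OF gh(2,4) this] obtain s' u' where u': "s' < s" "u' \<in> polys_over C"
            "coeffs_below (Suc s') u'" "coeff u' s' \<notin> P" "poly h y - poly u' y \<in> P"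
          by blast
        have "?l ^ k * poly F y - poly g y * (poly u y - d * e) - (poly h y - poly u' y) \<in> P"
          by (intro rmod.subspace_diff[OF sP] rmod.subspace_scale[OF sP] F(4) e(2) u'(5))
        moreover have "?l ^ k * poly F y - poly g y * (poly u y - d * e) - (poly h y - poly u' y) =
            poly u' y - d * (- (poly g y * e))"
          unfolding rem by (simp add: algebra_simps)
        moreover have "- (poly g y * e) \<in> extend C y"
          using gh(1) e(1) by (intro subring_set_uminus subring_set_mult subring_set_extend[OF C]) (auto simp: extend_def)
        ultimately have "poly u' y - d * (- (poly g y * e)) \<in> P" "- (poly g y * e) \<in> extend C y"
          by argo+
        then have "mult s' u'" using u' unfolding mult_def by blast
        then have "s \<le> s'" unfolding s_def by (intro Least_le) blast
        then show False using u'(1) by simp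
      qed
      have "poly g y * poly u y = ?l ^ k * poly F y - poly h y" using rem by simp
      also have "\<dots> \<in> P"
        by (intro rmod.subspace_diff[OF sP] rmod.subspace_scale[OF sP] F(4) poly_mem_subspace[OF sP] hP)
      finally have "poly g y \<in> P" using prime_setD(3)[OF P] \<open>poly u y \<notin> P\<close> by blast
      moreover have "coeffs_below r g" using gh(5) \<open>s \<noteq> 0\<close> unfolding coeffs_below_def by auto
      ultimately have gP: "coeff g i \<in> P" for i using indep[OF gh(1)] by blast
      have "coeff (g * u) r \<in> P"
        unfolding coeff_mult
        by (intro rmod.subspace_sum[OF sP]) (subst mult.commute, intro rmod.subspace_scale[OF sP] gP)
      then have "coeff (g * u + h) r \<in> P" using rmod.subspace_add[OF sP _ hP] by simp
      then have "?l ^ k * ?a \<in> P" unfolding gh(3)[symmetric] by simp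
      then show False using prime_setD(3)[OF P] prime_set_power[OF P] u(3) F(3) by blast
    qed
    let ?b = "coeff u 0"
    have "u = [:?b:]" using coeffs_belowD[OF u(2)] \<open>s = 0\<close>
      by (intro poly_eqI) (auto simp: coeff_pCons split: nat.splits)
    then have "poly u y = poly [:?b:] y" by (rule arg_cong)
    then have "poly u y = ?b" by simp
    then have b: "?b - d * e \<in> P" "?b \<notin> P" using e(2) u(3) \<open>s = 0\<close> by simp_all
    have bC: "?b \<in> C" using u(1) by (simp add: polys_over_def)
    have "\<exists>n. \<exists>e\<in>C. (?a * ?b) ^ n - z * e \<in> P"
      if z: "z \<in> C" and e1: "e1 \<in> extend C y" "d ^ n - z * e1 \<in> P" for z n e1
    proof -
      have "e1 * e ^ n \<in> extend C y"
        by (intro subring_set_mult subring_set_power subring_set_extend[OF C] e1(1) e(1))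
      then obtain \<epsilon> where \<epsilon>: "\<epsilon> \<in> polys_over C" "e1 * e ^ n = poly \<epsilon> y" by (auto simp: extend_def)
      obtain N g where g: "g \<in> polys_over C" "coeffs_below r g" "?a ^ N * poly \<epsilon> y - poly g y \<in> P"
        using reduce[OF \<epsilon>(1)] by blast
      \<comment> \<open>Modulo \<open>P\<close>, \<open>?b = d * e\<close> and
        \<open>d ^ n = z * e1\<close> give \<open>?b ^ n = z * (e1 * e ^ n)\<close>; the factor
        \<open>?a ^ N\<close> pays for rewriting \<open>e1 * e ^ n\<close> as the value of a
        polynomial of degree below \<open>r\<close>.\<close>
      have "?a ^ N * (?b ^ n - (d * e) ^ n) + (?a ^ N * e ^ n) * (d ^ n - z * e1) +
          z * (?a ^ N * poly \<epsilon> y - poly g y) \<in> P"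
        by (intro rmod.subspace_add[OF sP] rmod.subspace_scale[OF sP] g(3) e1(2)
            power_diff_mem_subspace[OF sP] b(1))
      then have "?a ^ N * ?b ^ n - z * poly g y \<in> P"
        unfolding \<epsilon>(2)[symmetric] by (simp add: algebra_simps)
      then have "poly ([:?a ^ N * ?b ^ n:] - smult z g) y \<in> P" by simp
      moreover have "[:?a ^ N * ?b ^ n:] - smult z g \<in> polys_over C"
        by (intro subring_set_diff[OF sPC] polys_over_smult[OF C] z g(1))
          (use subring_set_mult[OF C] subring_set_power[OF C] aC bC subring_set_0[OF C] in
            \<open>auto simp: polys_over_def coeff_pCons split: nat.splits\<close>)
      moreover have "coeffs_below r ([:?a ^ N * ?b ^ n:] - smult z g)"
        using g(2) \<open>r > 0\<close> by (auto simp: coeffs_below_def coeff_pCons split: nat.splits)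
      ultimately have "coeff ([:?a ^ N * ?b ^ n:] - smult z g) 0 \<in> P" using indep by blast
      then have "?a ^ N * ?b ^ n - z * coeff g 0 \<in> P" by simp
      \<comment> \<open>This factor equalises the exponents of \<open>?a\<close> and
        \<open>?b\<close>, so that a power of their product appears.\<close>
      then have "(?a ^ n * ?b ^ N) * (?a ^ N * ?b ^ n - z * coeff g 0) \<in> P"
        by (rule rmod.subspace_scale[OF sP])
      then have "(?a * ?b) ^ (N + n) - z * (?a ^ n * ?b ^ N * coeff g 0) \<in> P"
        by (simp add: power_add power_mult_distrib algebra_simps)
      moreover have "?a ^ n * ?b ^ N * coeff g 0 \<in> C"
        using g(1) by (intro subring_set_mult[OF C] subring_set_power[OF C] aC bC) (simp add: polys_over_def)
      ultimately show ?thesis by blast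
    qed
    moreover have "?a * ?b \<in> C" using subring_set_mult[OF C aC bC] .
    moreover have "?a * ?b \<notin> P" using prime_setD(3)[OF P] F(3) b(2) by blast
    ultimately show ?thesis by blast
  qed
qed

subsection \<open>Monomials\<close>

lemma poly_mapping_sum_single:
  fixes p :: "'a \<Rightarrow>\<^sub>0 'b::comm_monoid_add"
  shows "p = (\<Sum>m\<in>Poly_Mapping.keys p. Poly_Mapping.single m (Poly_Mapping.lookup p m))"
  by (rule poly_mapping_eqI)
    (simp add: lookup_sum lookup_single when_def not_in_keys_iff_lookup_eq_zero)

text \<open>In the case \<open>single\<close> the exponent is known to occur in the given
  \<open>p\<close>, so conditions on the support of \<open>p\<close> remain available for its
  terms.\<close>

lemma poly_mapping_additive_induct [case_names zero single add]:
  fixes p :: "'a \<Rightarrow>\<^sub>0 'b::comm_monoid_add"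
  assumes "Q 0" "\<And>m c. m \<in> Poly_Mapping.keys p \<Longrightarrow> Q (Poly_Mapping.single m c)"
    "\<And>p q. Q p \<Longrightarrow> Q q \<Longrightarrow> Q (p + q)"
  shows "Q p"
proof -
  have "Q (\<Sum>m\<in>A. Poly_Mapping.single m (Poly_Mapping.lookup p m))" if "A \<subseteq> Poly_Mapping.keys p" for A
    using finite_subset[OF that finite_keys] that
  proof (induction A rule: finite_induct)
    case (insert m A)
    then show ?case using assms(3)[OF assms(2)] by simp
  qed (simp add: assms(1))
  from this[OF subset_refl] show ?thesis by (simp only: poly_mapping_sum_single[symmetric])
qed

lemma keys_plus_nat: "Poly_Mapping.keys (m + n :: 'v \<Rightarrow>\<^sub>0 nat) = Poly_Mapping.keys m \<union> Poly_Mapping.keys n"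
  by (auto simp: in_keys_iff lookup_add)

lemma lookup_single_mult:
  "Poly_Mapping.lookup (Poly_Mapping.single a c * p) (a + m) = c * Poly_Mapping.lookup p (m :: 'v \<Rightarrow>\<^sub>0 nat)"
proof (induction p rule: poly_mapping_additive_induct)
  case (single m' d)
  then show ?case by (simp add: mult_single lookup_single when_def)
qed (simp_all add: lookup_add distrib_left)

definition const :: "'k \<Rightarrow> ('v \<Rightarrow>\<^sub>0 nat) \<Rightarrow>\<^sub>0 'k::comm_ring_1" where
  "const c = Poly_Mapping.single 0 c"

lemma const_0 [simp]: "const 0 = 0" and const_1 [simp]: "const 1 = 1"
  and const_add: "const (c + d) = const c + const d"
  and const_diff: "const (c - d) = const c - const d"
  and const_mult: "const (c * d) = const c * const d"
  by (simp_all add: const_def single_add single_diff mult_single)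

lemma mvar_power: "(mvar v :: ('v \<Rightarrow>\<^sub>0 nat) \<Rightarrow>\<^sub>0 'k::comm_ring_1) ^ n = Poly_Mapping.single (Poly_Mapping.single v n) 1"
  by (induction n) (simp_all add: mvar_def mult_single single_add[symmetric])

definition mpoly_set :: "'v set \<Rightarrow> (('v \<Rightarrow>\<^sub>0 nat) \<Rightarrow>\<^sub>0 'k::comm_ring_1) set" where
  "mpoly_set W = {p. \<forall>m\<in>Poly_Mapping.keys p. Poly_Mapping.keys m \<subseteq> W}"

lemma keys_minus_comm_ring: "Poly_Mapping.keys (p - q) \<subseteq> Poly_Mapping.keys p \<union> Poly_Mapping.keys (q :: 'a \<Rightarrow>\<^sub>0 'k::comm_ring_1)"
  by (auto simp: in_keys_iff lookup_minus)

lemma keys_mult_nat: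
  assumes "m \<in> Poly_Mapping.keys (p * q :: ('v \<Rightarrow>\<^sub>0 nat) \<Rightarrow>\<^sub>0 'k::comm_ring_1)"
  obtains a b where "a \<in> Poly_Mapping.keys p" "b \<in> Poly_Mapping.keys q" "m = a + b"
  using assms keys_mult[of p q] by blast

lemma subring_set_mpoly_set: "subring_set (mpoly_set W)"
  unfolding subring_set_def
proof (intro conjI ballI)
  show "1 \<in> mpoly_set W" by (simp add: mpoly_set_def)
  fix p q :: "('a \<Rightarrow>\<^sub>0 nat) \<Rightarrow>\<^sub>0 'b" assume pq: "p \<in> mpoly_set W" "q \<in> mpoly_set W"
  show "p - q \<in> mpoly_set W" using pq keys_minus_comm_ring[of p q] unfolding mpoly_set_def by blast
  show "p * q \<in> mpoly_set W"
    unfolding mpoly_set_def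
  proof (intro CollectI ballI)
    fix m assume "m \<in> Poly_Mapping.keys (p * q)"
    then obtain a b where "a \<in> Poly_Mapping.keys p" "b \<in> Poly_Mapping.keys q" "m = a + b" by (rule keys_mult_nat)
    then show "Poly_Mapping.keys m \<subseteq> W" using pq by (simp add: mpoly_set_def keys_plus_nat)
  qed
qed

lemma mem_mpoly_set_single: "Poly_Mapping.keys m \<subseteq> W \<Longrightarrow> Poly_Mapping.single m c \<in> mpoly_set W"
  by (simp add: mpoly_set_def)

lemma mpoly_set_insert_subset: "mpoly_set (insert w W) \<subseteq> extend (mpoly_set W) (mvar w :: ('v \<Rightarrow>\<^sub>0 nat) \<Rightarrow>\<^sub>0 'k::comm_ring_1)"
proof
  fix p :: "('v \<Rightarrow>\<^sub>0 nat) \<Rightarrow>\<^sub>0 'k" assume p: "p \<in> mpoly_set (insert w W)"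
  note sub = subring_set_extend[OF subring_set_mpoly_set]
  show "p \<in> extend (mpoly_set W) (mvar w)"
  proof (induction p rule: poly_mapping_additive_induct)
    case zero
    show ?case using subring_set_0[OF sub] .
  next
    case (add p q)
    then show ?case using subring_set_add[OF sub] by blast
  next
    case (single m c)
    define n where "n = Poly_Mapping.lookup m w"
    define m' where "m' = m - Poly_Mapping.single w n"
    have m: "m = m' + Poly_Mapping.single w n"
      by (rule poly_mapping_eqI) (simp add: m'_def n_def lookup_add lookup_minus lookup_single when_def)
    have "Poly_Mapping.keys m' \<subseteq> W"
    proof
      fix v assume "v \<in> Poly_Mapping.keys m'"
      then have "v \<in> Poly_Mapping.keys m" "v \<noteq> w"
        by (auto simp: in_keys_iff m'_def n_def lookup_minus lookup_single when_def split: if_splits)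
      then show "v \<in> W" using p single by (auto simp: mpoly_set_def)
    qed
    then have "Poly_Mapping.single m' c \<in> extend (mpoly_set W) (mvar w)"
      using subset_extend[OF subring_set_mpoly_set] mem_mpoly_set_single by blast
    moreover have "Poly_Mapping.single m c = Poly_Mapping.single m' c * mvar w ^ n"
      by (simp add: m mvar_power mult_single)
    ultimately show ?case
      using subring_set_mult[OF sub] subring_set_power[OF sub] mem_extend[OF subring_set_mpoly_set] by metis
  qed
qed

subsection \<open>Monomial ideals\<close>

text \<open>All elements of the type \<open>'v\<close> are variables here: the ideal contains \<open>x\<^sub>v\<close> whenever \<open>{v}\<close> is not
  a face, so that the quotient is the face ring for every vertex set containing the complex.\<close>

definition nonface_set :: "'v set set \<Rightarrow> (('v \<Rightarrow>\<^sub>0 nat) \<Rightarrow>\<^sub>0 'k::comm_ring_1) set" where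
  "nonface_set \<Delta> = {p. \<forall>m\<in>Poly_Mapping.keys p. Poly_Mapping.keys m \<notin> \<Delta>}"

definition down_closed :: "'v set set \<Rightarrow> bool" where
  "down_closed \<Delta> \<longleftrightarrow> (\<forall>A\<in>\<Delta>. \<forall>B\<subseteq>A. B \<in> \<Delta>)"

lemma subspace_nonface_set:
  assumes "down_closed \<Delta>"
  shows "rmod.subspace (nonface_set \<Delta> :: (('v \<Rightarrow>\<^sub>0 nat) \<Rightarrow>\<^sub>0 'k::comm_ring_1) set)"
proof (rule rmod.subspaceI)
  show "0 \<in> nonface_set \<Delta>" by (simp add: nonface_set_def)
  fix p q :: "('v \<Rightarrow>\<^sub>0 nat) \<Rightarrow>\<^sub>0 'k" assume q: "q \<in> nonface_set \<Delta>"
  show "p + q \<in> nonface_set \<Delta>" if "p \<in> nonface_set \<Delta>"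
    using that q Poly_Mapping.keys_add[of p q] unfolding nonface_set_def by blast
  show "p * q \<in> nonface_set \<Delta>"
    unfolding nonface_set_def
  proof (intro CollectI ballI)
    fix m assume "m \<in> Poly_Mapping.keys (p * q)"
    then obtain a b where ab: "b \<in> Poly_Mapping.keys q" "m = a + b" by (rule keys_mult_nat)
    then have "Poly_Mapping.keys b \<notin> \<Delta>" using q by (simp add: nonface_set_def)
    moreover have "Poly_Mapping.keys b \<subseteq> Poly_Mapping.keys m" by (simp add: ab(2) keys_plus_nat)
    ultimately show "Poly_Mapping.keys m \<notin> \<Delta>" using assms unfolding down_closed_def by blast
  qed
qed

lemma down_closed_Pow: "down_closed (Pow F)"
  by (auto simp: down_closed_def)

subsection \<open>Coefficients with respect to one variable\<close>

text \<open>The coefficient of \<open>mvar k ^ l\<close> when \<open>p\<close> is read as a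
  polynomial in that one variable. The test at \<open>k\<close> keeps the coefficient free of the
  variable, so each term of \<open>p\<close> is counted for a single \<open>l\<close>.\<close>

lift_definition var_coeff :: "'v \<Rightarrow> nat \<Rightarrow> (('v \<Rightarrow>\<^sub>0 nat) \<Rightarrow>\<^sub>0 'k::comm_ring_1) \<Rightarrow> ('v \<Rightarrow>\<^sub>0 nat) \<Rightarrow>\<^sub>0 'k"
  is "\<lambda>k l p m. if Poly_Mapping.lookup m k = 0 then p (m + Poly_Mapping.single k l) else 0"
proof -
  fix k :: 'v and l :: nat and p :: "('v \<Rightarrow>\<^sub>0 nat) \<Rightarrow> 'k"
  assume "finite {m. p m \<noteq> 0}"
  moreover have "{m. (if Poly_Mapping.lookup m k = 0 then p (m + Poly_Mapping.single k l) else 0) \<noteq> 0} \<subseteq>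
      (\<lambda>m. m - Poly_Mapping.single k l) ` {m. p m \<noteq> 0}"
  proof
    fix m assume "m \<in> {m. (if Poly_Mapping.lookup m k = 0 then p (m + Poly_Mapping.single k l) else 0) \<noteq> 0}"
    then have "p (m + Poly_Mapping.single k l) \<noteq> 0" by (auto split: if_splits)
    then show "m \<in> (\<lambda>m. m - Poly_Mapping.single k l) ` {m. p m \<noteq> 0}"
      by (intro image_eqI[of _ _ "m + Poly_Mapping.single k l"]) simp_all
  qed
  ultimately show "finite {m. (if Poly_Mapping.lookup m k = 0 then p (m + Poly_Mapping.single k l) else 0) \<noteq> 0}"
    by (rule finite_surj)
qed

lemma lookup_var_coeff: "Poly_Mapping.lookup (var_coeff k l p) m =
    (if Poly_Mapping.lookup m k = 0 then Poly_Mapping.lookup p (m + Poly_Mapping.single k l) else 0)"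
  by transfer simp

lemma var_coeff_0 [simp]: "var_coeff k l 0 = 0"
  and var_coeff_add: "var_coeff k l (p + q) = var_coeff k l p + var_coeff k l q"
  and var_coeff_diff: "var_coeff k l (p - q) = var_coeff k l p - var_coeff k l q"
  by (rule poly_mapping_eqI, simp add: lookup_var_coeff lookup_add lookup_minus)+

lemma var_coeff_single:
  "var_coeff k l (Poly_Mapping.single m c) =
     (if Poly_Mapping.lookup m k = l then Poly_Mapping.single (m - Poly_Mapping.single k l) c else 0)"
proof (rule poly_mapping_eqI)
  fix n
  have "Poly_Mapping.lookup n k = 0 \<and> m = n + Poly_Mapping.single k l \<longleftrightarrow>
      Poly_Mapping.lookup m k = l \<and> m - Poly_Mapping.single k l = n"
  proof (intro iffI conjI; elim conjE)
    assume n: "Poly_Mapping.lookup n k = 0" and m: "m = n + Poly_Mapping.single k l"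
    show "Poly_Mapping.lookup m k = l" "m - Poly_Mapping.single k l = n"
      unfolding m using n by (simp_all add: lookup_add)
  next
    assume l: "Poly_Mapping.lookup m k = l" and n: "m - Poly_Mapping.single k l = n"
    show "Poly_Mapping.lookup n k = 0" using l n[symmetric] by (simp add: lookup_minus)
    show "m = n + Poly_Mapping.single k l"
      by (rule poly_mapping_eqI) (use l n[symmetric] in \<open>auto simp: lookup_add lookup_minus lookup_single when_def\<close>)
  qed
  then show "Poly_Mapping.lookup (var_coeff k l (Poly_Mapping.single m c)) n =
      Poly_Mapping.lookup (if Poly_Mapping.lookup m k = l then Poly_Mapping.single (m - Poly_Mapping.single k l) c else 0) n"
    by (auto simp: lookup_var_coeff lookup_single when_def)
qed

lemma var_coeff_mvar_power:
  "var_coeff k l (mvar k ^ j * p) = (if j \<le> l then var_coeff k (l - j) p else 0)"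
proof (induction p rule: poly_mapping_additive_induct)
  case (single m c)
  have "Poly_Mapping.single k j + m - Poly_Mapping.single k l = m - Poly_Mapping.single k (l - j)" if "j \<le> l"
    by (rule poly_mapping_eqI) (use that in \<open>auto simp: lookup_add lookup_minus lookup_single when_def\<close>)
  then show ?case
    by (auto simp: mvar_power mult_single var_coeff_single lookup_add)
qed (simp_all add: distrib_left var_coeff_add)

lemma sum_var_coeff: "\<exists>N. (\<forall>l\<ge>N. var_coeff k l p = 0) \<and> p = (\<Sum>l<N. mvar k ^ l * var_coeff k l p)"
proof (induction p rule: poly_mapping_additive_induct)
  case zero
  then show ?case by simp
next
  case (single m c)
  let ?n = "Poly_Mapping.lookup m k"
  have "Poly_Mapping.single k ?n + (m - Poly_Mapping.single k ?n) = m"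
    by (rule poly_mapping_eqI) (simp add: lookup_add lookup_minus lookup_single when_def)
  then have "mvar k ^ ?n * var_coeff k ?n (Poly_Mapping.single m c) = Poly_Mapping.single m c"
    by (simp add: var_coeff_single mvar_power mult_single)
  moreover have "(\<Sum>l<Suc ?n. mvar k ^ l * var_coeff k l (Poly_Mapping.single m c)) =
      mvar k ^ ?n * var_coeff k ?n (Poly_Mapping.single m c)"
    by (simp add: var_coeff_single)
  ultimately show ?case by (intro exI[of _ "Suc ?n"]) (simp add: var_coeff_single)
next
  case (add p q)
  then obtain M N where MN: "\<forall>l\<ge>M. var_coeff k l p = 0" "p = (\<Sum>l<M. mvar k ^ l * var_coeff k l p)"
    "\<forall>l\<ge>N. var_coeff k l q = 0" "q = (\<Sum>l<N. mvar k ^ l * var_coeff k l q)" by blast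
  have "p + q = (\<Sum>l<M. mvar k ^ l * var_coeff k l p) + (\<Sum>l<N. mvar k ^ l * var_coeff k l q)"
    by (rule arg_cong2[of _ _ _ _ "(+)", OF MN(2,4)])
  also have "(\<Sum>l<M. mvar k ^ l * var_coeff k l p) = (\<Sum>l<max M N. mvar k ^ l * var_coeff k l p)"
    by (rule sum.mono_neutral_left) (use MN(1) in auto)
  also have "(\<Sum>l<N. mvar k ^ l * var_coeff k l q) = (\<Sum>l<max M N. mvar k ^ l * var_coeff k l q)"
    by (rule sum.mono_neutral_left) (use MN(3) in auto)
  also have "(\<Sum>l<max M N. mvar k ^ l * var_coeff k l p) + (\<Sum>l<max M N. mvar k ^ l * var_coeff k l q) =
      (\<Sum>l<max M N. mvar k ^ l * var_coeff k l (p + q))"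
    by (simp only: var_coeff_add distrib_left sum.distrib)
  finally have "p + q = (\<Sum>l<max M N. mvar k ^ l * var_coeff k l (p + q))" .
  moreover have "\<forall>l\<ge>max M N. var_coeff k l (p + q) = 0" using MN(1,3) by (simp add: var_coeff_add)
  ultimately show ?case by blast
qed

text \<open>Stated as linearity of \<open>var_coeff\<close>, the form in which polynomials without
  the variable \<open>k\<close> act on coefficients.\<close>

definition var_free :: "'v \<Rightarrow> (('v \<Rightarrow>\<^sub>0 nat) \<Rightarrow>\<^sub>0 'k::comm_ring_1) \<Rightarrow> bool" where
  "var_free k b \<longleftrightarrow> (\<forall>l p. var_coeff k l (b * p) = b * var_coeff k l p)"

lemma var_free_mpoly_set:
  assumes "b \<in> mpoly_set (- {k})"
  shows "var_free k b"
  unfolding var_free_def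
proof (intro allI)
  fix l p
  show "var_coeff k l (b * p) = b * var_coeff k l p"
  proof (induction b rule: poly_mapping_additive_induct)
    case (single m c)
    then have mk: "Poly_Mapping.lookup m k = 0"
      using assms by (force simp: mpoly_set_def in_keys_iff)
    show ?case
    proof (induction p rule: poly_mapping_additive_induct)
      case (single n d)
      have "m + n - Poly_Mapping.single k l = m + (n - Poly_Mapping.single k l)" if "Poly_Mapping.lookup n k = l"
        by (rule poly_mapping_eqI) (use that mk in \<open>auto simp: lookup_add lookup_minus lookup_single when_def\<close>)
      then show ?case by (auto simp: mult_single var_coeff_single lookup_add mk)
    qed (simp_all add: distrib_left var_coeff_add)
  qed (simp_all add: distrib_right var_coeff_add)
qed

text \<open>For an ideal this means being generated by polynomials without the variable
  \<open>k\<close>: the quotient is then a polynomial ring in that variable over a smaller ring, and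
  membership is decided coefficient by coefficient.\<close>

definition var_closed :: "'v \<Rightarrow> (('v \<Rightarrow>\<^sub>0 nat) \<Rightarrow>\<^sub>0 'k::comm_ring_1) set \<Rightarrow> bool" where
  "var_closed k Q \<longleftrightarrow> (\<forall>p\<in>Q. \<forall>l. var_coeff k l p \<in> Q)"

lemma var_closed_adjoin:
  assumes "var_closed k Q" "var_free k b"
  shows "var_closed k (adjoin Q b)"
  unfolding var_closed_def
proof (intro ballI allI)
  fix p l assume "p \<in> adjoin Q b"
  then obtain t where "p - b * t \<in> Q" by (rule adjoinE)
  then have "var_coeff k l (p - b * t) \<in> Q" using assms(1) by (simp add: var_closed_def)
  then have "var_coeff k l p - b * var_coeff k l t \<in> Q"
    using assms(2) by (simp add: var_coeff_diff var_free_def)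
  then show "var_coeff k l p \<in> adjoin Q b" by (rule adjoinI)
qed

lemma var_closed_nonface_set_Pow:
  assumes "k \<in> F"
  shows "var_closed k (nonface_set (Pow F))"
  unfolding var_closed_def nonface_set_def
proof (intro ballI allI CollectI)
  fix p :: "('a \<Rightarrow>\<^sub>0 nat) \<Rightarrow>\<^sub>0 'b" and l m
  assume p: "p \<in> {p. \<forall>m\<in>Poly_Mapping.keys p. Poly_Mapping.keys m \<notin> Pow F}"
    and "m \<in> Poly_Mapping.keys (var_coeff k l p)"
  then have "m + Poly_Mapping.single k l \<in> Poly_Mapping.keys p"
    by (auto simp: in_keys_iff lookup_var_coeff split: if_splits)
  then have "Poly_Mapping.keys (m + Poly_Mapping.single k l) \<notin> Pow F" using p by blast
  then show "Poly_Mapping.keys m \<notin> Pow F" using assms by (auto simp: keys_plus_nat split: if_splits)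
qed

lemma var_coeff_poly_mult:
  assumes "\<And>i. var_free k (coeff H i)"
  shows "var_coeff k l (poly H (mvar k) * p) = (\<Sum>j\<le>l. coeff H j * var_coeff k (l - j) p)"
  using assms
proof (induction H arbitrary: l)
  case (pCons a H)
  have free: "var_free k a" "\<And>i. var_free k (coeff H i)"
    using pCons.prems[of 0] pCons.prems[of "Suc _"] by simp_all
  have "var_coeff k l (poly (pCons a H) (mvar k) * p) =
      a * var_coeff k l p + var_coeff k l (mvar k ^ 1 * (poly H (mvar k) * p))"
    using free(1) by (simp add: distrib_right var_coeff_add var_free_def mult.assoc)
  also have "\<dots> = (\<Sum>j\<le>l. coeff (pCons a H) j * var_coeff k (l - j) p)"
    unfolding var_coeff_mvar_power
    by (cases l) (simp_all add: pCons.IH[OF free(2)] sum.atMost_Suc_shift del: sum.atMost_Suc)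
  finally show ?case .
qed simp

text \<open>A polynomial whose top coefficient is a unit is a nonzerodivisor over any ring. If
  \<open>l\<close> is the largest exponent at which \<open>p\<close> has a coefficient outside
  \<open>Q\<close>, the coefficient of the product at \<open>l + D\<close> is that coefficient times
  a unit, up to elements of \<open>Q\<close>.\<close>

lemma nonzerodivisor_mod_monic:
  assumes Q: "rmod.subspace Q" "var_closed k Q"
    and H: "\<And>i. var_free k (coeff H i)" "coeffs_below (Suc D) H" "c * coeff H D = 1"
  shows "nonzerodivisor_mod Q (poly H (mvar k))"
  unfolding nonzerodivisor_mod_def
proof (intro allI impI, rule ccontr)
  fix p assume hp: "poly H (mvar k) * p \<in> Q" and "p \<notin> Q"
  obtain N where N: "\<forall>l\<ge>N. var_coeff k l p = 0" "p = (\<Sum>l<N. mvar k ^ l * var_coeff k l p)"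
    using sum_var_coeff[of k p] by (elim exE conjE)
  define L where "L = {l. var_coeff k l p \<notin> Q}"
  have "\<exists>l. var_coeff k l p \<notin> Q"
  proof (rule ccontr)
    assume "\<nexists>l. var_coeff k l p \<notin> Q"
    then have "(\<Sum>l<N. mvar k ^ l * var_coeff k l p) \<in> Q"
      by (intro rmod.subspace_sum[OF Q(1)] rmod.subspace_scale[OF Q(1)]) blast
    then show False using N(2) \<open>p \<notin> Q\<close> by simp
  qed
  then have "L \<noteq> {}" by (auto simp: L_def)
  moreover have "L \<subseteq> {..<N}"
    using N(1) rmod.subspace_0[OF Q(1)] unfolding L_def by (auto intro: ccontr simp: not_less)
  then have fin: "finite L" by (rule finite_subset) simp
  ultimately have "Max L \<in> L" by (intro Max_in)
  define l where "l = Max L"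
  have l: "var_coeff k l p \<notin> Q" using \<open>Max L \<in> L\<close> by (simp add: l_def L_def)
  have bigger: "var_coeff k i p \<in> Q" if "l < i" for i
  proof (rule ccontr)
    assume "var_coeff k i p \<notin> Q"
    then have "i \<le> l" unfolding l_def using fin by (intro Max_ge) (simp_all add: L_def)
    then show False using that by simp
  qed
  have "(\<Sum>j\<le>l + D. coeff H j * var_coeff k (l + D - j) p) \<in> Q"
    using hp Q(2) var_coeff_poly_mult[OF H(1), of "l + D" p] unfolding var_closed_def by metis
  then have "coeff H D * var_coeff k l p + (\<Sum>j\<in>{..l + D} - {D}. coeff H j * var_coeff k (l + D - j) p) \<in> Q"
    by (subst (asm) sum.remove[of _ D]) auto
  moreover have "(\<Sum>j\<in>{..l + D} - {D}. coeff H j * var_coeff k (l + D - j) p) \<in> Q"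
  proof (rule rmod.subspace_sum[OF Q(1)])
    fix j assume "j \<in> {..l + D} - {D}"
    then consider "j < D" | "Suc D \<le> j" by fastforce
    then show "coeff H j * var_coeff k (l + D - j) p \<in> Q"
    proof cases
      case 1
      then show ?thesis using bigger[of "l + D - j"] by (intro rmod.subspace_scale[OF Q(1)]) simp
    next
      case 2
      then show ?thesis using coeffs_belowD[OF H(2)] rmod.subspace_0[OF Q(1)] by simp
    qed
  qed
  ultimately have "coeff H D * var_coeff k l p \<in> Q"
    using subspace_add_right_iff[OF Q(1)] by blast
  then have "c * (coeff H D * var_coeff k l p) \<in> Q" by (rule rmod.subspace_scale[OF Q(1)])
  then show False using l H(3) by (simp add: mult.assoc[symmetric])
qed

subsection \<open>Vandermonde sequences\<close>

definition eval_at :: "'v \<Rightarrow> 'k poly \<Rightarrow> ('v \<Rightarrow>\<^sub>0 nat) \<Rightarrow>\<^sub>0 'k::comm_ring_1" where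
  "eval_at v f = poly (map_poly const f) (mvar v)"

lemma coeff_map_poly_const: "coeff (map_poly const f) i = const (coeff f i)"
  by (simp add: coeff_map_poly)

lemma eval_at_0 [simp]: "eval_at v 0 = 0"
  by (simp add: eval_at_def)

lemma eval_at_pCons: "eval_at v (pCons c f) = const c + mvar v * eval_at v f"
  by (simp add: eval_at_def map_poly_pCons)

lemma eval_at_add: "eval_at v (f + g) = eval_at v f + eval_at v g"
proof -
  have "map_poly const (f + g) = map_poly const f + (map_poly const g :: (('a \<Rightarrow>\<^sub>0 nat) \<Rightarrow>\<^sub>0 'b) poly)"
    by (rule poly_eqI) (simp add: coeff_map_poly_const const_add)
  then show ?thesis by (simp add: eval_at_def)
qed

lemma eval_at_diff: "eval_at v (f - g) = eval_at v f - eval_at v g"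
proof -
  have "map_poly const (f - g) = map_poly const f - (map_poly const g :: (('a \<Rightarrow>\<^sub>0 nat) \<Rightarrow>\<^sub>0 'b) poly)"
    by (rule poly_eqI) (simp add: coeff_map_poly_const const_diff)
  then show ?thesis by (simp add: eval_at_def)
qed

lemma eval_at_smult: "eval_at v (smult c f) = const c * eval_at v f"
proof -
  have "map_poly const (smult c f) = smult (const c) (map_poly const f :: (('a \<Rightarrow>\<^sub>0 nat) \<Rightarrow>\<^sub>0 'b) poly)"
    by (rule poly_eqI) (simp add: coeff_map_poly_const const_mult)
  then show ?thesis by (simp add: eval_at_def)
qed

lemma eval_at_mult: "eval_at v (f * g) = eval_at v f * eval_at v g"
  by (induction f) (simp_all add: eval_at_pCons eval_at_add eval_at_smult algebra_simps)

lemma eval_at_power: "eval_at v (f ^ n) = eval_at v f ^ n"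
  by (induction n) (simp_all add: eval_at_mult one_pCons eval_at_pCons)

lemma mpoly_set_mono: "V \<subseteq> W \<Longrightarrow> mpoly_set V \<subseteq> mpoly_set W"
  unfolding mpoly_set_def by blast

lemma const_mem_mpoly_set: "const c \<in> mpoly_set W"
  unfolding const_def by (rule mem_mpoly_set_single) simp

lemma mvar_mem_mpoly_set: "v \<in> W \<Longrightarrow> mvar v \<in> mpoly_set W"
  unfolding mvar_def by (rule mem_mpoly_set_single) simp

lemma eval_at_mem_mpoly_set: "v \<in> W \<Longrightarrow> eval_at v f \<in> mpoly_set W"
proof (induction f)
  case 0
  show ?case using subring_set_0[OF subring_set_mpoly_set] by simp
next
  case (pCons c f)
  then show ?case
    unfolding eval_at_pCons
    by (intro subring_set_add subring_set_mult subring_set_mpoly_set const_mem_mpoly_set mvar_mem_mpoly_set) auto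
qed

text \<open>The weights are general so that eliminating one variable yields sums of the same kind.\<close>

definition vandermonde_comb ::
    "'v set \<Rightarrow> ('v \<Rightarrow> 'k poly) \<Rightarrow> ('v \<Rightarrow> 'k) \<Rightarrow> ('v \<Rightarrow> 'k) \<Rightarrow> nat \<Rightarrow> ('v \<Rightarrow>\<^sub>0 nat) \<Rightarrow>\<^sub>0 'k::comm_ring_1" where
  "vandermonde_comb F f w a j = (\<Sum>v\<in>F. const (w v * a v ^ j) * eval_at v (pCons 0 (f v)))"

lemma var_free_vandermonde_comb:
  assumes "k \<notin> F"
  shows "var_free k (vandermonde_comb F f w a j)"
  unfolding vandermonde_comb_def
  by (intro var_free_mpoly_set subring_set_sum[OF subring_set_mpoly_set]
      subring_set_mult[OF subring_set_mpoly_set] const_mem_mpoly_set eval_at_mem_mpoly_set) (use assms in auto)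

lemma shift_list_map_upt:
  "shift_list c (f n) (map f [Suc n..<Suc n + d]) = map (\<lambda>j. f (Suc j) - c * f j) [n..<n + d]"
proof (induction d arbitrary: n)
  case (Suc d)
  show ?case using Suc.IH[of "Suc n"] by (simp add: upt_conv_Cons del: upt_Suc)
qed simp

text \<open>Seen as a polynomial in the variable \<open>k\<close>, the sum has the unit
  \<open>w k * lead_coeff (f k)\<close> on top. The summands over \<open>F\<close> enter only the
  constant coefficient, which is not the top one because \<open>pCons 0\<close> raises the
  degree.\<close>

lemma nonzerodivisor_mod_vandermonde_comb:
  fixes f :: "'v \<Rightarrow> 'k::field poly"
  assumes Q: "rmod.subspace Q" "var_closed k Q"
    and k: "finite F" "k \<notin> F" "w k \<noteq> 0" "f k \<noteq> 0"
  shows "nonzerodivisor_mod Q (vandermonde_comb (insert k F) f w a 0)"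
proof -
  let ?b = "vandermonde_comb F f w a 0"
  let ?g = "map_poly const (pCons 0 (f k)) :: (('v \<Rightarrow>\<^sub>0 nat) \<Rightarrow>\<^sub>0 'k) poly"
  define H where "H = [:?b:] + smult (const (w k)) ?g"
  define D where "D = Suc (degree (f k))"
  have coeff_H: "coeff H i = (if i = 0 then ?b else const (w k * coeff (pCons 0 (f k)) i))" for i
    by (cases i) (simp_all add: H_def coeff_map_poly_const const_mult)
  have "poly H (mvar k) = vandermonde_comb (insert k F) f w a 0"
    using k(1,2) by (simp add: H_def vandermonde_comb_def eval_at_def add.commute)
  moreover have "nonzerodivisor_mod Q (poly H (mvar k))"
  proof (rule nonzerodivisor_mod_monic[OF Q])
    show "var_free k (coeff H i)" for i
      unfolding coeff_H using var_free_vandermonde_comb[OF k(2)] var_free_mpoly_set[OF const_mem_mpoly_set] by auto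
    show "coeffs_below (Suc D) H"
      unfolding coeffs_below_def coeff_H D_def by (auto simp: coeff_pCons coeff_eq_0 split: nat.splits)
    show "const (inverse (w k * lead_coeff (f k))) * coeff H D = 1"
    proof -
      have "coeff H D = const (w k * lead_coeff (f k))" unfolding coeff_H D_def by simp
      moreover have "inverse (w k * lead_coeff (f k)) * (w k * lead_coeff (f k)) = 1"
        by (rule left_inverse) (use k(3,4) in simp)
      ultimately show ?thesis by (simp only: const_mult[symmetric] const_1)
    qed
  qed
  ultimately show ?thesis by simp
qed

text \<open>Subtracting \<open>a k\<close> times the predecessor multiplies the weight of
  \<open>v\<close> by \<open>a v - a k\<close>: it removes \<open>k\<close> and, by injectivity,
  leaves nonzero weights on \<open>F\<close>. The shifted entries form a shorter sequence of the
  same kind, to which the induction applies; the unshifted first entry, monic in the variable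
  \<open>k\<close>, is put in front, and the subtraction is then undone.\<close>

lemma weakly_regular_vandermonde_comb:
  fixes f :: "'v \<Rightarrow> 'k::field poly"
  assumes "finite F" "rmod.subspace Q" "\<And>v. v \<in> F \<Longrightarrow> var_closed v Q" "inj_on a F"
    "\<And>v. v \<in> F \<Longrightarrow> w v \<noteq> 0" "\<And>v. v \<in> F \<Longrightarrow> f v \<noteq> 0"
  shows "weakly_regular Q (map (vandermonde_comb F f w a) [0..<card F])"
  using assms
proof (induction F arbitrary: w rule: finite_induct)
  case (insert k F)
  define w' where "w' v = w v * (a v - a k)" for v
  let ?t = "vandermonde_comb (insert k F) f w a" and ?t' = "vandermonde_comb F f w' a"
  have "a v \<noteq> a k" if "v \<in> F" for v
    using inj_onD[OF insert.prems(3), of v k] that insert.hyps(2) by auto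
  then have w': "w' v \<noteq> 0" if "v \<in> F" for v using insert.prems(4) that by (simp add: w'_def)
  have inj: "inj_on a F" using insert.prems(3) by (rule inj_on_subset) blast
  have step: "?t (Suc j) - const (a k) * ?t j = ?t' j" for j
  proof -
    have "?t (Suc j) - const (a k) * ?t j =
        (\<Sum>v\<in>insert k F. const (w' v * a v ^ j) * eval_at v (pCons 0 (f v)))"
      unfolding vandermonde_comb_def sum_distrib_left sum_subtractf[symmetric]
    proof (rule sum.cong)
      fix v
      let ?g = "eval_at v (pCons 0 (f v)) :: ('v \<Rightarrow>\<^sub>0 nat) \<Rightarrow>\<^sub>0 'k"
      have "const (w v * a v ^ Suc j) * ?g - const (a k) * (const (w v * a v ^ j) * ?g) =
          const (w v * a v ^ Suc j - a k * (w v * a v ^ j)) * ?g"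
        by (simp only: const_diff const_mult left_diff_distrib mult.assoc)
      also have "w v * a v ^ Suc j - a k * (w v * a v ^ j) = w' v * a v ^ j"
        by (simp add: w'_def algebra_simps)
      finally show "const (w v * a v ^ Suc j) * ?g - const (a k) * (const (w v * a v ^ j) * ?g) =
          const (w' v * a v ^ j) * ?g" .
    qed simp
    also have "\<dots> = ?t' j" using insert.hyps by (simp add: vandermonde_comb_def w'_def)
    finally show ?thesis .
  qed
  have IH: "weakly_regular Q (map ?t' [0..<card F])"
    by (rule insert.IH[OF insert.prems(1)]) (use insert.prems(2,5) inj w' in auto)
  \<comment> \<open>The sums \<open>?t'\<close> run over \<open>F\<close> and do not involve the
    variable \<open>k\<close>, so adjoining them keeps membership coefficientwise in it; hence
    \<open>?t 0\<close> is a nonzerodivisor after every prefix.\<close>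
  have closed: "var_closed k (foldl adjoin Q (map ?t' js))" if "var_closed k Q" for js Q
    using that by (induction js arbitrary: Q)
      (simp_all add: var_closed_adjoin var_free_vandermonde_comb[OF insert.hyps(2)])
  have "weakly_regular Q (?t 0 # map ?t' [0..<card F])"
  proof (rule weakly_regular_Cons_front[OF insert.prems(1) IH])
    fix i
    show "nonzerodivisor_mod (foldl adjoin Q (take i (map ?t' [0..<card F]))) (?t 0)"
      unfolding take_map
      by (intro nonzerodivisor_mod_vandermonde_comb subspace_foldl_adjoin closed insert.prems insert.hyps) simp_all
  qed
  then have nzd: "nonzerodivisor_mod Q (?t 0)"
    and "weakly_regular (adjoin Q (?t 0)) (map ?t' [0..<card F])" by simp_all
  moreover have "shift_list (const (a k)) (?t 0) (map ?t [1..<Suc (card F)]) = map ?t' [0..<card F]"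
    using shift_list_map_upt[of "const (a k)" ?t 0 "card F"] by (simp add: step del: upt_Suc)
  moreover have "?t 0 \<in> adjoin Q (?t 0)"
    using rmod.subspace_0[OF insert.prems(1)] by (intro adjoinI[of _ _ 1]) simp
  ultimately have "weakly_regular (adjoin Q (?t 0)) (map ?t [1..<Suc (card F)])"
    using weakly_regular_shift_list[OF subspace_adjoin[OF insert.prems(1)]] by metis
  then show ?case using nzd insert.hyps by (simp add: upt_conv_Cons del: upt_Suc)
qed simp

subsection \<open>Shellable complexes\<close>

text \<open>\<open>R\<close> is what is usually called the restriction of the facet \<open>F\<close>.\<close>

inductive shellable :: "nat \<Rightarrow> 'v set set \<Rightarrow> bool" for d where
  shellable_empty: "shellable d {}"
| shellable_step: "shellable d \<Delta> \<Longrightarrow> finite F \<Longrightarrow> card F = d \<Longrightarrow> R \<subseteq> F \<Longrightarrow>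
    (\<And>A. A \<subseteq> F \<Longrightarrow> A \<in> \<Delta> \<longleftrightarrow> \<not> R \<subseteq> A) \<Longrightarrow> shellable d (\<Delta> \<union> Pow F)"

lemma shellable_down_closed: "shellable d \<Delta> \<Longrightarrow> down_closed \<Delta>"
proof (induction rule: shellable.induct)
  case (shellable_step \<Delta> F R)
  then show ?case unfolding down_closed_def by blast
qed (simp add: down_closed_def)

lemma shellable_card: "shellable d \<Delta> \<Longrightarrow> A \<in> \<Delta> \<Longrightarrow> finite A \<and> card A \<le> d"
  by (induction rule: shellable.induct) (auto intro: card_mono finite_subset)

definition squarefree_monomial :: "'v set \<Rightarrow> 'v \<Rightarrow>\<^sub>0 nat" where
  "squarefree_monomial R = (\<Sum>v\<in>R. Poly_Mapping.single v 1)"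

lemma lookup_squarefree_monomial:
  "finite R \<Longrightarrow> Poly_Mapping.lookup (squarefree_monomial R) v = (if v \<in> R then 1 else 0)"
  by (simp add: squarefree_monomial_def lookup_sum lookup_single when_def)

lemma keys_squarefree_monomial: "finite R \<Longrightarrow> Poly_Mapping.keys (squarefree_monomial R) = R"
  by (auto simp: in_keys_iff lookup_squarefree_monomial split: if_splits)

lemma squarefree_monomial_divides:
  assumes "finite R" "R \<subseteq> Poly_Mapping.keys m"
  shows "m = squarefree_monomial R + (m - squarefree_monomial R)"
proof (rule poly_mapping_eqI)
  fix v
  have "v \<in> R \<Longrightarrow> Poly_Mapping.lookup m v \<ge> 1" using assms(2) by (auto simp: in_keys_iff)
  then show "Poly_Mapping.lookup m v = Poly_Mapping.lookup (squarefree_monomial R + (m - squarefree_monomial R)) v"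
    using assms(1) by (simp add: lookup_add lookup_minus lookup_squarefree_monomial)
qed

lemma mem_subspace_nonface_set:
  assumes "rmod.subspace K" "\<And>m c. Poly_Mapping.keys m \<notin> \<Delta> \<Longrightarrow> Poly_Mapping.single m c \<in> K"
    and p: "p \<in> nonface_set \<Delta>"
  shows "p \<in> K"
proof (induction p rule: poly_mapping_additive_induct)
  case zero
  show ?case using rmod.subspace_0[OF assms(1)] .
next
  case (single m c)
  then show ?case using p assms(2) by (simp add: nonface_set_def)
next
  case (add p q)
  then show ?case using rmod.subspace_add[OF assms(1)] by blast
qed

text \<open>The new faces are exactly the sets between \<open>R\<close> and \<open>F\<close>. Hence
  the old ideal \<open>?J\<close> arises from the new ideal \<open>?I\<close> by adjoining the
  monomial of \<open>R\<close>, and the annihilator of this monomial modulo \<open>?I\<close> is the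
  facet ideal \<open>?K\<close>. So \<open>weakly_regular_filtration\<close> combines regularity
  modulo \<open>?J\<close>, from the induction, with regularity modulo \<open>?K\<close>, where the
  Vandermonde argument applies.\<close>

lemma weakly_regular_shellable:
  fixes f :: "'v \<Rightarrow> 'k::field poly"
  assumes "shellable d \<Delta>" "finite V" "\<Union>\<Delta> \<subseteq> V" "inj_on a V" "\<And>v. v \<in> V \<Longrightarrow> f v \<noteq> 0"
  shows "weakly_regular (nonface_set \<Delta>) (map (vandermonde_comb V f (\<lambda>_. 1) a) [0..<d])"
  using assms(1,3)
proof (induction rule: shellable.induct)
  case shellable_empty
  then show ?case using weakly_regular_UNIV by (simp add: nonface_set_def)
next
  case (shellable_step \<Delta> F R)
  let ?\<theta> = "vandermonde_comb V f (\<lambda>_. 1) a" and ?\<phi> = "vandermonde_comb F f (\<lambda>_. 1) a"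
  let ?I = "nonface_set (\<Delta> \<union> Pow F) :: (('v \<Rightarrow>\<^sub>0 nat) \<Rightarrow>\<^sub>0 'k) set"
  let ?J = "nonface_set \<Delta> :: (('v \<Rightarrow>\<^sub>0 nat) \<Rightarrow>\<^sub>0 'k) set"
  let ?K = "nonface_set (Pow F) :: (('v \<Rightarrow>\<^sub>0 nat) \<Rightarrow>\<^sub>0 'k) set"
  have FV: "F \<subseteq> V" and finR: "finite R"
    using shellable_step.prems shellable_step.hyps(2,4) finite_subset by blast+
  have dc: "down_closed \<Delta>" using shellable_step.hyps(1) by (rule shellable_down_closed)
  have dc': "down_closed (\<Delta> \<union> Pow F)" using dc unfolding down_closed_def by blast
  have subI: "rmod.subspace ?I" and subJ: "rmod.subspace ?J" and subK: "rmod.subspace ?K"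
    by (intro subspace_nonface_set dc dc' down_closed_Pow)+
  have R: "R \<notin> \<Delta>" using shellable_step.hyps(4) shellable_step.hyps(5)[of R] by blast
  let ?m = "Poly_Mapping.single (squarefree_monomial R) 1 :: ('v \<Rightarrow>\<^sub>0 nat) \<Rightarrow>\<^sub>0 'k"
  have "weakly_regular ?K (map ?\<phi> [0..<d])"
    unfolding shellable_step.hyps(3)[symmetric]
    by (intro weakly_regular_vandermonde_comb shellable_step.hyps(2) subK var_closed_nonface_set_Pow
        inj_on_subset[OF assms(4) FV]) (use assms(5) FV in auto)
  moreover have "?\<theta> j - ?\<phi> j \<in> ?K" for j
  proof -
    \<comment> \<open>The summands outside \<open>F\<close> carry a factor \<open>mvar v\<close>
      with \<open>v\<close> not in \<open>F\<close>, contributed by \<open>pCons 0\<close>, and so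
      lie in the facet ideal.\<close>
    have "?\<theta> j - ?\<phi> j = (\<Sum>v\<in>V - F. const (1 * a v ^ j) * eval_at v (pCons 0 (f v)))"
      unfolding vandermonde_comb_def using assms(2) FV by (simp add: sum_diff)
    also have "\<dots> \<in> ?K"
    proof (intro rmod.subspace_sum[OF subK] rmod.subspace_scale[OF subK])
      fix v assume "v \<in> V - F"
      then have "mvar v \<in> ?K" by (simp add: mvar_def nonface_set_def)
      then have "eval_at v (f v) * mvar v \<in> ?K" by (rule rmod.subspace_scale[OF subK])
      then show "eval_at v (pCons 0 (f v)) \<in> ?K" by (simp add: eval_at_pCons mult.commute)
    qed
    finally show ?thesis .
  qed
  then have "list_all2 (\<lambda>x y. x - y \<in> ?K) (map ?\<theta> [0..<d]) (map ?\<phi> [0..<d])"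
    by (simp add: list_all2_conv_all_nth)
  ultimately have regK: "weakly_regular ?K (map ?\<theta> [0..<d])"
    using weakly_regular_cong[OF subK] by blast
  have regJ: "weakly_regular ?J (map ?\<theta> [0..<d])"
    using shellable_step.prems by (intro shellable_step.IH) blast
  have "?J = adjoin ?I ?m"
  proof
    show "?J \<subseteq> adjoin ?I ?m"
    proof
      fix p assume "p \<in> ?J"
      then show "p \<in> adjoin ?I ?m"
      proof (rule mem_subspace_nonface_set[OF subspace_adjoin[OF subI], rotated])
        fix m :: "'v \<Rightarrow>\<^sub>0 nat" and c :: 'k
        assume m: "Poly_Mapping.keys m \<notin> \<Delta>"
        show "Poly_Mapping.single m c \<in> adjoin ?I ?m"
        proof (cases "Poly_Mapping.keys m \<subseteq> F")
          case True
          then have "R \<subseteq> Poly_Mapping.keys m" using m shellable_step.hyps(5) by blast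
          then have "Poly_Mapping.single m c = ?m * Poly_Mapping.single (m - squarefree_monomial R) c"
            using squarefree_monomial_divides[OF finR] by (simp add: mult_single)
          then show ?thesis
            using rmod.subspace_0[OF subI] by (intro adjoinI[of _ _ "Poly_Mapping.single (m - squarefree_monomial R) c"]) simp
        next
          case False
          then have "Poly_Mapping.single m c \<in> ?I" using m by (simp add: nonface_set_def)
          then show ?thesis using subset_adjoin by blast
        qed
      qed
    qed
    show "adjoin ?I ?m \<subseteq> ?J"
    proof
      fix p assume "p \<in> adjoin ?I ?m"
      then obtain t where "p - ?m * t \<in> ?I" by (rule adjoinE)
      then have "p - t * ?m \<in> ?J" by (auto simp: nonface_set_def mult.commute)
      moreover have "?m \<in> ?J" using R by (simp add: nonface_set_def keys_squarefree_monomial[OF finR])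
      then have "t * ?m \<in> ?J" by (rule rmod.subspace_scale[OF subJ])
      ultimately have "(p - t * ?m) + t * ?m \<in> ?J" by (rule rmod.subspace_add[OF subJ])
      then show "p \<in> ?J" by simp
    qed
  qed
  moreover have "?m * s \<in> ?I \<longleftrightarrow> s \<in> ?K" for s
  proof
    assume ms: "?m * s \<in> ?I"
    show "s \<in> ?K"
      unfolding nonface_set_def
    proof (intro CollectI ballI)
      fix m assume "m \<in> Poly_Mapping.keys s"
      then have "squarefree_monomial R + m \<in> Poly_Mapping.keys (?m * s)"
        by (simp add: in_keys_iff lookup_single_mult)
      then have "Poly_Mapping.keys (squarefree_monomial R + m) \<notin> Pow F"
        using ms unfolding nonface_set_def by blast
      then show "Poly_Mapping.keys m \<notin> Pow F"
        using shellable_step.hyps(4) by (simp add: keys_plus_nat keys_squarefree_monomial[OF finR])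
    qed
  next
    assume s: "s \<in> ?K"
    have "rmod.subspace {s. ?m * s \<in> ?I}"
      by (rule rmod.subspaceI)
        (auto simp: distrib_left mult.left_commute rmod.subspace_0[OF subI]
          intro: rmod.subspace_add[OF subI] rmod.subspace_scale[OF subI])
    moreover have "Poly_Mapping.single m c \<in> {s. ?m * s \<in> ?I}" if "Poly_Mapping.keys m \<notin> Pow F" for m c
    proof -
      have "R \<union> Poly_Mapping.keys m \<notin> \<Delta>" using R dc unfolding down_closed_def by blast
      then show ?thesis
        using that by (simp add: mult_single nonface_set_def keys_plus_nat keys_squarefree_monomial[OF finR])
    qed
    ultimately have "s \<in> {s. ?m * s \<in> ?I}" using s by (rule mem_subspace_nonface_set)
    then show "?m * s \<in> ?I" by simp
  qed
  ultimately show ?case by (rule weakly_regular_filtration[OF subI subK _ _ regJ regK])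
qed

subsection \<open>Zariski's lemma\<close>

lemma mpoly_set_empty: "x \<in> mpoly_set {} \<Longrightarrow> x = const (Poly_Mapping.lookup x 0)"
proof (rule poly_mapping_eqI)
  fix m assume x: "x \<in> mpoly_set {}"
  have "m = 0" if "m \<in> Poly_Mapping.keys x" using that x by (simp add: mpoly_set_def)
  then show "Poly_Mapping.lookup x m = Poly_Mapping.lookup (const (Poly_Mapping.lookup x 0)) m"
    by (auto simp: const_def lookup_single when_def in_keys_iff)
qed

lemma mpoly_set_singleton: "mpoly_set {v} \<subseteq> range (eval_at v :: 'k::comm_ring_1 poly \<Rightarrow> _)"
proof
  fix p :: "('a \<Rightarrow>\<^sub>0 nat) \<Rightarrow>\<^sub>0 'k" assume "p \<in> mpoly_set {v}"
  then obtain q where q: "q \<in> polys_over (mpoly_set {})" "p = poly q (mvar v)"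
    using mpoly_set_insert_subset[of v "{}"] by (auto simp: extend_def)
  have "q = map_poly const (map_poly (\<lambda>x. Poly_Mapping.lookup x 0) q)"
    using q(1) by (intro poly_eqI) (auto simp: coeff_map_poly polys_over_def intro: mpoly_set_empty)
  then have "p = eval_at v (map_poly (\<lambda>x. Poly_Mapping.lookup x 0) q)"
    unfolding eval_at_def q(2) by simp
  then show "p \<in> range (eval_at v)" by blast
qed

text \<open>Zariski's lemma in terms of denominators. Modulo \<open>P\<close> everything outside
  \<open>P\<close> is invertible, so 1 is a common denominator for the elements of
  \<open>k[x_v]\<close> outside \<open>P\<close>. By \<open>denominator_descent\<close> the other
  variables can be removed one at a time, which leaves a common denominator inside
  \<open>k[x_v]\<close> itself. If \<open>x_v\<close> were transcendental modulo \<open>P\<close>,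
  this would be a nonzero polynomial with a power divisible by any given nonzero polynomial, and
  there is none.\<close>

lemma algebraic_mod_maximal:
  fixes P :: "(('v \<Rightarrow>\<^sub>0 nat) \<Rightarrow>\<^sub>0 'k::field) set"
  assumes V: "finite V" "v \<in> V" and P: "prime_set P"
    and max: "\<And>z. z \<notin> P \<Longrightarrow> \<exists>e\<in>mpoly_set V. 1 - z * e \<in> P"
  shows "\<exists>f. f \<noteq> 0 \<and> eval_at v f \<in> P"
proof (rule ccontr)
  assume "\<nexists>f. f \<noteq> 0 \<and> eval_at v f \<in> P"
  then have transcendental: "f = 0" if "eval_at v f \<in> P" for f using that by blast
  define good where "good W \<longleftrightarrow> (\<exists>c\<in>mpoly_set W. c \<notin> P \<and> (\<forall>z\<in>mpoly_set {v}. z \<notin> P \<longrightarrow>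
    (\<exists>n. \<exists>e\<in>mpoly_set W. c ^ n - z * e \<in> P)))" for W
  have descend: "good {v}" if "good (insert v W)" "finite W" for W
    using that(2,1)
  proof (induction W rule: finite_induct)
    case (insert w W)
    let ?C = "mpoly_set (insert v W) :: (('v \<Rightarrow>\<^sub>0 nat) \<Rightarrow>\<^sub>0 'k) set"
    have sub: "mpoly_set (insert v (insert w W)) \<subseteq> extend ?C (mvar w)"
      using mpoly_set_insert_subset[of w "insert v W"] by (simp add: insert_commute)
    obtain d where d: "d \<in> mpoly_set (insert v (insert w W))" "d \<notin> P"
        "\<forall>z\<in>mpoly_set {v}. z \<notin> P \<longrightarrow> (\<exists>n. \<exists>e\<in>mpoly_set (insert v (insert w W)). d ^ n - z * e \<in> P)"
      using insert.prems unfolding good_def by blast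
    have "d \<in> extend ?C (mvar w)" using d(1) sub by blast
    from denominator_descent[OF P subring_set_mpoly_set this d(2)]
    obtain c where c: "c \<in> ?C" "c \<notin> P" "\<forall>z\<in>?C. (\<exists>n. \<exists>e\<in>extend ?C (mvar w). d ^ n - z * e \<in> P) \<longrightarrow>
        (\<exists>n. \<exists>e\<in>?C. c ^ n - z * e \<in> P)"
      by blast
    have "\<exists>n. \<exists>e\<in>?C. c ^ n - z * e \<in> P" if "z \<in> mpoly_set {v}" "z \<notin> P" for z
    proof -
      have "z \<in> ?C" using that(1) mpoly_set_mono[of "{v}" "insert v W"] by blast
      moreover have "\<exists>n. \<exists>e\<in>extend ?C (mvar w). d ^ n - z * e \<in> P" using d(3) that sub by blast
      ultimately show ?thesis using c(3) by blast
    qed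
    then have "good (insert v W)" using c(1,2) unfolding good_def by blast
    then show ?case by (rule insert.IH)
  qed
  have "\<exists>n. \<exists>e\<in>mpoly_set V. 1 ^ n - z * e \<in> P" if "z \<notin> P" for z
    using max[OF that] by simp
  then have "good V"
    unfolding good_def using prime_setD(2)[OF P] subring_set_1[OF subring_set_mpoly_set]
    by (intro bexI[of _ 1]) simp_all
  then have "good {v}" using descend[of V] V by (simp add: insert_absorb)
  then obtain c where c: "c \<in> mpoly_set {v}" "c \<notin> P" "\<forall>z\<in>mpoly_set {v}. z \<notin> P \<longrightarrow>
      (\<exists>n. \<exists>e\<in>mpoly_set {v}. c ^ n - z * e \<in> P)"
    unfolding good_def by blast
  from subsetD[OF mpoly_set_singleton c(1)] obtain g where g: "c = eval_at v g" by (rule rangeE)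
  have "g \<noteq> 0" using c(2) g rmod.subspace_0[OF prime_setD(1)[OF P]] by auto
  \<comment> \<open>The polynomial \<open>1 + x g\<close>, in Euclid's manner: it is coprime to
    \<open>g\<close>, so it can divide a power of \<open>g\<close> only as a unit, yet its degree is
    positive since \<open>g\<close> is nonzero.\<close>
  let ?h = "pCons 1 g"
  have "eval_at v ?h \<notin> P" using transcendental[of ?h] by auto
  moreover have "eval_at v ?h \<in> mpoly_set {v}" by (rule eval_at_mem_mpoly_set) simp
  ultimately obtain n e where e: "e \<in> mpoly_set {v}" "c ^ n - eval_at v ?h * e \<in> P" using c(3) by blast
  from subsetD[OF mpoly_set_singleton e(1)] obtain k where k: "e = eval_at v k" by (rule rangeE)
  have "eval_at v (g ^ n - ?h * k) \<in> P"
    using e(2) unfolding g k by (simp only: eval_at_diff eval_at_mult eval_at_power)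
  then have "g ^ n = ?h * k" using transcendental[of "g ^ n - ?h * k"] by simp
  then have "?h dvd g ^ n" by (rule dvdI)
  moreover have "is_unit ?h" if "?h dvd g ^ j" for j
    using that
  proof (induction j)
    case (Suc j)
    have "g ^ j = ?h * g ^ j - [:0, 1:] * g ^ Suc j" by simp
    moreover have "?h dvd ?h * g ^ j - [:0, 1:] * g ^ Suc j"
      by (intro dvd_diff dvd_triv_left dvd_mult Suc.prems)
    ultimately show ?case using Suc.IH by argo
  qed simp
  ultimately have "is_unit ?h" by blast
  then have "degree ?h = 0" by (simp add: is_unit_iff_degree)
  then show False using \<open>g \<noteq> 0\<close> by simp
qed

subsection \<open>The dimension bound\<close>

primrec monom_list :: "'a::comm_ring_1 list \<Rightarrow> nat list \<Rightarrow> 'a" where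
  "monom_list [] m = 1"
| "monom_list (y # ys) m = y ^ hd m * monom_list ys (tl m)"

text \<open>A box rather than a bound on the total degree: the first exponent splits off
  independently of the rest, and the number of lists is a plain power.\<close>

definition exponent_lists :: "nat \<Rightarrow> nat \<Rightarrow> nat list set" where
  "exponent_lists M l = {m. set m \<subseteq> {..M} \<and> length m = l}"

lemma finite_exponent_lists: "finite (exponent_lists M l)"
  and card_exponent_lists: "card (exponent_lists M l) = Suc M ^ l"
  unfolding exponent_lists_def by (simp_all add: finite_lists_length_eq card_lists_length_eq)

lemma sum_exponent_lists_Suc:
  "(\<Sum>m\<in>exponent_lists M (Suc l). g m) = (\<Sum>a\<le>M. \<Sum>m\<in>exponent_lists M l. g (a # m))"
proof -
  have "exponent_lists M (Suc l) = (\<lambda>(a, m). a # m) ` ({..M} \<times> exponent_lists M l)"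
    by (auto simp: exponent_lists_def length_Suc_conv)
  moreover have "inj_on (\<lambda>(a, m). a # m) ({..M} \<times> exponent_lists M l)"
    by (auto simp: inj_on_def)
  ultimately show ?thesis
    by (simp add: sum.reindex sum.cartesian_product comp_def case_prod_unfold)
qed

text \<open>In a relation look at the least exponent of the first element: dividing by that power and
  passing to the next prime leaves a relation among the other elements.\<close>

lemma prime_chain_independent:
  fixes emb :: "'k::zero \<Rightarrow> 'a::comm_ring_1"
  assumes emb: "emb 0 = 0" "\<And>c P. prime_set P \<Longrightarrow> emb c \<in> P \<Longrightarrow> c = 0"
    and "\<And>i. i \<le> length ys \<Longrightarrow> prime_set (Q i)" "\<And>i. i < length ys \<Longrightarrow> Q i \<subseteq> Q (Suc i)"
      "\<And>i. i < length ys \<Longrightarrow> ys ! i \<in> Q (Suc i) - Q i"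
    and "(\<Sum>m\<in>exponent_lists M (length ys). emb (c m) * monom_list ys m) \<in> Q 0"
    and "m \<in> exponent_lists M (length ys)"
  shows "c m = 0"
  using assms(3-)
proof (induction ys arbitrary: Q c m)
  case Nil
  have "exponent_lists M 0 = {[]}" by (auto simp: exponent_lists_def)
  then show ?case using Nil.prems(1)[of 0] Nil.prems(4,5) emb(2) by simp
next
  case (Cons y ys)
  define G where "G a = (\<Sum>m\<in>exponent_lists M (length ys). emb (c (a # m)) * monom_list ys m)" for a
  have Q0: "prime_set (Q 0)" and Q1: "prime_set (Q 1)" and Q01: "Q 0 \<subseteq> Q 1" and y: "y \<in> Q 1" "y \<notin> Q 0"
    using Cons.prems(1)[of 0] Cons.prems(1)[of 1] Cons.prems(2)[of 0] Cons.prems(3)[of 0] by simp_all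
  have "(\<Sum>a\<le>M. y ^ a * G a) \<in> Q 0"
    using Cons.prems(4) by (simp add: sum_exponent_lists_Suc G_def sum_distrib_left mult.left_commute)
  have zero: "c (a # m) = 0" if "a \<le> M" "m \<in> exponent_lists M (length ys)" for a m
    using that
  proof (induction a arbitrary: m rule: less_induct)
    case (less a)
    define T where "T = (\<Sum>b\<in>{Suc a..M}. y ^ (b - Suc a) * G b)"
    have "G b = 0" if "b < a" for b
      unfolding G_def using less.IH[OF that] that less.prems(1) emb(1) by (intro sum.neutral) simp
    then have "(\<Sum>b\<le>M. y ^ b * G b) = (\<Sum>b\<in>{a..M}. y ^ b * G b)"
      by (intro sum.mono_neutral_right) auto
    also have "\<dots> = y ^ a * G a + (\<Sum>b\<in>{Suc a..M}. y ^ b * G b)"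
      using less.prems(1) by (rule sum.atLeast_Suc_atMost)
    also have "(\<Sum>b\<in>{Suc a..M}. y ^ b * G b) = y ^ a * (y * T)"
      unfolding T_def sum_distrib_left
    proof (rule sum.cong)
      fix b assume "b \<in> {Suc a..M}"
      then have "b = a + Suc (b - Suc a)" by simp
      then have "y ^ b = y ^ a * (y * y ^ (b - Suc a))" by (metis power_add power_Suc)
      then show "y ^ b * G b = y ^ a * (y * (y ^ (b - Suc a) * G b))" by (simp add: mult.assoc)
    qed simp
    finally have "(\<Sum>b\<le>M. y ^ b * G b) = y ^ a * (G a + y * T)" by (simp add: distrib_left)
    then have "y ^ a * (G a + y * T) \<in> Q 0" using \<open>(\<Sum>a\<le>M. y ^ a * G a) \<in> Q 0\<close> by simp
    then have "G a + y * T \<in> Q 0" using prime_setD(3)[OF Q0] prime_set_power[OF Q0] y(2) by blast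
    then have "G a + T * y \<in> Q 1" using Q01 by (auto simp: mult.commute)
    then have "G a \<in> Q 1"
      using subspace_add_right_iff[OF prime_setD(1)[OF Q1] rmod.subspace_scale[OF prime_setD(1)[OF Q1] y(1)]]
      by blast
    then show ?case
      using Cons.prems(1)[of "Suc _"] Cons.prems(2)[of "Suc _"] Cons.prems(3)[of "Suc _"] less.prems(2)
      by (intro Cons.IH[of "\<lambda>i. Q (Suc i)" "\<lambda>m. c (a # m)"]) (simp_all add: G_def)
  qed
  obtain a m' where "m = a # m'" "a \<le> M" "m' \<in> exponent_lists M (length ys)"
    using Cons.prems(5) by (auto simp: exponent_lists_def length_Suc_conv)
  then show ?case using zero by simp
qed

section \<open>Counting monomials with bounded exponents\<close>

definition exponents_le :: "nat \<Rightarrow> (('v \<Rightarrow>\<^sub>0 nat) \<Rightarrow>\<^sub>0 'k::comm_ring_1) \<Rightarrow> bool" where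
  "exponents_le E p \<longleftrightarrow> (\<forall>m\<in>Poly_Mapping.keys p. \<forall>v. Poly_Mapping.lookup m v \<le> E)"

lemma exponents_le_mono: "exponents_le E p \<Longrightarrow> E \<le> E' \<Longrightarrow> exponents_le E' p"
  unfolding exponents_le_def by (meson le_trans)

lemma exponents_le_mult:
  assumes "exponents_le E p" "exponents_le E' q"
  shows "exponents_le (E + E') (p * q)"
  unfolding exponents_le_def
proof (intro ballI allI)
  fix m v assume "m \<in> Poly_Mapping.keys (p * q)"
  then obtain a b where "a \<in> Poly_Mapping.keys p" "b \<in> Poly_Mapping.keys q" "m = a + b" by (rule keys_mult_nat)
  then show "Poly_Mapping.lookup m v \<le> E + E'" using assms by (simp add: exponents_le_def lookup_add add_mono)
qed

lemma exponents_le_1: "exponents_le E 1"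
  by (simp add: exponents_le_def)

lemma exponents_le_power: "exponents_le E p \<Longrightarrow> exponents_le (n * E) (p ^ n)"
  by (induction n) (simp_all add: exponents_le_1 exponents_le_mult)

lemma exponents_le_exists:
  assumes "finite S"
  shows "\<exists>E. \<forall>p\<in>S. exponents_le E p"
proof -
  have "finite (range (Poly_Mapping.lookup m))" for m :: "'a \<Rightarrow>\<^sub>0 nat"
  proof (rule finite_subset)
    show "range (Poly_Mapping.lookup m) \<subseteq> insert 0 (Poly_Mapping.lookup m ` Poly_Mapping.keys m)"
      by (auto simp: in_keys_iff)
  qed simp
  then have "finite (\<Union>p\<in>S. \<Union>m\<in>Poly_Mapping.keys p. range (Poly_Mapping.lookup m))"
    using assms by simp
  then obtain E where "\<forall>n\<in>(\<Union>p\<in>S. \<Union>m\<in>Poly_Mapping.keys p. range (Poly_Mapping.lookup m)). n \<le> E"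
    unfolding finite_nat_set_iff_bounded_le by (rule exE)
  then have "\<forall>p\<in>S. exponents_le E p" by (simp add: exponents_le_def)
  then show ?thesis ..
qed

lemma exponents_le_monom_list:
  assumes "\<And>y. y \<in> set ys \<Longrightarrow> exponents_le E y" "m \<in> exponent_lists M (length ys)"
  shows "exponents_le (length ys * (M * E)) (monom_list ys m)"
  using assms
proof (induction ys arbitrary: m)
  case (Cons y ys)
  then obtain a m' where m: "m = a # m'" "a \<le> M" "m' \<in> exponent_lists M (length ys)"
    by (auto simp: exponent_lists_def length_Suc_conv)
  have "exponents_le (M * E) (y ^ a)"
    by (rule exponents_le_mono[OF exponents_le_power]) (use Cons.prems(1) m(2) in auto)
  then show ?case using Cons.IH[OF _ m(3)] Cons.prems(1) m(1) exponents_le_mult by auto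
qed (simp add: exponents_le_1)

text \<open>A monomial is determined by its support, for which there are
  \<open>card \<Delta>\<close> choices, and by its exponents there, of which at most
  \<open>d\<close> can be chosen.\<close>

lemma card_bounded_monomials:
  assumes "finite \<Delta>" "\<And>A. A \<in> \<Delta> \<Longrightarrow> finite A \<and> card A \<le> d"
  shows "finite {m :: 'v \<Rightarrow>\<^sub>0 nat. Poly_Mapping.keys m \<in> \<Delta> \<and> (\<forall>v. Poly_Mapping.lookup m v \<le> X)} \<and>
    card {m :: 'v \<Rightarrow>\<^sub>0 nat. Poly_Mapping.keys m \<in> \<Delta> \<and> (\<forall>v. Poly_Mapping.lookup m v \<le> X)} \<le> card \<Delta> * Suc X ^ d"
    (is "finite ?S \<and> card ?S \<le> _")
proof -
  define B where "B A = {m :: 'v \<Rightarrow>\<^sub>0 nat. Poly_Mapping.keys m = A \<and> (\<forall>v. Poly_Mapping.lookup m v \<le> X)}" for A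
  have B: "finite (B A) \<and> card (B A) \<le> Suc X ^ d" if "A \<in> \<Delta>" for A
  proof -
    let ?r = "\<lambda>m :: 'v \<Rightarrow>\<^sub>0 nat. restrict (Poly_Mapping.lookup m) A"
    have inj: "inj_on ?r (B A)"
    proof (rule inj_onI)
      fix m n assume mn: "m \<in> B A" "n \<in> B A" "?r m = ?r n"
      show "m = n"
      proof (rule poly_mapping_eqI)
        fix v
        have "v \<notin> A \<Longrightarrow> Poly_Mapping.lookup m v = 0 \<and> Poly_Mapping.lookup n v = 0"
          using mn(1,2) by (auto simp: B_def in_keys_iff)
        moreover have "v \<in> A \<Longrightarrow> Poly_Mapping.lookup m v = Poly_Mapping.lookup n v"
          using fun_cong[OF mn(3), of v] by simp
        ultimately show "Poly_Mapping.lookup m v = Poly_Mapping.lookup n v" by fastforce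
      qed
    qed
    have img: "?r ` B A \<subseteq> PiE A (\<lambda>_. {..X})" by (auto simp: B_def)
    have fin: "finite (PiE A (\<lambda>_. {..X}))" using assms(2)[OF that] by (intro finite_PiE) auto
    have "card (B A) \<le> card (PiE A (\<lambda>_. {..X}))" by (rule card_inj_on_le[OF inj img fin])
    also have "\<dots> = Suc X ^ card A" using assms(2)[OF that] by (simp add: card_PiE)
    also have "\<dots> \<le> Suc X ^ d" using assms(2)[OF that] by (intro power_increasing) auto
    finally show ?thesis using inj_on_finite[OF inj img fin] by simp
  qed
  have S: "?S = (\<Union>A\<in>\<Delta>. B A)" by (auto simp: B_def)
  have "card ?S \<le> (\<Sum>A\<in>\<Delta>. card (B A))" unfolding S by (rule card_UN_le[OF assms(1)])
  also have "\<dots> \<le> (\<Sum>A\<in>\<Delta>. Suc X ^ d)" using B by (intro sum_mono) auto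
  finally show ?thesis unfolding S using assms(1) B by simp
qed

text \<open>A longer chain would give \<open>d + 1\<close> elements, one from each step, that are
  algebraically independent modulo the ideal. The products with exponents up to \<open>M\<close>
  number \<open>Suc M ^ Suc d\<close>, while their face parts lie in a space whose dimension grows
  only like the \<open>d\<close>-th power of \<open>M\<close>.\<close>

lemma prime_chain_length_le:
  fixes Q :: "nat \<Rightarrow> (('v \<Rightarrow>\<^sub>0 nat) \<Rightarrow>\<^sub>0 'k::field) set"
  assumes \<Delta>: "finite \<Delta>" "down_closed \<Delta>" "\<And>A. A \<in> \<Delta> \<Longrightarrow> finite A \<and> card A \<le> d"
    and Q: "\<And>i. i \<le> l \<Longrightarrow> prime_set (Q i)" "\<And>i. i < l \<Longrightarrow> Q i \<subset> Q (Suc i)" "nonface_set \<Delta> \<subseteq> Q 0"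
  shows "l \<le> d"
proof (rule ccontr)
  assume "\<not> l \<le> d"
  interpret kv: vector_space "\<lambda>c (p :: ('v \<Rightarrow>\<^sub>0 nat) \<Rightarrow>\<^sub>0 'k). const c * p"
    by unfold_locales (simp_all add: const_add const_mult algebra_simps)
  let ?I = "nonface_set \<Delta> :: (('v \<Rightarrow>\<^sub>0 nat) \<Rightarrow>\<^sub>0 'k) set"
  have subI: "rmod.subspace ?I" by (rule subspace_nonface_set[OF \<Delta>(2)])
  \<comment> \<open>The normal form modulo \<open>?I\<close>: only monomials supported on faces are
    kept. It replaces the quotient space in the dimension count.\<close>
  define part where "part p = (\<Sum>m\<in>{m\<in>Poly_Mapping.keys p. Poly_Mapping.keys m \<in> \<Delta>}.
    Poly_Mapping.single m (Poly_Mapping.lookup p m))" for p :: "('v \<Rightarrow>\<^sub>0 nat) \<Rightarrow>\<^sub>0 'k"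
  have lookup_part: "Poly_Mapping.lookup (part p) m = (if Poly_Mapping.keys m \<in> \<Delta> then Poly_Mapping.lookup p m else 0)" for p m
    by (auto simp: part_def lookup_sum lookup_single when_def in_keys_iff)
  have part: "p - part p \<in> ?I" for p
    by (auto simp: nonface_set_def in_keys_iff lookup_minus lookup_part)
  have "\<forall>i<l. \<exists>y. y \<in> Q (Suc i) - Q i" using Q(2) by blast
  then obtain z where z: "\<And>i. i < l \<Longrightarrow> z i \<in> Q (Suc i) - Q i" by metis
  define ys where "ys = map z [0..<Suc d]"
  have len: "length ys = Suc d" by (simp add: ys_def)
  have chain: "ys ! i \<in> Q (Suc i) - Q i" if "i < length ys" for i
    using that z[of i] \<open>\<not> l \<le> d\<close> len unfolding ys_def by (simp del: upt_Suc)
  obtain E where E: "\<forall>y\<in>set ys. exponents_le E y" using exponents_le_exists[of "set ys"] by auto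
  \<comment> \<open>\<open>K\<close> ensures \<open>Suc X \<le> K * Suc M\<close>. With
    \<open>M\<close> as below, the upper bound \<open>card \<Delta> * (K * Suc M) ^ d\<close>
    becomes \<open>M * Suc M ^ d\<close>, just short of \<open>Suc M ^ Suc d\<close>.\<close>
  define K where "K = Suc (Suc d * E)"
  define M where "M = card \<Delta> * K ^ d"
  define X where "X = length ys * (M * E)"
  let ?L = "exponent_lists M (length ys)" and ?\<phi> = "\<lambda>m. part (monom_list ys m)"
  let ?B = "{m :: 'v \<Rightarrow>\<^sub>0 nat. Poly_Mapping.keys m \<in> \<Delta> \<and> (\<forall>v. Poly_Mapping.lookup m v \<le> X)}"
  let ?T = "(\<lambda>m. Poly_Mapping.single m (1 :: 'k)) ` ?B"
  have unit: "c = 0" if "prime_set P" "const c \<in> P" for c :: 'k and P :: "(('v \<Rightarrow>\<^sub>0 nat) \<Rightarrow>\<^sub>0 'k) set"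
  proof (rule ccontr)
    assume "c \<noteq> 0"
    have "const (inverse c) * const c \<in> P" using prime_setD(1)[OF that(1)] that(2) by (rule rmod.subspace_scale)
    then show False using \<open>c \<noteq> 0\<close> prime_setD(2)[OF that(1)] by (simp add: const_mult[symmetric])
  qed
  have indep: "c m = 0" if "(\<Sum>m\<in>?L. const (c m) * ?\<phi> m) = 0" "m \<in> ?L" for c m
  proof (rule prime_chain_independent[where emb = const and Q = Q and c = c and ys = ys and M = M])
    have "(\<Sum>m\<in>?L. const (c m) * (monom_list ys m - ?\<phi> m)) \<in> ?I"
      by (intro rmod.subspace_sum[OF subI] rmod.subspace_scale[OF subI] part)
    also have "(\<Sum>m\<in>?L. const (c m) * (monom_list ys m - ?\<phi> m)) = (\<Sum>m\<in>?L. const (c m) * monom_list ys m)"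
      using that(1) by (simp add: right_diff_distrib sum_subtractf)
    finally show "(\<Sum>m\<in>?L. const (c m) * monom_list ys m) \<in> Q 0" using Q(3) by blast
    show "Q i \<subseteq> Q (Suc i)" if "i < length ys" for i using Q(2)[of i] that \<open>\<not> l \<le> d\<close> len by auto
    show "prime_set (Q i)" if "i \<le> length ys" for i using Q(1)[of i] that \<open>\<not> l \<le> d\<close> len by auto
  qed (use unit chain that(2) in auto)
  \<comment> \<open>\<open>indep\<close> concerns a family; injectivity is required to pass to
    independence of the set of its values and to count that set.\<close>
  have inj: "inj_on ?\<phi> ?L"
  proof (rule inj_onI, rule ccontr)
    fix m n assume mn: "m \<in> ?L" "n \<in> ?L" "?\<phi> m = ?\<phi> n" "m \<noteq> n"
    define c :: "nat list \<Rightarrow> 'k" where "c i = (if i = m then 1 else if i = n then -1 else 0)" for i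
    have "(\<Sum>i\<in>?L. const (c i) * ?\<phi> i) = (\<Sum>i\<in>{m, n}. const (c i) * ?\<phi> i)"
      by (rule sum.mono_neutral_right) (use mn(1,2) finite_exponent_lists in \<open>auto simp: c_def\<close>)
    also have "\<dots> = const 1 * ?\<phi> m + const (- 1) * ?\<phi> n" using mn(4) by (simp add: c_def)
    also have "\<dots> = const (1 + - 1) * ?\<phi> n" unfolding mn(3) const_add distrib_right ..
    finally have "c m = 0" using indep[of c m] mn(1) by simp
    then show False by (simp add: c_def)
  qed
  have "kv.independent (?\<phi> ` ?L)"
  proof (rule kv.independent_if_scalars_zero)
    show "finite (?\<phi> ` ?L)" using finite_exponent_lists by simp
    fix f x assume f: "(\<Sum>x\<in>?\<phi> ` ?L. const (f x) * x) = 0" and "x \<in> ?\<phi> ` ?L"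
    then obtain m where m: "m \<in> ?L" "x = ?\<phi> m" by blast
    have "(\<Sum>m\<in>?L. const (f (?\<phi> m)) * ?\<phi> m) = 0"
      using f by (simp add: sum.reindex[OF inj])
    then show "f x = 0" using indep[of "\<lambda>m. f (?\<phi> m)" m] m by simp
  qed
  moreover have "?\<phi> ` ?L \<subseteq> kv.span ?T"
  proof
    fix x assume "x \<in> ?\<phi> ` ?L"
    then obtain m where m: "m \<in> ?L" "x = ?\<phi> m" by blast
    have le: "exponents_le X (monom_list ys m)"
      unfolding X_def using E m(1) by (intro exponents_le_monom_list) auto
    show "x \<in> kv.span ?T"
      unfolding m(2) part_def
    proof (intro kv.span_sum)
      fix n assume n: "n \<in> {n \<in> Poly_Mapping.keys (monom_list ys m). Poly_Mapping.keys n \<in> \<Delta>}"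
      then have "Poly_Mapping.single n 1 \<in> ?T" using le by (auto simp: exponents_le_def)
      then have "const (Poly_Mapping.lookup (monom_list ys m) n) * Poly_Mapping.single n 1 \<in> kv.span ?T"
        by (intro kv.span_scale kv.span_base)
      then show "Poly_Mapping.single n (Poly_Mapping.lookup (monom_list ys m) n) \<in> kv.span ?T"
        by (simp add: const_def mult_single)
    qed
  qed
  moreover have finB: "finite ?B" and cardB: "card ?B \<le> card \<Delta> * Suc X ^ d"
    using card_bounded_monomials[OF \<Delta>(1,3), of X] by blast+
  have "finite ?T" using finB by simp
  ultimately have "card (?\<phi> ` ?L) \<le> card ?T" using kv.independent_span_bound by blast
  also have "\<dots> \<le> card ?B" using finB by (rule card_image_le)
  also have "\<dots> \<le> card \<Delta> * Suc X ^ d" by (rule cardB)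
  finally have "card (?\<phi> ` ?L) \<le> card \<Delta> * Suc X ^ d" .
  moreover have "card (?\<phi> ` ?L) = Suc M ^ Suc d"
    unfolding card_image[OF inj] card_exponent_lists by (simp only: len)
  ultimately have "Suc M ^ Suc d \<le> card \<Delta> * Suc X ^ d"
    by simp
  also have "\<dots> \<le> card \<Delta> * (K * Suc M) ^ d"
    unfolding X_def K_def len by (intro mult_left_mono power_mono) (auto simp: algebra_simps)
  also have "\<dots> = M * Suc M ^ d" unfolding M_def power_mult_distrib by simp
  finally show False by simp
qed

subsection \<open>Hilbert's basis theorem\<close>

text \<open>Ideals of the subring \<open>C\<close>: scalars come from \<open>C\<close> alone, unlike
  for \<open>rmod.subspace\<close>, where they range over the whole type.\<close>

definition ideal_in :: "'a::comm_ring_1 set \<Rightarrow> 'a set \<Rightarrow> bool" where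
  "ideal_in C J \<longleftrightarrow> J \<subseteq> C \<and> 0 \<in> J \<and> (\<forall>x\<in>J. \<forall>y\<in>J. x + y \<in> J) \<and> (\<forall>c\<in>C. \<forall>x\<in>J. c * x \<in> J)"

lemma ideal_inD:
  assumes "ideal_in C J"
  shows "x \<in> J \<Longrightarrow> x \<in> C" "0 \<in> J" "x \<in> J \<Longrightarrow> y \<in> J \<Longrightarrow> x + y \<in> J" "c \<in> C \<Longrightarrow> x \<in> J \<Longrightarrow> c * x \<in> J"
  using assms unfolding ideal_in_def by blast+

text \<open>Finite generation is expressed by \<open>J\<close> being the least ideal of
  \<open>C\<close> that contains \<open>G\<close>, which avoids an operator for ideals generated
  within \<open>C\<close>.\<close>

definition noetherian_set :: "'a::comm_ring_1 set \<Rightarrow> bool" where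
  "noetherian_set C \<longleftrightarrow> (\<forall>J. ideal_in C J \<longrightarrow>
     (\<exists>G. finite G \<and> G \<subseteq> J \<and> (\<forall>K. ideal_in C K \<longrightarrow> G \<subseteq> K \<longrightarrow> J \<subseteq> K)))"

lemma ideal_in_subspace_Int:
  assumes C: "subring_set C" and K: "rmod.subspace K"
  shows "ideal_in C (K \<inter> C)"
  unfolding ideal_in_def
proof (intro conjI ballI)
  show "0 \<in> K \<inter> C" using rmod.subspace_0[OF K] subring_set_0[OF C] by blast
  show "x + y \<in> K \<inter> C" if "x \<in> K \<inter> C" "y \<in> K \<inter> C" for x y
    using that rmod.subspace_add[OF K, of x y] subring_set_add[OF C, of x y] by blast
  show "c * x \<in> K \<inter> C" if "c \<in> C" "x \<in> K \<inter> C" for c x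
    using that rmod.subspace_scale[OF K, of x c] subring_set_mult[OF C, of c x] by blast
qed blast

lemma noetherian_setD:
  "noetherian_set C \<Longrightarrow> ideal_in C J \<Longrightarrow>
     \<exists>G. finite G \<and> G \<subseteq> J \<and> (\<forall>K. ideal_in C K \<longrightarrow> G \<subseteq> K \<longrightarrow> J \<subseteq> K)"
  unfolding noetherian_set_def by simp

definition top_coeffs :: "'a::comm_ring_1 set \<Rightarrow> 'a \<Rightarrow> 'a set \<Rightarrow> nat \<Rightarrow> 'a set" where
  "top_coeffs C y J n = {a. \<exists>q\<in>polys_over C. coeffs_below (Suc n) q \<and> coeff q n = a \<and> poly q y \<in> J}"

lemma ideal_in_top_coeffs:
  assumes C: "subring_set C" and J: "ideal_in (extend C y) J"
  shows "ideal_in C (top_coeffs C y J n)"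
proof -
  note pC = subring_set_polys_over[OF C]
  show ?thesis
    unfolding ideal_in_def
  proof (intro conjI ballI subsetI)
    show "a \<in> C" if "a \<in> top_coeffs C y J n" for a
      using that by (auto simp: top_coeffs_def polys_over_def)
    show "0 \<in> top_coeffs C y J n"
      unfolding top_coeffs_def using subring_set_0[OF pC] ideal_inD(2)[OF J]
      by (intro CollectI bexI[of _ 0]) (simp_all add: coeffs_below_def)
    show "a + b \<in> top_coeffs C y J n" if ab: "a \<in> top_coeffs C y J n" "b \<in> top_coeffs C y J n" for a b
    proof -
      obtain p q where p: "p \<in> polys_over C" "coeffs_below (Suc n) p" "coeff p n = a" "poly p y \<in> J"
        and q: "q \<in> polys_over C" "coeffs_below (Suc n) q" "coeff q n = b" "poly q y \<in> J"
        using ab unfolding top_coeffs_def by blast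
      have "coeffs_below (Suc n) (p + q)" using p(2) q(2) by (simp add: coeffs_below_def)
      then show ?thesis
        unfolding top_coeffs_def
        using subring_set_add[OF pC p(1) q(1)] ideal_inD(3)[OF J p(4) q(4)] p(3) q(3)
        by (intro CollectI bexI[of _ "p + q"]) simp_all
    qed
    show "c * a \<in> top_coeffs C y J n" if c: "c \<in> C" and a: "a \<in> top_coeffs C y J n" for c a
    proof -
      obtain p where p: "p \<in> polys_over C" "coeffs_below (Suc n) p" "coeff p n = a" "poly p y \<in> J"
        using a unfolding top_coeffs_def by blast
      have "c \<in> extend C y" using subset_extend[OF C] c by blast
      then have "c * poly p y \<in> J" by (rule ideal_inD(4)[OF J _ p(4)])
      moreover have "coeffs_below (Suc n) (smult c p)" using p(2) by (simp add: coeffs_below_def)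
      ultimately show ?thesis
        unfolding top_coeffs_def using polys_over_smult[OF C c p(1)] p(3)
        by (intro CollectI bexI[of _ "smult c p"]) simp_all
    qed
  qed
qed

lemma top_coeffs_shift:
  assumes C: "subring_set C" and J: "ideal_in (extend C y) J" and a: "a \<in> top_coeffs C y J n"
  shows "\<exists>q\<in>polys_over C. coeffs_below (Suc (n + k)) q \<and> coeff q (n + k) = a \<and> poly q y \<in> J"
proof -
  obtain p where p: "p \<in> polys_over C" "coeffs_below (Suc n) p" "coeff p n = a" "poly p y \<in> J"
    using a unfolding top_coeffs_def by blast
  have "y ^ k \<in> extend C y" using mem_extend[OF C] subring_set_power[OF subring_set_extend[OF C]] by blast
  then have "y ^ k * poly p y \<in> J" by (rule ideal_inD(4)[OF J _ p(4)])
  moreover have "coeffs_below (Suc (n + k)) (monom 1 k * p)"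
    using p(2) by (auto simp: coeffs_below_def coeff_monom_mult)
  moreover have "monom 1 k * p \<in> polys_over C"
    by (intro subring_set_mult[OF subring_set_polys_over[OF C]] polys_over_monom[OF C] subring_set_1[OF C] p(1))
  ultimately show ?thesis
    using p(3) by (intro bexI[of _ "monom 1 k * p"]) (simp_all add: poly_monom coeff_monom_mult)
qed

text \<open>The leading coefficient ideals increase with the degree, and their union is finitely
  generated, so they are constant from some \<open>N\<close> on. Lifts of generators in the degrees
  up to \<open>N\<close> generate \<open>J\<close>, since they allow the top coefficient of any
  representing polynomial to be cancelled.\<close>

lemma noetherian_set_extend:
  assumes C: "subring_set C" and noeth: "noetherian_set C"
  shows "noetherian_set (extend C y)"
  unfolding noetherian_set_def
proof (intro allI impI)
  fix J assume J: "ideal_in (extend C y) J"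
  let ?D = "extend C y" and ?L = "top_coeffs C y J"
  have L: "ideal_in C (?L n)" for n by (rule ideal_in_top_coeffs[OF C J])
  have mono: "?L n \<subseteq> ?L m" if "n \<le> m" for n m
  proof
    fix a assume "a \<in> ?L n"
    from top_coeffs_shift[OF C J this, of "m - n"] that show "a \<in> ?L m" by (simp add: top_coeffs_def)
  qed
  have fg: "\<exists>G. finite G \<and> G \<subseteq> I \<and> (\<forall>K. ideal_in C K \<longrightarrow> G \<subseteq> K \<longrightarrow> I \<subseteq> K)" if "ideal_in C I" for I
    using noeth that unfolding noetherian_set_def by blast
  have "ideal_in C (\<Union>n. ?L n)"
    unfolding ideal_in_def
  proof (intro conjI ballI)
    show "(\<Union>n. ?L n) \<subseteq> C" using ideal_inD(1)[OF L] by blast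
    show "0 \<in> (\<Union>n. ?L n)" using ideal_inD(2)[OF L] by blast
    show "c * a \<in> (\<Union>n. ?L n)" if "c \<in> C" "a \<in> (\<Union>n. ?L n)" for c a
      using that ideal_inD(4)[OF L that(1)] by blast
    show "a + b \<in> (\<Union>n. ?L n)" if ab: "a \<in> (\<Union>n. ?L n)" "b \<in> (\<Union>n. ?L n)" for a b
    proof -
      obtain n m where "a \<in> ?L n" "b \<in> ?L m" using ab by blast
      then have "a \<in> ?L (max n m)" "b \<in> ?L (max n m)" using mono[of n "max n m"] mono[of m "max n m"] by auto
      then have "a + b \<in> ?L (max n m)" by (rule ideal_inD(3)[OF L])
      then show ?thesis by blast
    qed
  qed
  from fg[OF this] obtain G0 where G0: "finite G0" "G0 \<subseteq> (\<Union>n. ?L n)"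
      "\<And>K. ideal_in C K \<Longrightarrow> G0 \<subseteq> K \<Longrightarrow> (\<Union>n. ?L n) \<subseteq> K"
    by blast
  have "\<exists>N. G0 \<subseteq> ?L N"
    using G0(1,2)
  proof (induction G0 rule: finite_induct)
    case (insert a F)
    then obtain N n where "F \<subseteq> ?L N" "a \<in> ?L n" by blast
    then have "insert a F \<subseteq> ?L (max N n)" using mono[of N "max N n"] mono[of n "max N n"] by auto
    then show ?case by blast
  qed simp
  then obtain N where "G0 \<subseteq> ?L N" by blast
  from G0(3)[OF L this] have stable: "?L n \<subseteq> ?L N" for n by blast
  have "\<forall>n. \<exists>G. finite G \<and> G \<subseteq> ?L n \<and> (\<forall>K. ideal_in C K \<longrightarrow> G \<subseteq> K \<longrightarrow> ?L n \<subseteq> K)"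
    using fg[OF L] by blast
  then obtain G where G: "\<And>n. finite (G n)" "\<And>n. G n \<subseteq> ?L n"
      "\<And>n K. ideal_in C K \<Longrightarrow> G n \<subseteq> K \<Longrightarrow> ?L n \<subseteq> K"
    by metis
  define lift where "lift n a = (SOME q. q \<in> polys_over C \<and> coeffs_below (Suc n) q \<and> coeff q n = a \<and> poly q y \<in> J)"
    for n a
  have lift: "lift n a \<in> polys_over C \<and> coeffs_below (Suc n) (lift n a) \<and> coeff (lift n a) n = a \<and> poly (lift n a) y \<in> J"
    if "a \<in> G n" for n a
  proof -
    have "\<exists>q. q \<in> polys_over C \<and> coeffs_below (Suc n) q \<and> coeff q n = a \<and> poly q y \<in> J"
      using G(2)[of n] that unfolding top_coeffs_def by blast
    then show ?thesis unfolding lift_def by (rule someI_ex)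
  qed
  define H where "H = (\<Union>n\<le>N. (\<lambda>a. poly (lift n a) y) ` G n)"
  have "J \<subseteq> K" if K: "ideal_in ?D K" "H \<subseteq> K" for K
  proof -
    \<comment> \<open>Working with \<open>K \<inter> J\<close> yields a cancelling polynomial with
      value in both ideals: in \<open>K\<close> to conclude, and in \<open>J\<close> so that the
      difference remains within reach of the induction.\<close>
    have KJ: "ideal_in ?D (K \<inter> J)" using K(1) J unfolding ideal_in_def by blast
    have KL: "?L n \<subseteq> top_coeffs C y (K \<inter> J) n" if "n \<le> N" for n
    proof (rule G(3)[OF ideal_in_top_coeffs[OF C KJ]], rule subsetI)
      fix a assume a: "a \<in> G n"
      have "poly (lift n a) y \<in> K" using K(2) a that unfolding H_def by blast
      then show "a \<in> top_coeffs C y (K \<inter> J) n"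
        unfolding top_coeffs_def using lift[OF a] by (intro CollectI bexI[of _ "lift n a"]) simp_all
    qed
    have "poly p y \<in> K" if "p \<in> polys_over C" "coeffs_below n p" "poly p y \<in> J" for p n
      using that
    proof (induction n arbitrary: p)
      case 0
      then have "p = 0" by (simp add: coeffs_below_def poly_eqI)
      then show ?case using ideal_inD(2)[OF K(1)] by simp
    next
      case (Suc n)
      \<comment> \<open>Above \<open>N\<close> no new leading coefficients occur, so the coefficient
        is realised in degree \<open>n'\<close>, and that witness is shifted up by
        \<open>n - n'\<close>.\<close>
      define n' where "n' = min n N"
      have "coeff p n \<in> ?L n" unfolding top_coeffs_def using Suc.prems by blast
      then have "coeff p n \<in> ?L n'" using stable[of n] unfolding n'_def by (cases "n \<le> N") (auto simp: min_def)
      then have "coeff p n \<in> top_coeffs C y (K \<inter> J) n'" using KL[of n'] by (auto simp: n'_def)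
      from top_coeffs_shift[OF C KJ this, of "n - n'"] obtain q where q: "q \<in> polys_over C"
          "coeffs_below (Suc n) q" "coeff q n = coeff p n" "poly q y \<in> K" "poly q y \<in> J"
        by (auto simp: n'_def)
      have "- poly q y \<in> J"
        using ideal_inD(4)[OF J subring_set_uminus[OF subring_set_extend[OF C] subring_set_1[OF subring_set_extend[OF C]]] q(5)]
        by simp
      then have "poly (p - q) y \<in> J" using ideal_inD(3)[OF J Suc.prems(3)] by fastforce
      moreover have "coeffs_below n (p - q)"
        unfolding coeffs_below_def
      proof (intro allI impI)
        fix i assume "n \<le> i"
        then show "coeff (p - q) i = 0"
          using q(2,3) Suc.prems(2) by (cases "i = n") (simp_all add: coeffs_below_def)
      qed
      moreover have "p - q \<in> polys_over C"
        by (rule subring_set_diff[OF subring_set_polys_over[OF C] Suc.prems(1) q(1)])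
      ultimately have "poly (p - q) y \<in> K" using Suc.IH by blast
      then have "poly (p - q) y + poly q y \<in> K" using q(4) by (rule ideal_inD(3)[OF K(1)])
      then show ?case by simp
    qed
    then show ?thesis
      using ideal_inD(1)[OF J] coeffs_below_degree unfolding extend_def by blast
  qed
  moreover have "finite H" unfolding H_def using G(1) by simp
  moreover have "H \<subseteq> J" unfolding H_def using lift by auto
  ultimately show "\<exists>G. finite G \<and> G \<subseteq> J \<and> (\<forall>K. ideal_in ?D K \<longrightarrow> G \<subseteq> K \<longrightarrow> J \<subseteq> K)"
    by blast
qed

lemma poly_mem_subring_set:
  assumes "subring_set D" "C \<subseteq> D" "y \<in> D" "p \<in> polys_over C"
  shows "poly p y \<in> D"
  unfolding poly_altdef
  by (intro subring_set_sum[OF assms(1)] subring_set_mult[OF assms(1)] subring_set_power[OF assms(1)] assms(3))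
    (use assms(2,4) in \<open>auto simp: polys_over_def\<close>)

lemma mpoly_set_insert:
  "mpoly_set (insert w W) = extend (mpoly_set W) (mvar w :: ('v \<Rightarrow>\<^sub>0 nat) \<Rightarrow>\<^sub>0 'k::comm_ring_1)"
proof
  have "poly p (mvar w) \<in> mpoly_set (insert w W)" if "p \<in> polys_over (mpoly_set W)"
    for p :: "(('v \<Rightarrow>\<^sub>0 nat) \<Rightarrow>\<^sub>0 'k) poly"
    by (rule poly_mem_subring_set[OF subring_set_mpoly_set mpoly_set_mono mvar_mem_mpoly_set that]) auto
  then show "extend (mpoly_set W) (mvar w :: ('v \<Rightarrow>\<^sub>0 nat) \<Rightarrow>\<^sub>0 'k) \<subseteq> mpoly_set (insert w W)"
    unfolding extend_def by (rule image_subsetI)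
qed (rule mpoly_set_insert_subset)

lemma noetherian_set_mpoly_set:
  assumes "finite V"
  shows "noetherian_set (mpoly_set V :: (('v \<Rightarrow>\<^sub>0 nat) \<Rightarrow>\<^sub>0 'k::field) set)"
  using assms
proof (induction V rule: finite_induct)
  case empty
  let ?C = "mpoly_set {} :: (('v \<Rightarrow>\<^sub>0 nat) \<Rightarrow>\<^sub>0 'k) set"
  show ?case
    unfolding noetherian_set_def
  proof (intro allI impI)
    fix J assume J: "ideal_in ?C J"
    show "\<exists>G. finite G \<and> G \<subseteq> J \<and> (\<forall>K. ideal_in ?C K \<longrightarrow> G \<subseteq> K \<longrightarrow> J \<subseteq> K)"
    proof (cases "J \<subseteq> {0}")
      case True
      then show ?thesis using ideal_inD(2) by (intro exI[of _ "{}"]) auto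
    next
      case False
      then obtain x where x: "x \<in> J" "x \<noteq> 0" by blast
      define c where "c = Poly_Mapping.lookup x 0"
      have xc: "x = const c" unfolding c_def using ideal_inD(1)[OF J x(1)] by (rule mpoly_set_empty)
      then have "c \<noteq> 0" using x(2) by auto
      have "J \<subseteq> K" if K: "ideal_in ?C K" "x \<in> K" for K
      proof
        fix z assume "z \<in> J"
        define d where "d = Poly_Mapping.lookup z 0"
        have "z = const d" unfolding d_def using ideal_inD(1)[OF J \<open>z \<in> J\<close>] by (rule mpoly_set_empty)
        moreover have "const (d / c) * x \<in> K" by (rule ideal_inD(4)[OF K(1) const_mem_mpoly_set K(2)])
        ultimately show "z \<in> K" using \<open>c \<noteq> 0\<close> by (simp add: xc const_mult[symmetric])
      qed
      then show ?thesis using x(1) by (intro exI[of _ "{x}"]) simp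
    qed
  qed
next
  case (insert w W)
  show ?case unfolding mpoly_set_insert by (rule noetherian_set_extend[OF subring_set_mpoly_set insert.IH])
qed

subsection \<open>Quotient presentations\<close>

text \<open>Turns ideals of \<open>R\<close> into ideals of a type containing \<open>N\<close>, with no carrier to keep track of.\<close>

locale quotient_presentation =
  fixes R :: "('b, 'm) ring_scheme" (structure) and \<phi> :: "'a::comm_ring_1 \<Rightarrow> 'b" and N :: "'a set"
  assumes cring_R: "cring R"
    and carrier_eq: "carrier R = range \<phi>"
    and phi_add: "\<phi> (p + q) = \<phi> p \<oplus> \<phi> q"
    and phi_mult: "\<phi> (p * q) = \<phi> p \<otimes> \<phi> q"
    and phi_0: "\<phi> 0 = \<zero>" and phi_1: "\<phi> 1 = \<one>"
    and phi_eq: "\<phi> p = \<phi> q \<longleftrightarrow> p - q \<in> N"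
begin

sublocale cring R by (rule cring_R)

lemma phi_closed: "\<phi> p \<in> carrier R"
  by (simp add: carrier_eq)

lemma phi_uminus: "\<phi> (- p) = \<ominus> \<phi> p"
proof -
  have "\<phi> (- p) \<oplus> \<phi> p = \<zero>" unfolding phi_add[symmetric] by (simp add: phi_0)
  then show ?thesis using minus_equality phi_closed by metis
qed

lemma subspace_vimage:
  assumes "ideal J R"
  shows "rmod.subspace (\<phi> -` J)" "N \<subseteq> \<phi> -` J" "J = \<phi> ` (\<phi> -` J)"
proof -
  interpret J: ideal J R by (rule assms)
  show "rmod.subspace (\<phi> -` J)"
  proof (rule rmod.subspaceI)
    show "0 \<in> \<phi> -` J" using J.zero_closed by (simp add: phi_0)
    show "x + y \<in> \<phi> -` J" if "x \<in> \<phi> -` J" "y \<in> \<phi> -` J" for x y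
      using that J.a_closed by (simp add: phi_add)
    show "c * x \<in> \<phi> -` J" if "x \<in> \<phi> -` J" for c x
      using that J.I_l_closed[of "\<phi> x" "\<phi> c"] phi_closed by (simp add: phi_mult)
  qed
  show "N \<subseteq> \<phi> -` J"
  proof
    fix p assume "p \<in> N"
    then have "\<phi> p = \<phi> 0" by (simp add: phi_eq)
    then show "p \<in> \<phi> -` J" using J.zero_closed by (simp add: phi_0)
  qed
  show "J = \<phi> ` (\<phi> -` J)" using J.a_subset by (auto simp: carrier_eq)
qed

lemma ideal_image:
  assumes K: "rmod.subspace K"
  shows "ideal (\<phi> ` K) R"
proof (rule idealI)
  show "ring R" by (rule ring_axioms)
  show "subgroup (\<phi> ` K) (add_monoid R)"
  proof (rule group.subgroupI)
    show "Group.group (add_monoid R)" by (rule a_group)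
    show "\<phi> ` K \<subseteq> carrier (add_monoid R)" using phi_closed by auto
    show "\<phi> ` K \<noteq> {}" using rmod.subspace_0[OF K] by blast
    fix a assume "a \<in> \<phi> ` K"
    then obtain x where x: "x \<in> K" "a = \<phi> x" by blast
    show "inv\<^bsub>add_monoid R\<^esub> a \<in> \<phi> ` K"
      unfolding a_inv_def[symmetric] x(2) phi_uminus[symmetric] using rmod.subspace_neg[OF K x(1)] by blast
    fix b assume "b \<in> \<phi> ` K"
    then obtain y where y: "y \<in> K" "b = \<phi> y" by blast
    have "\<phi> (x + y) \<in> \<phi> ` K" using rmod.subspace_add[OF K x(1) y(1)] by blast
    then show "a \<otimes>\<^bsub>add_monoid R\<^esub> b \<in> \<phi> ` K" by (simp add: x(2) y(2) phi_add)
  qed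
  fix a x assume "a \<in> \<phi> ` K" "x \<in> carrier R"
  then obtain p q where pq: "p \<in> K" "a = \<phi> p" "x = \<phi> q" by (auto simp: carrier_eq)
  have "\<phi> (q * p) \<in> \<phi> ` K" using rmod.subspace_scale[OF K pq(1)] by blast
  then show "x \<otimes> a \<in> \<phi> ` K" "a \<otimes> x \<in> \<phi> ` K"
    using m_comm[OF phi_closed phi_closed] by (simp_all add: pq(2,3) phi_mult)
qed

lemma vimage_image:
  assumes "rmod.subspace K" "N \<subseteq> K"
  shows "\<phi> -` (\<phi> ` K) = K"
proof -
  have "p \<in> K" if "q \<in> K" "\<phi> p = \<phi> q" for p q
    using rmod.subspace_add[OF assms(1) _ that(1), of "p - q"] that(2) assms(2) by (auto simp: phi_eq)
  then show ?thesis by blast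
qed

lemma genideal_image:
  assumes "rmod.subspace N"
  shows "genideal R (\<phi> ` G) = \<phi> ` rmod.span (N \<union> G)"
proof
  show "genideal R (\<phi> ` G) \<subseteq> \<phi> ` rmod.span (N \<union> G)"
  proof (rule genideal_minimal[OF ideal_image[OF rmod.subspace_span]])
    show "\<phi> ` G \<subseteq> \<phi> ` rmod.span (N \<union> G)" using rmod.span_superset[of "N \<union> G"] by blast
  qed
  have id: "ideal (genideal R (\<phi> ` G)) R" by (rule genideal_ideal) (use phi_closed in blast)
  have "G \<subseteq> \<phi> -` genideal R (\<phi> ` G)"
    using genideal_self[of "\<phi> ` G"] phi_closed by blast
  then have "rmod.span (N \<union> G) \<subseteq> \<phi> -` genideal R (\<phi> ` G)"
    using subspace_vimage(1,2)[OF id] by (intro rmod.span_minimal) simp_all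
  then show "\<phi> ` rmod.span (N \<union> G) \<subseteq> genideal R (\<phi> ` G)" by blast
qed

lemma phi_mem_genideal:
  assumes "rmod.subspace N"
  shows "\<phi> p \<in> genideal R (\<phi> ` G) \<longleftrightarrow> p \<in> rmod.span (N \<union> G)"
proof -
  have "\<phi> p \<in> genideal R (\<phi> ` G) \<longleftrightarrow> p \<in> \<phi> -` (\<phi> ` rmod.span (N \<union> G))"
    unfolding genideal_image[OF assms] by blast
  also have "\<phi> -` (\<phi> ` rmod.span (N \<union> G)) = rmod.span (N \<union> G)"
    using rmod.span_superset[of "N \<union> G"] by (intro vimage_image rmod.subspace_span) blast
  finally show ?thesis .
qed

lemma regular_sequence_map_iff:
  assumes N: "rmod.subspace N"
  shows "regular_sequence R (map \<phi> ps) \<longleftrightarrow> weakly_regular N ps \<and> rmod.span (N \<union> set ps) \<noteq> UNIV"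
proof -
  have "(\<forall>y\<in>carrier R. map \<phi> ps ! i \<otimes> y \<in> genideal R (set (take i (map \<phi> ps))) \<longrightarrow>
        y \<in> genideal R (set (take i (map \<phi> ps)))) \<longleftrightarrow>
      nonzerodivisor_mod (foldl adjoin N (take i ps)) (ps ! i)" if "i < length ps" for i
    using that unfolding nonzerodivisor_mod_def foldl_adjoin_eq_span[OF N]
    by (simp add: carrier_eq take_map phi_mult[symmetric] phi_mem_genideal[OF N])
  moreover have "genideal R (set (map \<phi> ps)) \<noteq> carrier R \<longleftrightarrow> rmod.span (N \<union> set ps) \<noteq> UNIV"
  proof -
    have "genideal R (set (map \<phi> ps)) = carrier R \<longleftrightarrow> (\<forall>p. p \<in> rmod.span (N \<union> set ps))"
      unfolding phi_mem_genideal[OF N, symmetric] set_map carrier_eq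
      using genideal_minimal[OF oneideal, of "\<phi> ` set ps"] phi_closed carrier_eq by blast
    then show ?thesis by blast
  qed
  moreover have "set (map \<phi> ps) \<subseteq> carrier R" using phi_closed by auto
  ultimately show ?thesis unfolding regular_sequence_def weakly_regular_iff_nth by simp
qed

lemma prime_set_vimage:
  assumes "primeideal J R"
  shows "prime_set (\<phi> -` J)" "N \<subseteq> \<phi> -` J" "J = \<phi> ` (\<phi> -` J)"
proof -
  interpret J: primeideal J R by (rule assms)
  show "N \<subseteq> \<phi> -` J" "J = \<phi> ` (\<phi> -` J)" using subspace_vimage[OF J.is_ideal] by blast+
  have "\<one> \<notin> J" using J.I_notcarr J.one_imp_carrier by blast
  then show "prime_set (\<phi> -` J)"
    unfolding prime_set_def
    using subspace_vimage(1)[OF J.is_ideal] J.I_prime[OF phi_closed phi_closed]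
    by (simp add: phi_1 phi_mult)
qed

lemma primeideal_image:
  assumes "prime_set K" "N \<subseteq> K"
  shows "primeideal (\<phi> ` K) R"
proof (rule primeidealI[OF ideal_image[OF prime_setD(1)[OF assms(1)]] cring_R])
  have mem: "\<phi> p \<in> \<phi> ` K \<longleftrightarrow> p \<in> K" for p
    using vimage_image[OF prime_setD(1)[OF assms(1)] assms(2)] by blast
  show "carrier R \<noteq> \<phi> ` K"
    using mem[of 1] prime_setD(2)[OF assms(1)] carrier_eq by blast
  fix a b assume "a \<in> carrier R" "b \<in> carrier R" "a \<otimes> b \<in> \<phi> ` K"
  then obtain p q where "a = \<phi> p" "b = \<phi> q" "p * q \<in> K"
    unfolding carrier_eq using mem phi_mult by (metis rangeE)
  then show "a \<in> \<phi> ` K \<or> b \<in> \<phi> ` K" using prime_setD(3)[OF assms(1)] by blast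
qed

lemma maximalideal_vimage:
  assumes "maximalideal P R" "z \<notin> \<phi> -` P"
  shows "\<exists>e. 1 - z * e \<in> \<phi> -` P"
proof -
  interpret P: maximalideal P R by (rule assms(1))
  note vim = subspace_vimage[OF P.is_ideal]
  let ?K = "adjoin (\<phi> -` P) z"
  have sub: "\<phi> -` P \<subseteq> ?K" by (rule subset_adjoin)
  have "z \<in> ?K" using rmod.subspace_0[OF vim(1)] by (intro adjoinI[of _ _ 1]) simp
  then have "\<phi> ` ?K \<noteq> P" using assms(2) by blast
  moreover have "P \<subseteq> \<phi> ` ?K" using vim(3) sub by blast
  ultimately have "\<phi> ` ?K = carrier R"
    using P.I_maximal[OF ideal_image[OF subspace_adjoin[OF vim(1)]]] phi_closed by blast
  then have "1 \<in> \<phi> -` (\<phi> ` ?K)" using phi_closed by blast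
  then have "1 \<in> ?K"
    using vimage_image[OF subspace_adjoin[OF vim(1)]] vim(2) sub by blast
  then show ?thesis by (rule adjoinE) blast
qed

lemma depth_le_codimension:
  assumes N: "rmod.subspace N" and P: "primeideal P R"
  shows "ideal_depth R P \<le> codimension R P"
  unfolding ideal_depth_def
proof (rule Sup_least)
  fix l assume "l \<in> {enat (length xs) | xs. regular_sequence R xs \<and> set xs \<subseteq> P}"
  then obtain xs where l: "l = enat (length xs)" and xs: "regular_sequence R xs" "set xs \<subseteq> P" by blast
  have "set xs \<subseteq> range \<phi>" using xs(1) by (simp add: regular_sequence_def carrier_eq)
  then have "\<exists>ps. xs = map \<phi> ps" unfolding ex_map_conv by blast
  then obtain ps where ps: "xs = map \<phi> ps" by (rule exE)
  have reg: "weakly_regular N ps" using xs(1) unfolding ps regular_sequence_map_iff[OF N] by blast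
  note vim = prime_set_vimage[OF P]
  have "N \<union> set ps \<subseteq> \<phi> -` P" using vim(2) xs(2) ps by auto
  from prime_chain_weakly_regular[OF N reg vim(1) this] obtain Q where
    Q: "\<forall>i\<le>length ps. prime_set (Q i) \<and> N \<subseteq> Q i" "\<forall>i<length ps. Q i \<subset> Q (Suc i)" "Q (length ps) = \<phi> -` P"
    by blast
  have "\<phi> ` Q i \<subset> \<phi> ` Q (Suc i)" if "i < length ps" for i
  proof -
    \<comment> \<open>Strict inclusions stay strict under \<open>\<phi>\<close> because these primes
      contain \<open>N\<close> and are therefore recovered from their images.\<close>
    have v: "\<phi> -` (\<phi> ` Q j) = Q j" if "j \<le> length ps" for j
      using Q(1) that by (intro vimage_image) (auto dest: prime_setD(1))
    have "Q i \<subset> Q (Suc i)" using Q(2) that by blast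
    then show ?thesis using v[of i] v[of "Suc i"] that by (metis Suc_leI image_mono less_imp_le psubset_eq)
  qed
  then have "enat (length ps) \<in> {enat l | l. \<exists>Q. (\<forall>i\<le>l. primeideal (Q i) R) \<and> (\<forall>i<l. Q i \<subset> Q (Suc i)) \<and> Q l = P}"
    using Q(1,3) vim(3) primeideal_image by (intro CollectI exI[of _ "length ps"] conjI exI[of _ "\<lambda>i. \<phi> ` Q i"]) auto
  then show "l \<le> codimension R P"
    unfolding codimension_def l ps length_map by (rule Sup_upper)
qed

lemma codimension_le:
  assumes "\<And>l Q. (\<And>i. i \<le> l \<Longrightarrow> prime_set (Q i)) \<Longrightarrow> (\<And>i. i < l \<Longrightarrow> Q i \<subset> Q (Suc i)) \<Longrightarrow> N \<subseteq> Q 0 \<Longrightarrow> l \<le> d"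
  shows "codimension R P \<le> enat d"
  unfolding codimension_def
proof (rule Sup_least)
  fix k assume "k \<in> {enat l | l. \<exists>Q. (\<forall>i\<le>l. primeideal (Q i) R) \<and> (\<forall>i<l. Q i \<subset> Q (Suc i)) \<and> Q l = P}"
  then obtain l Q where k: "k = enat l" and Q: "\<forall>i\<le>l. primeideal (Q i) R" "\<forall>i<l. Q i \<subset> Q (Suc i)" by blast
  have "l \<le> d"
  proof (rule assms[of l "\<lambda>i. \<phi> -` Q i"])
    show "prime_set (\<phi> -` Q i)" if "i \<le> l" for i using Q(1) that prime_set_vimage(1) by blast
    show "N \<subseteq> \<phi> -` Q 0" using Q(1) prime_set_vimage(2) by blast
    show "\<phi> -` Q i \<subset> \<phi> -` Q (Suc i)" if "i < l" for i
    proof -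
      have "Q i = \<phi> ` (\<phi> -` Q i)" "Q (Suc i) = \<phi> ` (\<phi> -` Q (Suc i))"
        using Q(1) that prime_set_vimage(3)[of "Q i"] prime_set_vimage(3)[of "Q (Suc i)"] by simp_all
      moreover have "Q i \<subset> Q (Suc i)" using Q(2) that by blast
      ultimately show ?thesis by (metis psubset_eq vimage_mono)
    qed
  qed
  then show "k \<le> enat d" by (simp add: k)
qed

end

subsection \<open>Face rings\<close>

lemma carrier_mpoly_ring: "carrier (mpoly_ring V) = mpoly_set V"
  by (simp add: mpoly_ring_def mpoly_set_def)

lemma cring_mpoly_ring: "cring (mpoly_ring V :: (('v \<Rightarrow>\<^sub>0 nat) \<Rightarrow>\<^sub>0 'k::comm_ring_1) ring)"
proof (rule cringI)
  let ?S = "mpoly_set V :: (('v \<Rightarrow>\<^sub>0 nat) \<Rightarrow>\<^sub>0 'k) set"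
  note S = subring_set_mpoly_set[of V, where 'b = 'k]
  show "abelian_group (mpoly_ring V :: (('v \<Rightarrow>\<^sub>0 nat) \<Rightarrow>\<^sub>0 'k) ring)"
  proof (rule abelian_groupI)
    show "\<exists>y\<in>carrier (mpoly_ring V). y \<oplus>\<^bsub>mpoly_ring V\<^esub> x = \<zero>\<^bsub>mpoly_ring V\<^esub>"
      if "x \<in> carrier (mpoly_ring V)" for x :: "('v \<Rightarrow>\<^sub>0 nat) \<Rightarrow>\<^sub>0 'k"
      using that subring_set_uminus[OF S] unfolding carrier_mpoly_ring by (intro bexI[of _ "- x"]) (simp_all add: mpoly_ring_def)
  qed (use subring_set_add[OF S] subring_set_0[OF S] in \<open>simp_all add: carrier_mpoly_ring, simp_all add: mpoly_ring_def add_ac\<close>)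
  show "comm_monoid (mpoly_ring V :: (('v \<Rightarrow>\<^sub>0 nat) \<Rightarrow>\<^sub>0 'k) ring)"
    by (rule comm_monoidI)
      (use subring_set_mult[OF S] subring_set_1[OF S] in \<open>simp_all add: carrier_mpoly_ring, simp_all add: mpoly_ring_def mult_ac\<close>)
qed (simp add: mpoly_ring_def distrib_right)

lemma ideal_mpoly_ring_iff:
  fixes J :: "(('v \<Rightarrow>\<^sub>0 nat) \<Rightarrow>\<^sub>0 'k::comm_ring_1) set"
  shows "ideal J (mpoly_ring V) \<longleftrightarrow> ideal_in (mpoly_set V) J"
proof
  let ?R = "mpoly_ring V :: (('v \<Rightarrow>\<^sub>0 nat) \<Rightarrow>\<^sub>0 'k) ring"
  interpret R: cring ?R by (rule cring_mpoly_ring)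
  note S = subring_set_mpoly_set[of V, where 'b = 'k]
  {
    assume "ideal J ?R"
    then interpret J: ideal J ?R .
    show "ideal_in (mpoly_set V) J"
      unfolding ideal_in_def
    proof (intro conjI ballI)
      show "J \<subseteq> mpoly_set V" using J.a_subset unfolding carrier_mpoly_ring .
      show "0 \<in> J" using J.zero_closed unfolding mpoly_ring_def by simp
      show "x + y \<in> J" if "x \<in> J" "y \<in> J" for x y
        using J.a_closed[OF that] unfolding mpoly_ring_def by simp
      show "c * x \<in> J" if "c \<in> mpoly_set V" "x \<in> J" for c x
        using J.I_l_closed[of x c] that unfolding carrier_mpoly_ring unfolding mpoly_ring_def by simp
    qed
  next
    assume J: "ideal_in (mpoly_set V) J"
    show "ideal J ?R"
    proof (rule idealI)
      show "ring ?R" by (rule R.ring_axioms)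
      show "subgroup J (add_monoid ?R)"
      proof (rule group.subgroupI)
        show "Group.group (add_monoid ?R)" by (rule R.a_group)
        show "J \<subseteq> carrier (add_monoid ?R)" using ideal_inD(1)[OF J] by (auto simp: carrier_mpoly_ring)
        show "J \<noteq> {}" using ideal_inD(2)[OF J] by blast
        fix a assume a: "a \<in> J"
        have aS: "a \<in> mpoly_set V" using ideal_inD(1)[OF J a] .
        have "- a \<in> J"
          using ideal_inD(4)[OF J subring_set_uminus[OF S subring_set_1[OF S]] a] by simp
        moreover have "\<ominus>\<^bsub>?R\<^esub> a = - a"
        proof (rule R.minus_equality)
          show "- a \<oplus>\<^bsub>?R\<^esub> a = \<zero>\<^bsub>?R\<^esub>" by (simp add: mpoly_ring_def)
        qed (use aS subring_set_uminus[OF S aS] in \<open>simp_all add: carrier_mpoly_ring\<close>)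
        ultimately show "inv\<^bsub>add_monoid ?R\<^esub> a \<in> J" by (simp add: a_inv_def)
        fix b assume "b \<in> J"
        then show "a \<otimes>\<^bsub>add_monoid ?R\<^esub> b \<in> J" using ideal_inD(3)[OF J a] by (simp add: mpoly_ring_def)
      qed
      fix a x assume "a \<in> J" "x \<in> carrier ?R"
      then have "x * a \<in> J" using ideal_inD(4)[OF J] by (simp add: carrier_mpoly_ring)
      then show "x \<otimes>\<^bsub>?R\<^esub> a \<in> J" "a \<otimes>\<^bsub>?R\<^esub> x \<in> J" by (simp_all add: mpoly_ring_def mult.commute)
    qed
  }
qed

lemma prod_mvar:
  "finite W \<Longrightarrow> (\<Prod>v\<in>W. mvar v :: ('v \<Rightarrow>\<^sub>0 nat) \<Rightarrow>\<^sub>0 'k::comm_ring_1) = Poly_Mapping.single (squarefree_monomial W) 1"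
  by (induction W rule: finite_induct) (simp_all add: squarefree_monomial_def mvar_def mult_single)

text \<open>A monomial with nonface support is a multiple of the squarefree monomial of that
  support; conversely, enlarging the support of a nonface never produces a face, as the complex is
  closed under subsets. So the generated ideal consists of all combinations of such
  monomials.\<close>

lemma nonface_ideal_eq:
  fixes \<Delta> :: "'v set set"
  assumes "finite V" "down_closed \<Delta>"
  shows "nonface_ideal V \<Delta> = (nonface_set \<Delta> \<inter> mpoly_set V :: (('v \<Rightarrow>\<^sub>0 nat) \<Rightarrow>\<^sub>0 'k::comm_ring_1) set)"
proof
  let ?N = "nonface_set \<Delta> :: (('v \<Rightarrow>\<^sub>0 nat) \<Rightarrow>\<^sub>0 'k) set" and ?S = "mpoly_set V :: (('v \<Rightarrow>\<^sub>0 nat) \<Rightarrow>\<^sub>0 'k) set"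
  let ?R = "mpoly_ring V :: (('v \<Rightarrow>\<^sub>0 nat) \<Rightarrow>\<^sub>0 'k) ring"
  let ?G = "{\<Prod>v\<in>W. mvar v | W. W \<subseteq> V \<and> W \<notin> \<Delta>} :: (('v \<Rightarrow>\<^sub>0 nat) \<Rightarrow>\<^sub>0 'k) set"
  interpret R: cring ?R by (rule cring_mpoly_ring)
  note S = subring_set_mpoly_set[of V, where 'b = 'k]
  have subN: "rmod.subspace ?N" by (rule subspace_nonface_set[OF assms(2)])
  have G: "?G \<subseteq> ?N \<inter> ?S"
  proof
    fix p assume "p \<in> ?G"
    then obtain W where W: "p = (\<Prod>v\<in>W. mvar v)" "W \<subseteq> V" "W \<notin> \<Delta>" by blast
    have fin: "finite W" using W(2) assms(1) finite_subset by blast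
    show "p \<in> ?N \<inter> ?S"
      unfolding W(1) prod_mvar[OF fin] using W(2,3)
      by (simp add: nonface_set_def mpoly_set_def keys_squarefree_monomial[OF fin])
  qed
  have "ideal (?N \<inter> ?S) ?R"
    unfolding ideal_mpoly_ring_iff by (rule ideal_in_subspace_Int[OF S subN])
  then show "nonface_ideal V \<Delta> \<subseteq> ?N \<inter> ?S"
    unfolding nonface_ideal_def using G by (rule R.genideal_minimal)
  have "ideal (nonface_ideal V \<Delta>) ?R"
    unfolding nonface_ideal_def by (rule R.genideal_ideal) (use G in \<open>auto simp: carrier_mpoly_ring\<close>)
  then have J: "ideal_in ?S (nonface_ideal V \<Delta>)" by (simp only: ideal_mpoly_ring_iff)
  have GJ: "?G \<subseteq> nonface_ideal V \<Delta>"
    unfolding nonface_ideal_def by (rule R.genideal_self) (use G in \<open>auto simp: carrier_mpoly_ring\<close>)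
  show "?N \<inter> ?S \<subseteq> nonface_ideal V \<Delta>"
  proof
    fix p assume p: "p \<in> ?N \<inter> ?S"
    show "p \<in> nonface_ideal V \<Delta>"
    proof (induction p rule: poly_mapping_additive_induct)
      case zero
      show ?case using ideal_inD(2)[OF J] .
    next
      case (add p q)
      then show ?case by (rule ideal_inD(3)[OF J])
    next
      case (single m c)
      let ?W = "Poly_Mapping.keys m"
      have W: "?W \<subseteq> V" "?W \<notin> \<Delta>" using p single by (auto simp: nonface_set_def mpoly_set_def)
      have "m = (m - squarefree_monomial ?W) + squarefree_monomial ?W"
        by (subst add.commute) (rule squarefree_monomial_divides; simp)
      then have "Poly_Mapping.single m c =
          Poly_Mapping.single ((m - squarefree_monomial ?W) + squarefree_monomial ?W) (c * 1)"
        by (rule arg_cong2[of _ _ _ _ Poly_Mapping.single]) simp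
      then have eq: "Poly_Mapping.single m c = Poly_Mapping.single (m - squarefree_monomial ?W) c * (\<Prod>v\<in>?W. mvar v)"
        unfolding mult_single[symmetric] prod_mvar[OF finite_keys] .
      have "Poly_Mapping.keys (m - squarefree_monomial ?W) \<subseteq> V"
        using W(1) by (auto simp: in_keys_iff lookup_minus)
      then have "Poly_Mapping.single (m - squarefree_monomial ?W) c \<in> ?S" by (rule mem_mpoly_set_single)
      moreover have "(\<Prod>v\<in>?W. mvar v) \<in> (nonface_ideal V \<Delta> :: (('v \<Rightarrow>\<^sub>0 nat) \<Rightarrow>\<^sub>0 'k) set)"
        by (rule subsetD[OF GJ], intro CollectI exI[of _ ?W] conjI refl W)
      ultimately show ?case unfolding eq by (rule ideal_inD(4)[OF J])
    qed
  qed
qed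

lemma mpoly_set_representative:
  fixes p :: "('v \<Rightarrow>\<^sub>0 nat) \<Rightarrow>\<^sub>0 'k::comm_ring_1"
  assumes "down_closed \<Delta>" "\<Delta> \<subseteq> Pow V"
  shows "\<exists>s\<in>mpoly_set V. p - s \<in> nonface_set \<Delta>"
proof (induction p rule: poly_mapping_additive_induct)
  case zero
  show ?case
    using subring_set_0[OF subring_set_mpoly_set] rmod.subspace_0[OF subspace_nonface_set[OF assms(1)]]
    by (intro bexI[of _ 0]) simp_all
next
  case (single m c)
  show ?case
  proof (cases "Poly_Mapping.keys m \<subseteq> V")
    case True
    then show ?thesis
      using mem_mpoly_set_single[OF True] rmod.subspace_0[OF subspace_nonface_set[OF assms(1)]]
      by (intro bexI[of _ "Poly_Mapping.single m c"]) simp_all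
  next
    case False
    then have "Poly_Mapping.single m c \<in> nonface_set \<Delta>" using assms(2) by (auto simp: nonface_set_def)
    then show ?thesis using subring_set_0[OF subring_set_mpoly_set] by (intro bexI[of _ 0]) simp_all
  qed
next
  case (add p q)
  then obtain s t where st: "s \<in> mpoly_set V" "p - s \<in> nonface_set \<Delta>" "t \<in> mpoly_set V" "q - t \<in> nonface_set \<Delta>"
    by blast
  have "(p - s) + (q - t) \<in> nonface_set \<Delta>"
    by (rule rmod.subspace_add[OF subspace_nonface_set[OF assms(1)] st(2,4)])
  then show ?case
    using subring_set_add[OF subring_set_mpoly_set st(1,3)] by (intro bexI[of _ "s + t"]) (simp_all add: algebra_simps)
qed

text \<open>For \<open>p\<close> in the polynomial ring over \<open>V\<close> this is the usual coset; other \<open>p\<close> are first reduced to it.\<close>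

definition face_class :: "'v set \<Rightarrow> 'v set set \<Rightarrow> (('v \<Rightarrow>\<^sub>0 nat) \<Rightarrow>\<^sub>0 'k::comm_ring_1) \<Rightarrow> (('v \<Rightarrow>\<^sub>0 nat) \<Rightarrow>\<^sub>0 'k) set" where
  "face_class V \<Delta> p = {s \<in> mpoly_set V. s - p \<in> nonface_set \<Delta>}"

text \<open>On polynomials over \<open>V\<close> the map \<open>face_class\<close> is the coset map,
  which is a ring homomorphism; for other arguments each law is reduced to this case through
  representatives.\<close>

lemma quotient_presentation_face_ring:
  assumes V: "finite V" and \<Delta>: "down_closed \<Delta>" "\<Delta> \<subseteq> Pow V"
  shows "quotient_presentation (face_ring V \<Delta> :: (('v \<Rightarrow>\<^sub>0 nat) \<Rightarrow>\<^sub>0 'k::comm_ring_1) set ring)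
    (face_class V \<Delta>) (nonface_set \<Delta>)"
proof -
  let ?N = "nonface_set \<Delta> :: (('v \<Rightarrow>\<^sub>0 nat) \<Rightarrow>\<^sub>0 'k) set" and ?S = "mpoly_set V :: (('v \<Rightarrow>\<^sub>0 nat) \<Rightarrow>\<^sub>0 'k) set"
  let ?A = "mpoly_ring V :: (('v \<Rightarrow>\<^sub>0 nat) \<Rightarrow>\<^sub>0 'k) ring"
  let ?R = "face_ring V \<Delta> :: (('v \<Rightarrow>\<^sub>0 nat) \<Rightarrow>\<^sub>0 'k) set ring"
  let ?\<phi> = "face_class V \<Delta> :: (('v \<Rightarrow>\<^sub>0 nat) \<Rightarrow>\<^sub>0 'k) \<Rightarrow> _"
  define I where "I = (nonface_ideal V \<Delta> :: (('v \<Rightarrow>\<^sub>0 nat) \<Rightarrow>\<^sub>0 'k) set)"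
  have I: "I = ?N \<inter> ?S" unfolding I_def by (rule nonface_ideal_eq[OF V \<Delta>(1)])
  interpret A: cring ?A by (rule cring_mpoly_ring)
  note S = subring_set_mpoly_set[of V, where 'b = 'k]
  have subN: "rmod.subspace ?N" by (rule subspace_nonface_set[OF \<Delta>(1)])
  have "ideal I ?A"
    unfolding I_def nonface_ideal_def
  proof (rule A.genideal_ideal)
    show "{\<Prod>v\<in>W. mvar v | W. W \<subseteq> V \<and> W \<notin> \<Delta>} \<subseteq> carrier ?A"
    proof
      fix p :: "('v \<Rightarrow>\<^sub>0 nat) \<Rightarrow>\<^sub>0 'k" assume "p \<in> {\<Prod>v\<in>W. mvar v | W. W \<subseteq> V \<and> W \<notin> \<Delta>}"
      then obtain W where W: "p = (\<Prod>v\<in>W. mvar v)" "W \<subseteq> V" by blast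
      have fin: "finite W" using W(2) V finite_subset by blast
      show "p \<in> carrier ?A"
        unfolding W(1) prod_mvar[OF fin] carrier_mpoly_ring using W(2)
        by (intro mem_mpoly_set_single) (simp add: keys_squarefree_monomial[OF fin])
    qed
  qed
  then interpret I: ideal I ?A .
  have R: "?R = ?A Quot I" by (simp add: face_ring_def I_def)
  let ?h = "\<lambda>s. I +>\<^bsub>?A\<^esub> s"
  have hom: "?h \<in> ring_hom ?A ?R" unfolding R by (rule I.rcos_ring_hom)
  have h: "?\<phi> s = ?h s" if "s \<in> ?S" for s
  proof -
    have "t \<in> ?S \<and> t - s \<in> ?N \<longleftrightarrow> (\<exists>i\<in>I. t = i + s)" for t
    proof
      assume t: "t \<in> ?S \<and> t - s \<in> ?N"
      then have "t - s \<in> I" using subring_set_diff[OF S _ that] by (simp add: I)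
      then show "\<exists>i\<in>I. t = i + s" by (intro bexI[of _ "t - s"]) simp_all
    next
      assume "\<exists>i\<in>I. t = i + s"
      then show "t \<in> ?S \<and> t - s \<in> ?N" using subring_set_add[OF S _ that] by (auto simp: I)
    qed
    then show ?thesis
      unfolding face_class_def a_r_coset_def' by (auto simp: mpoly_ring_def)
  qed
  have phi_eq: "?\<phi> p = ?\<phi> q \<longleftrightarrow> p - q \<in> ?N" for p q
  proof
    assume "?\<phi> p = ?\<phi> q"
    moreover obtain s where s: "s \<in> ?S" "p - s \<in> ?N" using mpoly_set_representative[OF \<Delta>, of p] by blast
    moreover have "s \<in> ?\<phi> p" using s rmod.subspace_neg[OF subN s(2)] by (simp add: face_class_def)
    ultimately have "s - q \<in> ?N" by (simp add: face_class_def)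
    then have "(p - s) + (s - q) \<in> ?N" by (rule rmod.subspace_add[OF subN s(2)])
    then show "p - q \<in> ?N" by simp
  next
    assume pq: "p - q \<in> ?N"
    have "s - p \<in> ?N \<longleftrightarrow> s - q \<in> ?N" for s
      using subspace_add_right_iff[OF subN pq, of "s - p"] by simp
    then show "?\<phi> p = ?\<phi> q" by (simp add: face_class_def)
  qed
  have rep: "\<exists>s\<in>?S. p - s \<in> ?N \<and> ?\<phi> p = ?h s" for p
  proof -
    obtain s where s: "s \<in> ?S" "p - s \<in> ?N" using mpoly_set_representative[OF \<Delta>, of p] by blast
    have "?\<phi> p = ?\<phi> s" unfolding phi_eq by (rule s(2))
    also have "\<dots> = ?h s" by (rule h[OF s(1)])
    finally show ?thesis using s by blast
  qed
  show ?thesis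
  proof (rule quotient_presentation.intro)
    show "cring ?R" unfolding R by (rule I.quotient_is_cring[OF A.cring_axioms])
    show "carrier ?R = range ?\<phi>"
    proof -
      have "carrier ?R = ?h ` ?S"
        unfolding R FactRing_def A_RCOSETS_def' by (auto simp: carrier_mpoly_ring)
      also have "\<dots> = range ?\<phi>"
      proof
        show "?h ` ?S \<subseteq> range ?\<phi>" using h by (metis image_subsetI rangeI)
        show "range ?\<phi> \<subseteq> ?h ` ?S" using rep by (metis image_subsetI imageI)
      qed
      finally show ?thesis .
    qed
    show "?\<phi> 0 = \<zero>\<^bsub>?R\<^esub>"
      unfolding R by (auto simp: FactRing_def face_class_def I)
    show "?\<phi> 1 = \<one>\<^bsub>?R\<^esub>"
      using h[OF subring_set_1[OF S]] ring_hom_one[OF hom] by (simp add: mpoly_ring_def)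
    fix p q
    obtain s where s: "s \<in> ?S" "p - s \<in> ?N" "?\<phi> p = ?h s" using rep[of p] by (elim bexE conjE)
    obtain t where t: "t \<in> ?S" "q - t \<in> ?N" "?\<phi> q = ?h t" using rep[of q] by (elim bexE conjE)
    have "p * (q - t) + t * (p - s) \<in> ?N"
      by (intro rmod.subspace_add[OF subN] rmod.subspace_scale[OF subN] s(2) t(2))
    then have "?\<phi> (p * q) = ?\<phi> (s * t)" unfolding phi_eq by (simp add: algebra_simps)
    also have "\<dots> = ?h (s \<otimes>\<^bsub>?A\<^esub> t)" using h[OF subring_set_mult[OF S s(1) t(1)]] by (simp add: mpoly_ring_def)
    also have "\<dots> = ?\<phi> p \<otimes>\<^bsub>?R\<^esub> ?\<phi> q"
      unfolding s(3) t(3) by (rule ring_hom_mult[OF hom]) (use s(1) t(1) in \<open>simp_all add: carrier_mpoly_ring\<close>)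
    finally show "?\<phi> (p * q) = ?\<phi> p \<otimes>\<^bsub>?R\<^esub> ?\<phi> q" .
    have "(p - s) + (q - t) \<in> ?N" by (rule rmod.subspace_add[OF subN s(2) t(2)])
    then have "?\<phi> (p + q) = ?\<phi> (s + t)" unfolding phi_eq by (simp add: algebra_simps)
    also have "\<dots> = ?h (s \<oplus>\<^bsub>?A\<^esub> t)" using h[OF subring_set_add[OF S s(1) t(1)]] by (simp add: mpoly_ring_def)
    also have "\<dots> = ?\<phi> p \<oplus>\<^bsub>?R\<^esub> ?\<phi> q"
      unfolding s(3) t(3) by (rule ring_hom_add[OF hom]) (use s(1) t(1) in \<open>simp_all add: carrier_mpoly_ring\<close>)
    finally show "?\<phi> (p + q) = ?\<phi> p \<oplus>\<^bsub>?R\<^esub> ?\<phi> q" .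
  qed (rule phi_eq)
qed

theorem cohen_macaulay_face_ring:
  fixes V :: "'v set"
  assumes inf: "infinite (UNIV :: 'k::field set)" and V: "finite V"
    and \<Delta>: "shellable d \<Delta>" "\<Delta> \<subseteq> Pow V"
  shows "cohen_macaulay (face_ring V \<Delta> :: (('v \<Rightarrow>\<^sub>0 nat) \<Rightarrow>\<^sub>0 'k) set ring)"
proof -
  let ?N = "nonface_set \<Delta> :: (('v \<Rightarrow>\<^sub>0 nat) \<Rightarrow>\<^sub>0 'k) set" and ?S = "mpoly_set V :: (('v \<Rightarrow>\<^sub>0 nat) \<Rightarrow>\<^sub>0 'k) set"
  let ?R = "face_ring V \<Delta> :: (('v \<Rightarrow>\<^sub>0 nat) \<Rightarrow>\<^sub>0 'k) set ring"
  let ?\<phi> = "face_class V \<Delta> :: (('v \<Rightarrow>\<^sub>0 nat) \<Rightarrow>\<^sub>0 'k) \<Rightarrow> _"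
  have dc: "down_closed \<Delta>" by (rule shellable_down_closed[OF \<Delta>(1)])
  interpret quotient_presentation ?R ?\<phi> ?N by (rule quotient_presentation_face_ring[OF V dc \<Delta>(2)])
  note S = subring_set_mpoly_set[of V, where 'b = 'k]
  have subN: "rmod.subspace ?N" by (rule subspace_nonface_set[OF dc])
  have fin\<Delta>: "finite \<Delta>" using \<Delta>(2) V finite_subset by blast
  have "noetherian_ring ?R"
  proof (rule noetherian_ringI)
    fix J assume J: "ideal J ?R"
    note vim = subspace_vimage[OF J]
    \<comment> \<open>Hilbert's theorem is available only for finitely many variables, so generators
      are sought among the polynomials over \<open>V\<close>; they suffice because every class has a
      representative there.\<close>
    obtain G where G: "finite G" "G \<subseteq> ?\<phi> -` J \<inter> ?S"
        "\<forall>K. ideal_in ?S K \<longrightarrow> G \<subseteq> K \<longrightarrow> ?\<phi> -` J \<inter> ?S \<subseteq> K"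
      using noetherian_setD[OF noetherian_set_mpoly_set[OF V] ideal_in_subspace_Int[OF S vim(1)]]
      by (elim exE conjE)
    let ?g = "rmod.span (?N \<union> G)"
    have "ideal_in ?S (?g \<inter> ?S)" by (rule ideal_in_subspace_Int[OF S rmod.subspace_span])
    moreover have "G \<subseteq> ?g \<inter> ?S" using G(2) rmod.span_superset[of "?N \<union> G"] by blast
    ultimately have le: "?\<phi> -` J \<inter> ?S \<subseteq> ?g" using G(3) by blast
    have "J \<subseteq> ?\<phi> ` ?g"
    proof
      fix x assume "x \<in> J"
      then obtain p where p: "p \<in> ?\<phi> -` J" "x = ?\<phi> p" using vim(3) by blast
      obtain s where s: "s \<in> ?S" "p - s \<in> ?N" using mpoly_set_representative[OF dc \<Delta>(2), of p] by blast
      have eq: "?\<phi> p = ?\<phi> s" using s(2) by (simp add: phi_eq)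
      then have "s \<in> ?g" using p s(1) le by auto
      then show "x \<in> ?\<phi> ` ?g" using p(2) eq by blast
    qed
    moreover have "?\<phi> ` ?g \<subseteq> J"
    proof -
      have "?g \<subseteq> ?\<phi> -` J" by (rule rmod.span_minimal[OF _ vim(1)]) (use vim(2) G(2) in blast)
      then show ?thesis by blast
    qed
    ultimately have "J = genideal ?R (?\<phi> ` G)" unfolding genideal_image[OF subN] by blast
    moreover have "?\<phi> ` G \<subseteq> carrier ?R" using phi_closed by blast
    ultimately show "\<exists>A\<subseteq>carrier ?R. finite A \<and> J = genideal ?R A" using G(1) by blast
  qed
  moreover have "ideal_depth ?R P = codimension ?R P" if P: "maximalideal P ?R" for P
  proof -
    have primeP: "primeideal P ?R" using P by (rule maximalideal_prime)
    note vim = prime_set_vimage[OF primeP]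
    have sub: "rmod.subspace (?\<phi> -` P)" by (rule prime_setD(1)[OF vim(1)])
    \<comment> \<open>The inverse modulo the preimage of \<open>P\<close> can be chosen over the
      finite set \<open>V\<close>, as the removal of variables in
      \<open>algebraic_mod_maximal\<close> requires.\<close>
    have max: "\<exists>e\<in>?S. 1 - z * e \<in> ?\<phi> -` P" if z: "z \<notin> ?\<phi> -` P" for z
    proof -
      obtain e where e: "1 - z * e \<in> ?\<phi> -` P" using maximalideal_vimage[OF P z] by (rule exE)
      obtain s where s: "s \<in> ?S" "e - s \<in> ?N" using mpoly_set_representative[OF dc \<Delta>(2), of e] by blast
      have "(1 - z * e) + z * (e - s) \<in> ?\<phi> -` P"
        using s(2) vim(2) by (intro rmod.subspace_add[OF sub e] rmod.subspace_scale[OF sub]) blast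
      then have "1 - z * s \<in> ?\<phi> -` P" by (simp add: algebra_simps)
      then show ?thesis using s(1) by blast
    qed
    have "\<forall>v\<in>V. \<exists>f. f \<noteq> 0 \<and> eval_at v f \<in> ?\<phi> -` P"
      using algebraic_mod_maximal[OF V _ vim(1) max] by blast
    then obtain f where f: "\<And>v. v \<in> V \<Longrightarrow> f v \<noteq> 0" "\<And>v. v \<in> V \<Longrightarrow> eval_at v (f v) \<in> ?\<phi> -` P"
      by metis
    obtain B where B: "finite B" "card B = card V" "B \<subseteq> (UNIV :: 'k set)"
      using infinite_arbitrarily_large[OF inf] by blast
    obtain a :: "'v \<Rightarrow> 'k" where a: "inj_on a V"
      using finite_same_card_bij[OF V B(1)] B(2) by (auto simp: bij_betw_def)
    define ps where "ps = map (vandermonde_comb V f (\<lambda>_. 1) a) [0..<d]"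
    have reg: "weakly_regular ?N ps"
      unfolding ps_def using \<Delta>(2) by (intro weakly_regular_shellable[OF \<Delta>(1) V _ a f(1)]) blast+
    have psP: "set ps \<subseteq> ?\<phi> -` P"
    proof
      fix p assume "p \<in> set ps"
      then obtain j where j: "p = vandermonde_comb V f (\<lambda>_. 1) a j" unfolding ps_def by auto
      show "p \<in> ?\<phi> -` P"
        unfolding j vandermonde_comb_def
      proof (intro rmod.subspace_sum[OF sub] rmod.subspace_scale[OF sub])
        fix v assume "v \<in> V"
        have "mvar v * eval_at v (f v) \<in> ?\<phi> -` P" by (rule rmod.subspace_scale[OF sub f(2)[OF \<open>v \<in> V\<close>]])
        then show "eval_at v (pCons 0 (f v)) \<in> ?\<phi> -` P" by (simp add: eval_at_pCons)
      qed
    qed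
    have "rmod.span (?N \<union> set ps) \<subseteq> ?\<phi> -` P"
      by (rule rmod.span_minimal[OF _ sub]) (use psP vim(2) in blast)
    then have "rmod.span (?N \<union> set ps) \<noteq> UNIV" using prime_setD(2)[OF vim(1)] by blast
    then have "regular_sequence ?R (map ?\<phi> ps)" using reg regular_sequence_map_iff[OF subN] by blast
    then have "enat (length ps) \<in> {enat (length xs) | xs. regular_sequence ?R xs \<and> set xs \<subseteq> P}"
      using psP by (intro CollectI exI[of _ "map ?\<phi> ps"]) auto
    then have "enat (length ps) \<le> ideal_depth ?R P" unfolding ideal_depth_def by (rule Sup_upper)
    then have "enat d \<le> ideal_depth ?R P" by (simp add: ps_def)
    moreover have "codimension ?R P \<le> enat d"
      by (rule codimension_le) (rule prime_chain_length_le[OF fin\<Delta> dc shellable_card[OF \<Delta>(1)]])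
    ultimately show ?thesis using depth_le_codimension[OF subN primeP] by order
  qed
  ultimately show ?thesis unfolding cohen_macaulay_def using cring_R by blast
qed

subsection \<open>Shelling the Gallai complex of a tree\<close>

lemma successively_crossing:
  assumes "successively R xs" "xs \<noteq> []" "hd xs \<in> A" "last xs \<notin> A"
  shows "\<exists>a\<in>set xs \<inter> A. \<exists>b\<in>set xs - A. R a b"
  using assms
proof (induction xs)
  case (Cons x xs)
  then have "xs \<noteq> []" by auto
  show ?case
  proof (cases "hd xs \<in> A")
    case True
    then obtain a b where "a \<in> set xs \<inter> A" "b \<in> set xs - A" "R a b"
      using Cons \<open>xs \<noteq> []\<close> by (auto simp: successively_Cons)
    then show ?thesis by auto
  next
    case False
    have "R x (hd xs)" using Cons.prems(1) \<open>xs \<noteq> []\<close> by (simp add: successively_Cons)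
    then show ?thesis
      using False Cons.prems(3) \<open>xs \<noteq> []\<close> by (intro bexI[of _ x] bexI[of _ "hd xs"]) auto
  qed
qed simp

text \<open>Distinctness is demanded so that closing such a walk through a vertex outside
  \<open>W\<close> yields a \<open>graph_cycle\<close>.\<close>

definition joined :: "'a ugraph \<Rightarrow> 'a set \<Rightarrow> 'a \<Rightarrow> 'a \<Rightarrow> bool" where
  "joined T W u v \<longleftrightarrow> (\<exists>xs. walk T xs \<and> set xs \<subseteq> W \<and> distinct xs \<and> hd xs = u \<and> last xs = v)"

text \<open>Generated by the vertex sets of paths with two edges inside \<open>W\<close>.
  Restricting to \<open>W\<close> lets the tree be grown. Without such a path it is the void
  complex, lacking even the empty face.\<close>

definition path_complex :: "'a ugraph \<Rightarrow> 'a set \<Rightarrow> 'a set set" where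
  "path_complex T W = {A. \<exists>i j k. {i, j, k} \<subseteq> W \<and> {i, j} \<in> edges T \<and> {j, k} \<in> edges T \<and> i \<noteq> k \<and> A \<subseteq> {i, j, k}}"

context
  fixes T :: "'a ugraph"
  assumes T: "tree T"
begin

section \<open>Paths and cycles in a tree\<close>

lemma edge_verts: "{u, v} \<in> edges T \<Longrightarrow> u \<in> verts T \<and> v \<in> verts T \<and> u \<noteq> v"
  using T unfolding tree_def simple_graph_def by force

lemma edge_cases:
  assumes "e \<in> edges T"
  obtains u v where "e = {u, v}" "u \<noteq> v" "u \<in> verts T" "v \<in> verts T"
proof -
  have "card e = 2" "e \<subseteq> verts T" using T assms unfolding tree_def simple_graph_def by blast+
  then show ?thesis using that by (auto simp: card_2_iff)
qed

lemma finite_verts: "finite (verts T)" and verts_nonempty: "verts T \<noteq> {}"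
  using T unfolding tree_def simple_graph_def graph_connected_def by blast+

lemma no_cycle: "\<not> graph_cycle T xs"
  using T unfolding tree_def by blast

lemma verts_crossing:
  assumes "A \<subseteq> verts T" "A \<noteq> {}" "A \<noteq> verts T"
  shows "\<exists>a\<in>A. \<exists>b\<in>verts T - A. {a, b} \<in> edges T"
proof -
  obtain u v where uv: "u \<in> A" "v \<in> verts T" "v \<notin> A" using assms by blast
  then obtain xs where xs: "walk T xs" "hd xs = u" "last xs = v"
    using T assms(1) unfolding tree_def graph_connected_def by blast
  have "\<exists>a\<in>set xs \<inter> A. \<exists>b\<in>set xs - A. {a, b} \<in> edges T"
    using xs uv by (intro successively_crossing) (auto simp: walk_def)
  then show ?thesis using xs(1) unfolding walk_def by blast
qed

lemma joined_crossing:
  assumes "\<forall>u\<in>W. \<forall>v\<in>W. joined T W u v" "A \<subseteq> W" "A \<noteq> {}" "A \<noteq> W"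
  shows "\<exists>a\<in>A. \<exists>b\<in>W - A. {a, b} \<in> edges T"
proof -
  obtain u v where uv: "u \<in> A" "v \<in> W" "v \<notin> A" using assms by blast
  then obtain xs where xs: "walk T xs" "set xs \<subseteq> W" "hd xs = u" "last xs = v"
    using assms(1,2) unfolding joined_def by blast
  have "\<exists>a\<in>set xs \<inter> A. \<exists>b\<in>set xs - A. {a, b} \<in> edges T"
    using xs uv by (intro successively_crossing) (auto simp: walk_def)
  then show ?thesis using xs(2) by blast
qed

lemma no_triangle:
  assumes "{i, j} \<in> edges T" "{j, k} \<in> edges T" "i \<noteq> k"
  shows "{i, k} \<notin> edges T"
proof
  assume "{i, k} \<in> edges T"
  then have "graph_cycle T [i, j, k]"
    using assms edge_verts[OF assms(1)] edge_verts[OF assms(2)]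
    by (simp add: graph_cycle_def walk_def insert_commute)
  then show False using no_cycle by blast
qed

text \<open>Two different neighbours of \<open>l\<close> in \<open>W\<close> are linked by a path
  inside \<open>W\<close>, and \<open>l\<close> would close it to a cycle.\<close>

lemma unique_attachment:
  assumes W: "W \<subseteq> verts T" "\<forall>u\<in>W. \<forall>v\<in>W. joined T W u v"
    and l: "l \<notin> W" and v: "v \<in> W" "{v, l} \<in> edges T" and u: "u \<in> W" "{u, l} \<in> edges T"
  shows "u = v"
proof (rule ccontr)
  assume "u \<noteq> v"
  obtain xs where xs: "walk T xs" "set xs \<subseteq> W" "distinct xs" "hd xs = v" "last xs = u"
    using W(2) u(1) v(1) unfolding joined_def by blast
  have ne: "xs \<noteq> []" using xs(1) by (simp add: walk_def)
  have "length xs \<ge> 2"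
  proof (rule ccontr)
    assume "\<not> length xs \<ge> 2"
    obtain x ys where x: "xs = x # ys" using ne by (cases xs) auto
    have "ys = []" using \<open>\<not> length xs \<ge> 2\<close> unfolding x by (cases ys) simp_all
    then show False using xs(4,5) \<open>u \<noteq> v\<close> unfolding x by simp
  qed
  moreover have "walk T (xs @ [l])"
    using xs(1,5) ne u(2) edge_verts[OF u(2)] unfolding walk_def by (simp add: successively_append_iff)
  moreover have "distinct (xs @ [l])" using xs(2,3) l by auto
  moreover have "{last (xs @ [l]), hd (xs @ [l])} \<in> edges T"
    using v(2) xs(4) ne by (simp add: insert_commute)
  ultimately have "graph_cycle T (xs @ [l])" by (simp add: graph_cycle_def)
  then show False using no_cycle by blast
qed

lemma joined_insert:
  assumes W: "W \<subseteq> verts T" "\<forall>u\<in>W. \<forall>v\<in>W. joined T W u v"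
    and l: "l \<notin> W" and v: "v \<in> W" "{v, l} \<in> edges T"
  shows "\<forall>a\<in>insert l W. \<forall>b\<in>insert l W. joined T (insert l W) a b"
proof (intro ballI)
  have lV: "l \<in> verts T" using edge_verts[OF v(2)] by blast
  fix a b assume "a \<in> insert l W" "b \<in> insert l W"
  then consider "a \<in> W" "b \<in> W" | "a \<in> W" "b = l" | "a = l" "b \<in> W" | "a = l" "b = l" by blast
  then show "joined T (insert l W) a b"
  proof cases
    case 1
    then show ?thesis using W(2) unfolding joined_def by blast
  next
    case 2
    obtain xs where xs: "walk T xs" "set xs \<subseteq> W" "distinct xs" "hd xs = a" "last xs = v"
      using W(2) 2 v(1) unfolding joined_def by blast
    have "walk T (xs @ [l])"
      using xs(1,5) v(2) lV unfolding walk_def by (simp add: successively_append_iff)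
    then show ?thesis
      unfolding joined_def using xs 2(2) l by (intro exI[of _ "xs @ [l]"]) (auto simp: walk_def)
  next
    case 3
    obtain xs where xs: "walk T xs" "set xs \<subseteq> W" "distinct xs" "hd xs = v" "last xs = b"
      using W(2) 3 v(1) unfolding joined_def by blast
    have "walk T (l # xs)"
      using xs(1,4) v(2) lV unfolding walk_def by (simp add: successively_Cons insert_commute)
    then show ?thesis
      unfolding joined_def using xs 3(1) l by (intro exI[of _ "l # xs"]) (auto simp: walk_def)
  next
    case 4
    then show ?thesis unfolding joined_def using lV by (intro exI[of _ "[l]"]) (simp add: walk_def)
  qed
qed

text \<open>As \<open>W\<close> is connected and has a further vertex, some edge leaves
  \<open>{v, k}\<close>; together with the edge \<open>{v, k}\<close> it forms a path on three
  vertices.\<close>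

lemma edge_in_path_complex:
  assumes "\<forall>u\<in>W. \<forall>v\<in>W. joined T W u v" "v \<in> W" "k \<in> W" "{v, k} \<in> edges T" "W \<noteq> {v, k}"
  shows "{v, k} \<in> path_complex T W"
proof -
  obtain a b where ab: "a \<in> {v, k}" "b \<in> W - {v, k}" "{a, b} \<in> edges T"
    using joined_crossing[OF assms(1), of "{v, k}"] assms(2,3,5) by blast
  show ?thesis
  proof (cases "a = v")
    case True
    then have "{b, v, k} \<subseteq> W \<and> {b, v} \<in> edges T \<and> {v, k} \<in> edges T \<and> b \<noteq> k \<and> {v, k} \<subseteq> {b, v, k}"
      using ab assms(2,3,4) by (auto simp: insert_commute)
    then show ?thesis unfolding path_complex_def by blast
  next
    case False
    then have "{v, k, b} \<subseteq> W \<and> {v, k} \<in> edges T \<and> {k, b} \<in> edges T \<and> v \<noteq> b \<and> {v, k} \<subseteq> {v, k, b}"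
      using ab assms(2,3,4) by auto
    then show ?thesis unfolding path_complex_def by blast
  qed
qed

lemma path_complex_subset: "A \<in> path_complex T W \<Longrightarrow> A \<subseteq> W"
  unfolding path_complex_def by blast

lemma path_complex_downward: "A \<in> path_complex T W \<Longrightarrow> B \<subseteq> A \<Longrightarrow> B \<in> path_complex T W"
  unfolding path_complex_def by blast

text \<open>Also used with \<open>v = k\<close>, for a single vertex.\<close>

lemma path_complex_pair: "path_complex T {v, k} = {}"
proof -
  have False if "{i, j, m} \<subseteq> {v, k}" "{i, j} \<in> edges T" "{j, m} \<in> edges T" "i \<noteq> m" for i j m
    using that edge_verts[OF that(2)] edge_verts[OF that(3)] by auto
  then show ?thesis unfolding path_complex_def by blast
qed

text \<open>Since \<open>v\<close> is the only neighbour of \<open>l\<close>, the vertex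
  \<open>l\<close> can only be an end of a new path, and \<open>v\<close> is then its
  middle.\<close>

lemma path_complex_insert:
  assumes W: "W \<subseteq> verts T" "\<forall>u\<in>W. \<forall>v\<in>W. joined T W u v"
    and l: "l \<notin> W" and v: "v \<in> W" "{v, l} \<in> edges T"
  shows "path_complex T (insert l W) =
    path_complex T W \<union> (\<Union>k\<in>{k\<in>W. {v, k} \<in> edges T}. Pow {l, v, k})" (is "_ = _ \<union> ?N")
proof
  have unique: "u = v" if "u \<in> insert l W" "{u, l} \<in> edges T" for u
    using unique_attachment[OF W l v, of u] that edge_verts[OF that(2)] by blast
  show "path_complex T (insert l W) \<subseteq> path_complex T W \<union> ?N"
  proof
    fix A assume "A \<in> path_complex T (insert l W)"
    then obtain i j k where ijk: "{i, j, k} \<subseteq> insert l W" "{i, j} \<in> edges T" "{j, k} \<in> edges T" "i \<noteq> k"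
        "A \<subseteq> {i, j, k}"
      unfolding path_complex_def by blast
    have ji: "{j, i} \<in> edges T" and kj: "{k, j} \<in> edges T" using ijk(2,3) by (simp_all add: insert_commute)
    have "j \<noteq> l" using unique[of i] unique[of k] ijk kj by blast
    show "A \<in> path_complex T W \<union> ?N"
    proof (cases "i = l")
      case True
      then have "j = v" using unique[of j] ijk(1) ji by blast
      moreover have "k \<in> W" using ijk(1,4) True by blast
      ultimately show ?thesis using ijk(3,5) True by blast
    next
      case iW: False
      show ?thesis
      proof (cases "k = l")
        case True
        then have "j = v" using unique[of j] ijk(1,3) by blast
        moreover have "i \<in> W" using ijk(1,4) True by blast
        ultimately show ?thesis using ji ijk(5) True by blast
      next
        case False
        then have "{i, j, k} \<subseteq> W" using ijk(1) iW \<open>j \<noteq> l\<close> by blast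
        then show ?thesis using ijk unfolding path_complex_def by blast
      qed
    qed
  qed
  show "path_complex T W \<union> ?N \<subseteq> path_complex T (insert l W)"
  proof (rule Un_least)
    show "path_complex T W \<subseteq> path_complex T (insert l W)" unfolding path_complex_def by blast
    show "?N \<subseteq> path_complex T (insert l W)"
    proof
      fix A assume "A \<in> ?N"
      then obtain k where k: "k \<in> W" "{v, k} \<in> edges T" "A \<subseteq> {l, v, k}" by blast
      have "{l, v, k} \<subseteq> insert l W \<and> {l, v} \<in> edges T \<and> {v, k} \<in> edges T \<and> l \<noteq> k \<and> A \<subseteq> {l, v, k}"
        using k v l by (auto simp: insert_commute)
      then show "A \<in> path_complex T (insert l W)" unfolding path_complex_def by blast
    qed
  qed
qed

text \<open>The restriction of the facet \<open>{l, v, k}\<close> depends on what is already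
  covered. If \<open>W\<close> is the single edge \<open>{v, k}\<close>, the old complex is void and
  the restriction is empty. Otherwise \<open>{v, k}\<close> is an old face: for the first
  \<open>k\<close> it is the whole intersection with the old complex, and the restriction is
  \<open>{l}\<close>; for later ones \<open>{l, v}\<close> is covered as well, and the restriction
  is \<open>{l, k}\<close>.\<close>

lemma shellable_path_complex_insert:
  assumes W: "W \<subseteq> verts T" "\<forall>u\<in>W. \<forall>v\<in>W. joined T W u v"
    and l: "l \<notin> W" and v: "v \<in> W" "{v, l} \<in> edges T"
    and shell: "shellable 3 (path_complex T W)"
  shows "shellable 3 (path_complex T (insert l W))"
proof -
  let ?\<Delta> = "path_complex T W"
  have "shellable 3 (?\<Delta> \<union> (\<Union>k\<in>M. Pow {l, v, k}))"
    if "M \<subseteq> {k\<in>W. {v, k} \<in> edges T}" "finite M" for M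
    using that(2,1)
  proof (induction M rule: finite_induct)
    case empty
    then show ?case using shell by simp
  next
    case (insert k M)
    let ?F = "{l, v, k}" and ?\<Delta>' = "?\<Delta> \<union> (\<Union>k\<in>M. Pow {l, v, k})"
    have k: "k \<in> W" "{v, k} \<in> edges T" using insert.prems by auto
    have neq: "l \<noteq> v" "l \<noteq> k" "v \<noteq> k" using l k v(1) edge_verts[OF k(2)] by auto
    have l\<Delta>: "l \<notin> A" if "A \<in> ?\<Delta>" for A using path_complex_subset[OF that] l by blast
    have shell': "shellable 3 ?\<Delta>'" using insert.IH insert.prems by blast
    have "\<exists>R\<subseteq>?F. \<forall>A\<subseteq>?F. A \<in> ?\<Delta>' \<longleftrightarrow> \<not> R \<subseteq> A"
    proof (cases "W = {v, k}")
      case True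
      have "M \<subseteq> {v, k}" using insert.prems True by blast
      moreover have "v \<notin> M" using insert.prems edge_verts by blast
      ultimately have "M = {}" using insert.hyps(2) by blast
      then have "?\<Delta>' = {}" using path_complex_pair True by simp
      then show ?thesis by (intro exI[of _ "{}"]) simp
    next
      case False
      have "{v, k} \<in> ?\<Delta>" by (rule edge_in_path_complex[OF W(2) v(1) k False])
      then have vk: "A \<in> ?\<Delta>" if "A \<subseteq> {v, k}" for A using path_complex_downward that by blast
      show ?thesis
      proof (cases "M = {}")
        case True
        have "A \<in> ?\<Delta> \<longleftrightarrow> \<not> {l} \<subseteq> A" if "A \<subseteq> ?F" for A
          using l\<Delta>[of A] vk[of A] that by blast
        then show ?thesis using True by (intro exI[of _ "{l}"]) simp
      next
        case False
        then obtain k' where k': "k' \<in> M" by blast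
        have "A \<in> ?\<Delta>' \<longleftrightarrow> \<not> {l, k} \<subseteq> A" if A: "A \<subseteq> ?F" for A
        proof
          assume A': "A \<in> ?\<Delta>'"
          show "\<not> {l, k} \<subseteq> A"
          proof
            assume lk: "{l, k} \<subseteq> A"
            then have "A \<notin> ?\<Delta>" using l\<Delta> by blast
            then obtain k'' where "k'' \<in> M" "A \<subseteq> {l, v, k''}" using A' by blast
            then have "k = k''" using lk neq by blast
            then show False using \<open>k'' \<in> M\<close> insert.hyps(2) by blast
          qed
        next
          assume "\<not> {l, k} \<subseteq> A"
          then consider "A \<subseteq> {v, k}" | "A \<subseteq> {l, v, k'}" using A by blast
          then show "A \<in> ?\<Delta>'"
          proof cases
            case 1
            then show ?thesis using vk by blast
          next
            case 2
            then show ?thesis using k' by blast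
          qed
        qed
        then show ?thesis by (intro exI[of _ "{l, k}"]) simp
      qed
    qed
    then obtain R where R: "R \<subseteq> ?F" "\<And>A. A \<subseteq> ?F \<Longrightarrow> A \<in> ?\<Delta>' \<longleftrightarrow> \<not> R \<subseteq> A" by blast
    have "shellable 3 (?\<Delta>' \<union> Pow ?F)"
      by (rule shellable_step[OF shell' _ _ R]) (use neq in auto)
    moreover have "?\<Delta>' \<union> Pow ?F = ?\<Delta> \<union> (\<Union>k\<in>insert k M. Pow {l, v, k})" by blast
    ultimately show ?case by simp
  qed
  moreover have "finite {k\<in>W. {v, k} \<in> edges T}" using W(1) finite_verts finite_subset by fastforce
  ultimately show ?thesis unfolding path_complex_insert[OF W l v] by blast
qed

text \<open>The tree is grown from one vertex along edges leaving the current set, which takes the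
  place of stripping leaves; the induction runs over the number of vertices reached.\<close>

lemma shellable_path_complex: "shellable 3 (path_complex T (verts T))"
proof -
  have "\<exists>W\<subseteq>verts T. card W = m \<and> (\<forall>u\<in>W. \<forall>v\<in>W. joined T W u v) \<and> shellable 3 (path_complex T W)"
    if "1 \<le> m" "m \<le> card (verts T)" for m
    using that
  proof (induction m rule: nat_induct_at_least)
    case base
    obtain r where r: "r \<in> verts T" using verts_nonempty by blast
    have "joined T {r} r r" unfolding joined_def using r by (intro exI[of _ "[r]"]) (simp add: walk_def)
    moreover have "shellable 3 (path_complex T {r})" using path_complex_pair[of r r] shellable_empty by simp
    ultimately show ?case using r by (intro exI[of _ "{r}"]) simp
  next
    case (Suc m)
    then obtain W where W: "W \<subseteq> verts T" "card W = m" "\<forall>u\<in>W. \<forall>v\<in>W. joined T W u v"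
        "shellable 3 (path_complex T W)" by auto
    have "W \<noteq> {}" "W \<noteq> verts T" using W(2) Suc.hyps Suc.prems by auto
    then obtain v l where vl: "v \<in> W" "l \<in> verts T - W" "{v, l} \<in> edges T"
      using verts_crossing[OF W(1)] by blast
    have l: "l \<notin> W" using vl(2) by blast
    have "finite W" using W(1) finite_verts finite_subset by blast
    then have "card (insert l W) = Suc m" using W(2) l by simp
    then show ?case
      using W(1) vl(2) joined_insert[OF W(1,3) l vl(1,3)]
        shellable_path_complex_insert[OF W(1,3) l vl(1,3) W(4)]
      by (intro exI[of _ "insert l W"]) simp
  qed
  from this[of "card (verts T)"] obtain W where "W \<subseteq> verts T" "card W = card (verts T)"
      "shellable 3 (path_complex T W)"
    using finite_verts verts_nonempty by (auto simp: Suc_le_eq card_gt_0_iff)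
  then show ?thesis using card_subset_eq[OF finite_verts] by metis
qed

text \<open>A tree has no triangles, so incidence of distinct edges already makes them adjacent in
  the Gallai graph.\<close>

lemma gallai_edge_iff:
  "{{i, j}, {j, k}} \<in> edges (gallai_graph T) \<longleftrightarrow> {i, j} \<in> edges T \<and> {j, k} \<in> edges T \<and> i \<noteq> k"
proof
  assume "{{i, j}, {j, k}} \<in> edges (gallai_graph T)"
  then obtain e f where ef: "{{i, j}, {j, k}} = {e, f}" "e \<in> edges T" "f \<in> edges T" "e \<noteq> f"
    unfolding gallai_graph_def edges_def by auto
  then have "{i, j} \<in> edges T" "{j, k} \<in> edges T" "{i, j} \<noteq> {j, k}" by (auto simp: doubleton_eq_iff)
  then show "{i, j} \<in> edges T \<and> {j, k} \<in> edges T \<and> i \<noteq> k" by (auto simp: insert_commute)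
next
  assume ijk: "{i, j} \<in> edges T \<and> {j, k} \<in> edges T \<and> i \<noteq> k"
  then have neq: "i \<noteq> j" "j \<noteq> k" using edge_verts by blast+
  have "{i, k} \<notin> edges T" using no_triangle ijk by blast
  then have "\<not> span_triangle T {i, j} {j, k}" unfolding span_triangle_def using ijk by blast
  moreover have "{i, j} \<noteq> {j, k}" using ijk neq by (auto simp: doubleton_eq_iff)
  ultimately have "\<exists>e f. {{i, j}, {j, k}} = {e, f} \<and> e \<in> edges T \<and> f \<in> edges T \<and> e \<noteq> f \<and> e \<inter> f \<noteq> {} \<and>
      \<not> span_triangle T e f"
    using ijk by (intro exI[of _ "{i, j}"] exI[of _ "{j, k}"]) simp
  then show "{{i, j}, {j, k}} \<in> edges (gallai_graph T)"
    unfolding gallai_graph_def edges_def by simp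
qed

text \<open>If the tree has a vertex off the edge \<open>{i, j}\<close>, connectedness provides an
  edge leaving \<open>{i, j}\<close>, and this is a neighbour in the Gallai graph.\<close>

lemma isolated_iff:
  "isolated_vertex (gallai_graph T) {i, j} \<longleftrightarrow> verts T = {i, j} \<and> {i, j} \<in> edges T"
proof
  assume iso: "isolated_vertex (gallai_graph T) {i, j}"
  then have e: "{i, j} \<in> edges T" and none: "\<forall>E\<in>edges (gallai_graph T). {i, j} \<notin> E"
    unfolding isolated_vertex_def gallai_graph_def verts_def edges_def by simp_all
  have "verts T = {i, j}"
  proof (rule ccontr)
    assume "verts T \<noteq> {i, j}"
    then obtain a b where ab: "a \<in> {i, j}" "b \<in> verts T - {i, j}" "{a, b} \<in> edges T"
      using verts_crossing[of "{i, j}"] edge_verts[OF e] by blast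
    have ji: "{j, i} \<in> edges T" using e by (simp add: insert_commute)
    show False
    proof (cases "a = i")
      case True
      then have "{{j, i}, {i, b}} \<in> edges (gallai_graph T)" using gallai_edge_iff[of j i b] ji ab by auto
      then show False using none by (auto simp: insert_commute)
    next
      case False
      then have "{{i, j}, {j, b}} \<in> edges (gallai_graph T)" using gallai_edge_iff[of i j b] e ab by auto
      then show False using none by auto
    qed
  qed
  then show "verts T = {i, j} \<and> {i, j} \<in> edges T" using e by blast
next
  assume V: "verts T = {i, j} \<and> {i, j} \<in> edges T"
  have only: "e = {i, j}" if "e \<in> edges T" for e
    using that V by (elim edge_cases) auto
  have "edges (gallai_graph T) = {}"
    using only unfolding gallai_graph_def edges_def snd_conv by blast
  then show "isolated_vertex (gallai_graph T) {i, j}"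
    using V unfolding isolated_vertex_def by (simp add: gallai_graph_def verts_def)
qed

text \<open>The condition \<open>verts T \<in> edges T\<close> says that \<open>T\<close> is a
  single edge; the second set is then the full simplex on its two vertices, and otherwise it is
  empty. A tree with one vertex has the void complex.\<close>

lemma gallai_complex_eq:
  "gallai_complex T = path_complex T (verts T) \<union> {A. A \<subseteq> verts T \<and> verts T \<in> edges T}"
proof -
  have "A \<in> gallai_complex T \<longleftrightarrow> (\<exists>i j k. {i, j} \<in> edges T \<and> {j, k} \<in> edges T \<and> i \<noteq> k \<and> A \<subseteq> {i, j, k}) \<or>
      (\<exists>i j. verts T = {i, j} \<and> {i, j} \<in> edges T \<and> A \<subseteq> {i, j})" for A
  proof -
    have "A \<in> gallai_complex T \<longleftrightarrow>
        (\<exists>F. ((\<exists>i j k. F = {i, j, k} \<and> {{i, j}, {j, k}} \<in> edges (gallai_graph T)) \<or>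
          (\<exists>i j. F = {i, j} \<and> isolated_vertex (gallai_graph T) {i, j})) \<and> A \<subseteq> F)"
      by (simp only: gallai_complex_def gallai_indices_def mem_Collect_eq Bex_def Un_iff)
    also have "\<dots> \<longleftrightarrow> (\<exists>i j k. {{i, j}, {j, k}} \<in> edges (gallai_graph T) \<and> A \<subseteq> {i, j, k}) \<or>
        (\<exists>i j. isolated_vertex (gallai_graph T) {i, j} \<and> A \<subseteq> {i, j})"
      by metis
    finally show ?thesis unfolding gallai_edge_iff isolated_iff by simp
  qed
  moreover have "(\<exists>i j k. {i, j} \<in> edges T \<and> {j, k} \<in> edges T \<and> i \<noteq> k \<and> A \<subseteq> {i, j, k}) \<longleftrightarrow>
      A \<in> path_complex T (verts T)" for A
  proof -
    have "{i, j, k} \<subseteq> verts T" if "{i, j} \<in> edges T" "{j, k} \<in> edges T" for i j k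
      using edge_verts[OF that(1)] edge_verts[OF that(2)] by simp
    then show ?thesis unfolding path_complex_def mem_Collect_eq by meson
  qed
  moreover have "(\<exists>i j. verts T = {i, j} \<and> {i, j} \<in> edges T \<and> A \<subseteq> {i, j}) \<longleftrightarrow> A \<subseteq> verts T \<and> verts T \<in> edges T" for A
  proof
    assume A: "A \<subseteq> verts T \<and> verts T \<in> edges T"
    then obtain i j where "verts T = {i, j}" using edge_cases by metis
    then show "\<exists>i j. verts T = {i, j} \<and> {i, j} \<in> edges T \<and> A \<subseteq> {i, j}" using A by auto
  qed auto
  ultimately show ?thesis by auto
qed

text \<open>Facets have two vertices for a single edge and three for larger trees; the void complex
  of a one-vertex tree falls under the second case.\<close>

lemma shellable_gallai_complex: "\<exists>d. shellable d (gallai_complex T)"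
proof (cases "verts T \<in> edges T")
  case True
  then obtain u v where uv: "verts T = {u, v}" "u \<noteq> v" by (rule edge_cases)
  have "gallai_complex T = {} \<union> Pow {u, v}"
    unfolding gallai_complex_eq uv(1) using path_complex_pair True uv(1) by auto
  moreover have "shellable 2 ({} \<union> Pow {u, v})"
    by (rule shellable_step[OF shellable_empty, where R = "{}"]) (use uv(2) in auto)
  ultimately show ?thesis by metis
next
  case False
  then show ?thesis using shellable_path_complex unfolding gallai_complex_eq by auto
qed

lemma gallai_complex_subset: "gallai_complex T \<subseteq> Pow (verts T)"
  unfolding gallai_complex_eq using path_complex_subset by blast

end

theorem theorem4p9:
  fixes T :: "nat ugraph" and n :: nat
  assumes "infinite (UNIV :: 'k::field set)"
    and "tree T" and "verts T = {1..n}"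
  shows "cohen_macaulay
    (face_ring {1..n} (gallai_complex T) :: ((nat \<Rightarrow>\<^sub>0 nat) \<Rightarrow>\<^sub>0 'k) set ring)"
proof -
  obtain d where "shellable d (gallai_complex T)"
    using shellable_gallai_complex[OF assms(2)] by blast
  moreover have "gallai_complex T \<subseteq> Pow {1..n}"
    using gallai_complex_subset[OF assms(2)] unfolding assms(3) .
  ultimately show ?thesis
    by (intro cohen_macaulay_face_ring[OF assms(1)]) simp_all
qed

end
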